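(* Let $0<\alpha\le 1$ and $T>0$ be fixed, let $0\le\beta\le 2$, let $m\ge 2$ be an integer, and for $0<\varepsilon\le 1$ put $T_\varepsilon=T/\varepsilon^{\beta}$. Let $\psi=\psi(x,t)$ be the exact solution on $[0,T_\varepsilon]$ of $$i\partial_t\psi-\alpha\,\partial_{tt}\psi+\partial_{xx}\psi-\varepsilon^2|\psi|^2\psi=0,\quad x\in\Omega=(a,b),\ t>0,$$ with initial data $\psi(x,0)=\psi_0(x)$, $\partial_t\psi(x,0)=\psi_1(x)$ and periodic boundary conditions $\psi(a,t)=\psi(b,t)$, $\partial_x\psi(a,t)=\partial_x\psi(b,t)$. Assume, uniformly in $\varepsilon\in(0,1]$, $$\text{(A)}\quad \|\psi\|_{L^\infty([0,T_\varepsilon];W^{1,\infty}\cap H^m)}+\|\partial_t\psi\|_{L^\infty([0,T_\varepsilon];H^1)}+\|\partial_{tt}\psi\|_{L^\infty([0,T_\varepsilon];H^1)}\lesssim 1,$$ $$\text{(B)}\quad \|\psi_0\|_{H^{m+2}}\lesssim 1,$$ and put $M_1=\sup_{\varepsilon\in(0,1]}\sup_{t\in[0,T_\varepsilon]}\|\psi(\cdot,t)\|_{L^\infty}$. Let $\psi^n\in X_M$ be the numerical approximation of $\psi(\cdot,t_n)$ produced by the EWI-FP scheme (defined in the context) with mesh size $h$ and time step $\tau$. Then there exist constants $h_0>0$ and $\tau_0>0$, sufficiently small and independent of $\varepsilon$, such that for all $0<h<h_0$, $0<\tau<\tau_0$ and all $0<\varepsilon\le 1$, $$\|\psi(x,t_n)-I_M\psi^n\|_{H^1}\lesssim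 h^{m-1}+\varepsilon^{2-\beta}\tau^2,\qquad \|\psi^n\|_{l^\infty}\le 1+M_1,\qquad 0\le n\le\frac{T/\varepsilon^{\beta}}{\tau}.$$
   Context: Convention: $A\lesssim B$ means $|A|\le CB$ with a constant $C>0$ independent of $h$, $\tau$, $\varepsilon$ (and of the time index $n$). The solution $\psi$ depends on $\varepsilon$. Spaces and operators. $\mu_l=2\pi l/(b-a)$. $H^m(\Omega)$ is the space of $u(x)=\sum_{l\in\mathbb Z}\widehat u_l e^{i\mu_l(x-a)}\in L^2(\Omega)$ with $\|u\|_{H^m}^2=\sum_{l\in\mathbb Z}(1+\mu_l^2)^m|\widehat u_l|^2<\infty$ (periodic Sobolev space). $M$ is an even positive integer, $h=(b-a)/M$, $x_j=a+jh$ for $j=0,\dots,M$; $\tau>0$, $t_n=n\tau$. $\mathcal T_M=\{-M/2,-M/2+1,\dots,M/2-1\}$; $X_M=\{u=(u_0,\dots,u_M)^T\in\mathbb C^{M+1}: u_0=u_M\}$; $Y_M=\mathrm{span}\{e^{i\mu_l(x-a)}: l\in\mathcal T_M\}$. For $u\in X_M$, or a continuous periodic function $u$ (with $u_j=u(x_j)$): $\widetilde u_l=\frac1M\sum_{j=0}^{M-1}u_je^{-i\mu_l(x_j-a)}$ for $l\in\mathcal T_M$, and $I_Mu(x)=\sum_{l\in\mathcal T_M}\widetilde u_le^{i\mu_l(x-a)}$. $\|\phi\|_{l^\infty}=\max_{0\le j\le M-1}|\phi_j|$ on $X_M$. $\mathrm{sinc}(s)=\sin(s)/s$ for $s\ne0$,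 $\mathrm{sinc}(0)=1$. EWI-FP scheme. Let $f(v)=|v|^2v$ (applied componentwise to vectors), and for $l\in\mathcal T_M$ $$\beta_l^\pm=\frac{1\pm\sqrt{1+4\alpha\mu_l^2}}{2\alpha},\quad \beta_l=\beta_l^+-\beta_l^-=\frac{\sqrt{1+4\alpha\mu_l^2}}{\alpha},\quad \sigma_l^\pm(\tau)=e^{i\beta_l^\pm\tau/2}\,\mathrm{sinc}(\beta_l^\pm\tau/2).$$ Coefficients: $$c_l^0=\frac{\beta_l^+e^{i\beta_l^-\tau}-\beta_l^-e^{i\beta_l^+\tau}}{\beta_l},\quad d_l^0=\tau e^{\frac{i\tau}{2\alpha}}\mathrm{sinc}(\tau\beta_l/2),\quad c_l=-e^{\frac{i\tau}{\alpha}},\quad d_l=2e^{\frac{i\tau}{2\alpha}}\cos(\tau\beta_l/2),$$ $$p_l=\frac{i\varepsilon^2\tau}{\alpha\beta_l}\big(\sigma_l^+(\tau)-\sigma_l^-(\tau)\big),\quad p_l^*=\frac{i\varepsilon^2\tau e^{i\tau/\alpha}}{\alpha\beta_l}\big(\overline{\sigma_l^+(\tau)}-\overline{\sigma_l^-(\tau)}\big)$$ (for $l=0$, $\beta_0^-=0$ and $\sigma_0^-(\tau)=1$); for $l\ne0$ $$q_l=\frac{-\varepsilon^2\tau}{\alpha\beta_l}\Big(\frac{1-\sigma_l^+(\tau)}{\beta_l^+}-\frac{1-\sigma_l^-(\tau)}{\beta_l^-}\Big),\quad q_l^*=\frac{-\varepsilon^2\tau e^{i\tau/\alpha}}{\alpha\beta_l}\Big(\frac{1-\sigma_l^+(\tau)}{\beta_l^+e^{i\beta_l^+\tau}}-\frac{1-\sigma_l^-(\tau)}{\beta_l^-e^{i\beta_l^-\tau}}\Big),$$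 and $$q_0=\frac{-\varepsilon^2\tau}{\alpha\beta_0}\Big(\frac{1-\sigma_0^+(\tau)}{\beta_0^+}+\frac{i\tau}{2}\Big),\quad q_0^*=\frac{-\varepsilon^2\tau e^{i\tau/\alpha}}{\alpha\beta_0}\Big(\frac{1-\sigma_0^+(\tau)}{\beta_0^+e^{i\beta_0^+\tau}}+\frac{i\tau}{2}\Big).$$ Set $\psi_j^0=\psi_0(x_j)$, and for $n\ge0$ define $\psi^{n+1}\in X_M$ by $\psi_j^{n+1}=\sum_{l\in\mathcal T_M}\widetilde{(\psi^{n+1})}_le^{i\mu_l(x_j-a)}$, $0\le j\le M$, where $$\widetilde{(\psi^1)}_l=c_l^0\widetilde{(\psi_0)}_l+d_l^0\widetilde{(\psi_1)}_l+p_l\widetilde{(f(\psi_0))}_l+q_l\widetilde{(g(\psi_0))}_l,$$ $$\widetilde{(\psi^{n+1})}_l=c_l\widetilde{(\psi^{n-1})}_l+d_l\widetilde{(\psi^n)}_l+p_l\widetilde{(f(\psi^n))}_l+q_l\widetilde{(g(\psi^n))}_l-p_l^*\widetilde{(f(\psi^{n-1}))}_l-q_l^*\widetilde{(g(\psi^{n-1}))}_l,\quad n\ge1,$$ with $g(\psi^0)=g(\psi_0)=2|\psi_0|^2\psi_1+(\psi_0)^2\overline{\psi_1}$ and $g(\psi^n)=\big(f(\psi^n)-f(\psi^{n-1})\big)/\tau$ for $n\ge1$. (Here $\psi_0,\psi_1$ with lower index are the initial data, $\psi^0,\psi^1$ with upper index are numerical solutions.) *)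

theory Defs
  imports "HOL-Probability.Essential_Supremum" "HOL-Probability.Sinc_Integral"
begin

definition cubic :: "complex \<Rightarrow> complex" where
  "cubic v = of_real ((cmod v)\<^sup>2) * v"

definition wavenum :: "real \<Rightarrow> real \<Rightarrow> int \<Rightarrow> real" where
  "wavenum a b l = 2 * pi * of_int l / (b - a)"


text \<open>
  Function space norms on the interval from \<open>a\<close> to \<open>b\<close>. They take values in the extended
  nonnegative reals and equal \<open>top\<close> outside the space, so that a finite bound on a norm entails
  membership. (The function \<^const>\<open>esssup\<close> is itself \<open>top\<close> on non-measurable functions.)
\<close>

definition fourier_coeff :: "real \<Rightarrow> real \<Rightarrow> (real \<Rightarrow> complex) \<Rightarrow> int \<Rightarrow> complex" where
  "fourier_coeff a b u l =
     (\<integral>x. u x * cis (- (wavenum a b l * (x - a))) \<partial>lebesgue_on {a..b}) / of_real (b - a)"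

definition square_integrable :: "real \<Rightarrow> real \<Rightarrow> (real \<Rightarrow> complex) \<Rightarrow> bool" where
  "square_integrable a b u \<longleftrightarrow>
     u \<in> borel_measurable (lebesgue_on {a..b}) \<and>
     integrable (lebesgue_on {a..b}) (\<lambda>x. (cmod (u x))\<^sup>2)"

definition Hper_norm :: "real \<Rightarrow> real \<Rightarrow> nat \<Rightarrow> (real \<Rightarrow> complex) \<Rightarrow> ennreal" where
  "Hper_norm a b m u =
     (let w = (\<lambda>l::int. (1 + (wavenum a b l)\<^sup>2) ^ m * (cmod (fourier_coeff a b u l))\<^sup>2)
      in if square_integrable a b u \<and> w summable_on UNIV
         then ennreal (sqrt (\<Sum>\<^sub>\<infinity>l\<in>UNIV. w l)) else top)"

definition Linf_norm :: "real \<Rightarrow> real \<Rightarrow> (real \<Rightarrow> complex) \<Rightarrow> ennreal" where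
  "Linf_norm a b u = esssup (lebesgue_on {a..b}) (\<lambda>x. ennreal (cmod (u x)))"

text \<open>
  The norm below is only applied to functions that are continuously differentiable on \<open>{a..b}\<close>
  (see \<open>nlsw_solution\<close>); for them the weak derivative is the classical one.
\<close>
definition W1inf_norm :: "real \<Rightarrow> real \<Rightarrow> (real \<Rightarrow> complex) \<Rightarrow> ennreal" where
  "W1inf_norm a b u =
     Linf_norm a b u + Linf_norm a b (\<lambda>x. vector_derivative u (at x within {a..b}))"

text \<open>The norm of \<open>L\<^sup>\<infinity>([0,S]; X)\<close>, where \<open>N\<close> is the norm of \<open>X\<close>.\<close>
definition Linf_time_norm ::
  "real \<Rightarrow> ((real \<Rightarrow> complex) \<Rightarrow> ennreal) \<Rightarrow> (real \<Rightarrow> real \<Rightarrow> complex) \<Rightarrow> ennreal" where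
  "Linf_time_norm S N u = esssup (lebesgue_on {0..S}) (\<lambda>t. N (\<lambda>x. u x t))"


text \<open>
  Space-time functions are written \<open>u x t\<close>. Derivatives are taken within the closed rectangle,
  hence are one-sided on its boundary.
\<close>

definition dx :: "real \<Rightarrow> real \<Rightarrow> (real \<Rightarrow> real \<Rightarrow> complex) \<Rightarrow> real \<Rightarrow> real \<Rightarrow> complex" where
  "dx a b u x t = vector_derivative (\<lambda>y. u y t) (at x within {a..b})"

definition dt :: "real \<Rightarrow> (real \<Rightarrow> real \<Rightarrow> complex) \<Rightarrow> real \<Rightarrow> real \<Rightarrow> complex" where
  "dt S u x t = vector_derivative (\<lambda>s. u x s) (at t within {0..S})"

definition C1_space :: "real \<Rightarrow> real \<Rightarrow> real \<Rightarrow> (real \<Rightarrow> real \<Rightarrow> complex) \<Rightarrow> bool" where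
  "C1_space a b S u \<longleftrightarrow>
     (\<forall>x\<in>{a..b}. \<forall>t\<in>{0..S}. (\<lambda>y. u y t) differentiable (at x within {a..b})) \<and>
     continuous_on ({a..b} \<times> {0..S}) (\<lambda>(x, t). dx a b u x t)"

definition C1_time :: "real \<Rightarrow> real \<Rightarrow> real \<Rightarrow> (real \<Rightarrow> real \<Rightarrow> complex) \<Rightarrow> bool" where
  "C1_time a b S u \<longleftrightarrow>
     (\<forall>x\<in>{a..b}. \<forall>t\<in>{0..S}. (\<lambda>s. u x s) differentiable (at t within {0..S})) \<and>
     continuous_on ({a..b} \<times> {0..S}) (\<lambda>(x, t). dt S u x t)"

text \<open>
  Classical solutions on \<open>{a..b} \<times> {0..S}\<close>. The regularity demanded here is no restriction for
  solutions with \<open>\<psi>\<close> in \<open>L\<^sup>\<infinity>([0,S]; H\<^sup>2)\<close> and with first and second time derivative in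
  \<open>L\<^sup>\<infinity>([0,S]; H\<^sup>1)\<close>: by the equation the second space derivative is then in \<open>L\<^sup>\<infinity>([0,S]; H\<^sup>1)\<close>
  as well, and interpolation and Sobolev embedding make all these derivatives continuous.
\<close>
definition nlsw_solution ::
  "real \<Rightarrow> real \<Rightarrow> real \<Rightarrow> real \<Rightarrow> real \<Rightarrow> (real \<Rightarrow> complex) \<Rightarrow> (real \<Rightarrow> complex) \<Rightarrow>
   (real \<Rightarrow> real \<Rightarrow> complex) \<Rightarrow> bool" where
  "nlsw_solution a b \<alpha> \<epsilon> S \<psi>0 \<psi>1 \<psi> \<longleftrightarrow>
     continuous_on ({a..b} \<times> {0..S}) (\<lambda>(x, t). \<psi> x t) \<and>
     C1_space a b S \<psi> \<and> C1_space a b S (dx a b \<psi>) \<and>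
     C1_time a b S \<psi> \<and> C1_time a b S (dt S \<psi>) \<and>
     (\<forall>x\<in>{a<..<b}. \<forall>t\<in>{0<..S}.
        \<i> * dt S \<psi> x t - of_real \<alpha> * dt S (dt S \<psi>) x t + dx a b (dx a b \<psi>) x t
        - of_real (\<epsilon>\<^sup>2) * cubic (\<psi> x t) = 0) \<and>
     (\<forall>x\<in>{a..b}. \<psi> x 0 = \<psi>0 x \<and> dt S \<psi> x 0 = \<psi>1 x) \<and>
     (\<forall>t\<in>{0..S}. \<psi> a t = \<psi> b t \<and> dx a b \<psi> a t = dx a b \<psi> b t)"


text \<open>Grid functions are maps \<open>nat \<Rightarrow> complex\<close>, relevant at the indices \<open>0, \<dots>, M\<close>.\<close>

definition modes :: "nat \<Rightarrow> int set" where
  "modes M = {- (int M div 2) .. int M div 2 - 1}"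

definition gridpt :: "real \<Rightarrow> real \<Rightarrow> nat \<Rightarrow> nat \<Rightarrow> real" where
  "gridpt a b M j = a + real j * ((b - a) / real M)"

definition dft :: "real \<Rightarrow> real \<Rightarrow> nat \<Rightarrow> (nat \<Rightarrow> complex) \<Rightarrow> int \<Rightarrow> complex" where
  "dft a b M v l =
     (\<Sum>j<M. v j * cis (- (wavenum a b l * (gridpt a b M j - a)))) / of_nat M"

definition trig_sum :: "real \<Rightarrow> real \<Rightarrow> nat \<Rightarrow> (int \<Rightarrow> complex) \<Rightarrow> real \<Rightarrow> complex" where
  "trig_sum a b M w x = (\<Sum>l\<in>modes M. w l * cis (wavenum a b l * (x - a)))"

definition trig_interp :: "real \<Rightarrow> real \<Rightarrow> nat \<Rightarrow> (nat \<Rightarrow> complex) \<Rightarrow> real \<Rightarrow> complex" where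
  "trig_interp a b M v = trig_sum a b M (dft a b M v)"

definition grid_max_norm :: "nat \<Rightarrow> (nat \<Rightarrow> complex) \<Rightarrow> real" where
  "grid_max_norm M v = Max ((\<lambda>j. cmod (v j)) ` {0..M - 1})"


context
  fixes a b \<alpha> \<epsilon> \<tau> :: real
begin

definition beta_p :: "int \<Rightarrow> real" where
  "beta_p l = (1 + sqrt (1 + 4 * \<alpha> * (wavenum a b l)\<^sup>2)) / (2 * \<alpha>)"

definition beta_m :: "int \<Rightarrow> real" where
  "beta_m l = (1 - sqrt (1 + 4 * \<alpha> * (wavenum a b l)\<^sup>2)) / (2 * \<alpha>)"

definition beta_d :: "int \<Rightarrow> real" where
  "beta_d l = beta_p l - beta_m l"

definition sigma_p :: "int \<Rightarrow> complex" where
  "sigma_p l = cis (beta_p l * \<tau> / 2) * of_real (sinc (beta_p l * \<tau> / 2))"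

definition sigma_m :: "int \<Rightarrow> complex" where
  "sigma_m l = cis (beta_m l * \<tau> / 2) * of_real (sinc (beta_m l * \<tau> / 2))"

definition coeff_c0 :: "int \<Rightarrow> complex" where
  "coeff_c0 l = (of_real (beta_p l) * cis (beta_m l * \<tau>) - of_real (beta_m l) * cis (beta_p l * \<tau>))
                / of_real (beta_d l)"

definition coeff_d0 :: "int \<Rightarrow> complex" where
  "coeff_d0 l = of_real \<tau> * cis (\<tau> / (2 * \<alpha>)) * of_real (sinc (\<tau> * beta_d l / 2))"

definition coeff_c :: "int \<Rightarrow> complex" where
  "coeff_c l = - cis (\<tau> / \<alpha>)"

definition coeff_d :: "int \<Rightarrow> complex" where
  "coeff_d l = 2 * cis (\<tau> / (2 * \<alpha>)) * of_real (cos (\<tau> * beta_d l / 2))"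

definition coeff_p :: "int \<Rightarrow> complex" where
  "coeff_p l = \<i> * of_real (\<epsilon>\<^sup>2 * \<tau> / (\<alpha> * beta_d l)) * (sigma_p l - sigma_m l)"

definition coeff_p_star :: "int \<Rightarrow> complex" where
  "coeff_p_star l = \<i> * of_real (\<epsilon>\<^sup>2 * \<tau> / (\<alpha> * beta_d l)) * cis (\<tau> / \<alpha>)
                    * (cnj (sigma_p l) - cnj (sigma_m l))"

definition coeff_q :: "int \<Rightarrow> complex" where
  "coeff_q l = - of_real (\<epsilon>\<^sup>2 * \<tau> / (\<alpha> * beta_d l)) *
     (if l = 0 then (1 - sigma_p 0) / of_real (beta_p 0) + \<i> * of_real \<tau> / 2
      else (1 - sigma_p l) / of_real (beta_p l) - (1 - sigma_m l) / of_real (beta_m l))"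

definition coeff_q_star :: "int \<Rightarrow> complex" where
  "coeff_q_star l = - of_real (\<epsilon>\<^sup>2 * \<tau> / (\<alpha> * beta_d l)) * cis (\<tau> / \<alpha>) *
     (if l = 0 then (1 - sigma_p 0) / (of_real (beta_p 0) * cis (beta_p 0 * \<tau>)) + \<i> * of_real \<tau> / 2
      else (1 - sigma_p l) / (of_real (beta_p l) * cis (beta_p l * \<tau>))
         - (1 - sigma_m l) / (of_real (beta_m l) * cis (beta_m l * \<tau>)))"

text \<open>
  The grid values \<open>\<psi>\<^sup>n\<^sub>j\<close> of the exponential wave integrator Fourier pseudospectral method, for
  initial data \<open>\<psi>0\<close> and initial velocity \<open>\<psi>1\<close>. In the last equation, \<open>G0\<close> and \<open>G1\<close> are
  \<open>g(\<psi>\<^sup>n)\<close> and \<open>g(\<psi>\<^sup>n\<^sup>+\<^sup>1)\<close>, where \<open>g\<close> is the derivative of the nonlinearity at time 0 and a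
  backward difference quotient at later times.
\<close>
fun ewi_fp :: "nat \<Rightarrow> (real \<Rightarrow> complex) \<Rightarrow> (real \<Rightarrow> complex) \<Rightarrow> nat \<Rightarrow> nat \<Rightarrow> complex" where
  "ewi_fp M \<psi>0 \<psi>1 0 = (\<lambda>j. \<psi>0 (gridpt a b M j))"
| "ewi_fp M \<psi>0 \<psi>1 (Suc 0) =
     (let u0 = (\<lambda>j. \<psi>0 (gridpt a b M j));
          u1 = (\<lambda>j. \<psi>1 (gridpt a b M j));
          g0 = (\<lambda>j. 2 * of_real ((cmod (u0 j))\<^sup>2) * u1 j + (u0 j)\<^sup>2 * cnj (u1 j));
          w = (\<lambda>l. coeff_c0 l * dft a b M u0 l + coeff_d0 l * dft a b M u1 l
                 + coeff_p l * dft a b M (\<lambda>j. cubic (u0 j)) l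
                 + coeff_q l * dft a b M g0 l)
      in (\<lambda>j. trig_sum a b M w (gridpt a b M j)))"
| "ewi_fp M \<psi>0 \<psi>1 (Suc (Suc n)) =
     (let U0 = ewi_fp M \<psi>0 \<psi>1 n;
          U1 = ewi_fp M \<psi>0 \<psi>1 (Suc n);
          G0 = (if n = 0
                then (\<lambda>j. 2 * of_real ((cmod (\<psi>0 (gridpt a b M j)))\<^sup>2) * \<psi>1 (gridpt a b M j)
                        + (\<psi>0 (gridpt a b M j))\<^sup>2 * cnj (\<psi>1 (gridpt a b M j)))
                else (\<lambda>j. (cubic (U0 j) - cubic (ewi_fp M \<psi>0 \<psi>1 (n - 1) j)) / of_real \<tau>));
          G1 = (\<lambda>j. (cubic (U1 j) - cubic (U0 j)) / of_real \<tau>);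
          w = (\<lambda>l. coeff_c l * dft a b M U0 l + coeff_d l * dft a b M U1 l
                 + coeff_p l * dft a b M (\<lambda>j. cubic (U1 j)) l
                 + coeff_q l * dft a b M G1 l
                 - coeff_p_star l * dft a b M (\<lambda>j. cubic (U0 j)) l
                 - coeff_q_star l * dft a b M G0 l)
      in (\<lambda>j. trig_sum a b M w (gridpt a b M j)))"

end

end

theory Submission
  imports Defs
begin

text \<open>
  On the Fourier side every mode is a forced linear oscillator, and both the exact solution and the
  scheme are given by the same Duhamel formula: for the scheme, the nonlinearity is replaced by a
  function that is linear in time on each step. The kernel of the formula is bounded by
  \<open>2 / weight l\<close> and thus gains the derivative that the \<open>H\<^sup>1\<close> norm requires, so that differences of
  the nonlinearity have to be estimated in \<open>L\<^sup>2\<close> only. Aliasing contributes \<open>h\<^sup>m\<^sup>-\<^sup>1\<close>; Taylor expansion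
  in time contributes \<open>\<tau>\<^sup>2\<close> per unit of time, multiplied by \<open>\<epsilon>\<^sup>2\<close> and summed over a time of order
  \<open>1 / \<epsilon> powr \<beta>\<close>. Gronwall's inequality closes the estimate; the maximum bound on the numerical
  solution, needed for the Lipschitz constant of the nonlinearity, is carried along by induction on
  the time step. The rate in \<open>h\<close> requires the initial velocity in \<open>H\<^sup>m\<^sup>-\<^sup>1\<close>, which is not assumed but
  follows from the bound on the solution in \<open>H\<^sup>m\<close> over a time interval of length \<open>T\<close>.
\<close>

section \<open>Weighted square-summable coefficient families\<close>

text \<open>Hypothesis (A) speaks of essential suprema, whereas the scheme samples at grid points
  and starts from the values at time 0. The norm over finitely many modes is continuous in time, so
  a bound for almost every time holds at every time. In H^1 the Fourier series converges absolutely,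
  so the effect of sampling can be computed coefficient by coefficient. The horizon
  \<open>S = T / \<epsilon> powr \<beta>\<close> enters the constants through
  \<open>T \<le> S\<close> and \<open>\<epsilon>\<^sup>2 * S \<le> T\<close>. The first leaves an
  interval of fixed length on which the regularity of the initial velocity is recovered; the second
  bounds the Gronwall exponent and the accumulated aliasing. In the Taylor contribution the factor
  \<open>\<epsilon>\<^sup>2 * S\<close> is kept, because it equals
  \<open>T * \<epsilon> powr (2 - \<beta>)\<close>. The Sobolev embedding turns the H^1 error into
  an error on the grid, and this is at most 1 once \<open>h\<close> and \<tau> lie below thresholds
  free of \<epsilon>. The thresholds are independent of each other.\<close>

lemma L2_set_sum_le:
  "L2_set (\<lambda>l. \<Sum>j\<in>J. g j l) F \<le> (\<Sum>j\<in>J. L2_set (g j) F)"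
proof (induction J rule: infinite_finite_induct)
  case (insert j J)
  have "L2_set (\<lambda>l. \<Sum>i\<in>insert j J. g i l) F = L2_set (\<lambda>l. g j l + (\<Sum>i\<in>J. g i l)) F"
    using insert by simp
  also have "\<dots> \<le> L2_set (g j) F + L2_set (\<lambda>l. \<Sum>i\<in>J. g i l) F"
    by (rule L2_set_triangle_ineq)
  finally show ?case using insert by simp
qed (auto simp: L2_set_def)

lemma L2_set_reindex:
  "inj_on h F \<Longrightarrow> L2_set (\<lambda>l. g (h l)) F = L2_set g (h ` F)"
  unfolding L2_set_def by (simp add: sum.reindex)

lemma L2_set_mono_subset:
  "finite G \<Longrightarrow> F \<subseteq> G \<Longrightarrow> L2_set g F \<le> L2_set g G"
  unfolding L2_set_def by (intro real_sqrt_le_mono sum_mono2) auto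

lemma tendsto_L2_set:
  assumes "\<And>l. l \<in> F \<Longrightarrow> ((\<lambda>x. g x l) \<longlongrightarrow> h l) X"
  shows "((\<lambda>x. L2_set (g x) F) \<longlongrightarrow> L2_set h F) X"
  unfolding L2_set_def by (intro tendsto_intros assms)

text \<open>A Fatou argument: partial sums converge in each component, and a closed bound survives
  the limit. Convolutions and aliasing sums can thus be estimated on finite index sets.\<close>

lemma L2_set_has_sum_le:
  fixes g :: "'a \<Rightarrow> 'b \<Rightarrow> complex"
  assumes sum: "\<And>l. l \<in> F \<Longrightarrow> ((\<lambda>j. g j l) has_sum G l) A"
    and bound: "\<And>J. finite J \<Longrightarrow> J \<subseteq> A \<Longrightarrow> L2_set (\<lambda>l. w l * cmod (\<Sum>j\<in>J. g j l)) F \<le> B"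
  shows "L2_set (\<lambda>l. w l * cmod (G l)) F \<le> B"
proof (rule tendsto_upperbound)
  show "((\<lambda>J. L2_set (\<lambda>l. w l * cmod (\<Sum>j\<in>J. g j l)) F)
          \<longlongrightarrow> L2_set (\<lambda>l. w l * cmod (G l)) F) (finite_subsets_at_top A)"
    using sum by (intro tendsto_L2_set tendsto_intros) (simp add: has_sum_def)
  show "\<forall>\<^sub>F J in finite_subsets_at_top A. L2_set (\<lambda>l. w l * cmod (\<Sum>j\<in>J. g j l)) F \<le> B"
    using bound by (intro eventually_finite_subsets_at_top_weakI) auto
qed simp

lemma sum_inverse_squares_le:
  assumes "finite P" "0 \<notin> P"
  shows "(\<Sum>p\<in>P. 1 / (real_of_int p)\<^sup>2) \<le> 4"
proof -
  \<comment> \<open>The telescoping bound \<open>1 / N\<^sup>2 \<le> 1 / (N - 1) - 1 / N\<close>.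
    Each sign of \<open>p\<close> contributes at most 2, hence the 4.\<close>
  have partial: "(\<Sum>i\<in>{1..Suc N}. 1 / (real i)\<^sup>2) \<le> 2 - 1 / real (Suc N)" for N :: nat
  proof (induction N)
    case (Suc N)
    have "1 / (real (Suc (Suc N)))\<^sup>2 \<le> 1 / (real (Suc N) * real (Suc (Suc N)))"
      unfolding power2_eq_square by (intro divide_left_mono mult_right_mono) auto
    also have "\<dots> = 1 / real (Suc N) - 1 / real (Suc (Suc N))"
      by (simp add: field_simps)
    finally have "1 / (real (Suc (Suc N)))\<^sup>2 \<le> 1 / real (Suc N) - 1 / real (Suc (Suc N))" .
    with Suc show ?case by simp
  qed simp
  obtain N :: nat where N: "\<And>p. p \<in> P \<Longrightarrow> nat \<bar>p\<bar> \<le> Suc N"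
  proof
    show "nat \<bar>p\<bar> \<le> Suc (\<Sum>p\<in>P. nat \<bar>p\<bar>)" if "p \<in> P" for p
      using member_le_sum[OF that, of "\<lambda>p. nat \<bar>p\<bar>"] assms(1) by simp
  qed
  have "P \<subseteq> int ` {1..Suc N} \<union> (\<lambda>i. - int i) ` {1..Suc N}"
  proof
    fix p assume "p \<in> P"
    then have "nat \<bar>p\<bar> \<in> {1..Suc N}" and "p = int (nat \<bar>p\<bar>) \<or> p = - int (nat \<bar>p\<bar>)"
      using N[of p] assms(2) by (auto simp: Suc_le_eq)
    then show "p \<in> int ` {1..Suc N} \<union> (\<lambda>i. - int i) ` {1..Suc N}"
      by blast
  qed
  then have "(\<Sum>p\<in>P. 1 / (real_of_int p)\<^sup>2)
      \<le> (\<Sum>p\<in>int ` {1..Suc N} \<union> (\<lambda>i. - int i) ` {1..Suc N}. 1 / (real_of_int p)\<^sup>2)"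
    by (intro sum_mono2) auto
  also have "\<dots> = (\<Sum>p\<in>int ` {1..Suc N}. 1 / (real_of_int p)\<^sup>2)
      + (\<Sum>p\<in>(\<lambda>i. - int i) ` {1..Suc N}. 1 / (real_of_int p)\<^sup>2)"
    by (intro sum.union_disjoint) auto
  also have "\<dots> = 2 * (\<Sum>i\<in>{1..Suc N}. 1 / (real i)\<^sup>2)"
    by (subst (1 2) sum.reindex) (auto simp: inj_on_def)
  also have "\<dots> \<le> 4"
    using order_trans[OF partial[of N], of 2] by simp
  finally show ?thesis .
qed

lemma cubic_eq: "cubic z = z * z * cnj z"
  by (simp only: cubic_def complex_norm_square mult_ac)

locale periodic_interval =
  fixes a b :: real
  assumes a_less_b: "a < b"
begin

abbreviation wn :: "int \<Rightarrow> real" where "wn \<equiv> wavenum a b"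

definition weight :: "int \<Rightarrow> real" where
  "weight l = sqrt (1 + (wn l)\<^sup>2)"

lemma wn_diff: "wn (l - j) = wn l - wn j"
  by (simp add: wavenum_def diff_divide_distrib algebra_simps)

lemma wn_minus: "wn (- l) = - wn l"
  by (simp add: wavenum_def)

lemma wn_0 [simp]: "wn 0 = 0"
  by (simp add: wavenum_def)

lemma weight_ge_1: "1 \<le> weight l"
  by (simp add: weight_def)

lemma weight_pos: "0 < weight l"
  using weight_ge_1[of l] by linarith

lemma weight_minus: "weight (- l) = weight l"
  by (simp add: weight_def wn_minus)

lemma weight_sq: "(weight l)\<^sup>2 = 1 + (wn l)\<^sup>2"
  by (simp add: weight_def add_nonneg_nonneg)

lemma wn_le_weight: "\<bar>wn l\<bar> \<le> weight l"
  unfolding weight_def by (rule real_le_rsqrt) simp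

text \<open>\<open>weight l\<close> is the Euclidean length of the vector with entries 1 and
  \<open>wn l\<close>. After squaring, it remains to dominate the product of the two frequencies by
  the product of the weights.\<close>

lemma weight_triangle: "weight l \<le> weight (l - j) + weight j"
proof -
  define x where "x = wn (l - j)"
  define y where "y = wn j"
  have l: "wn l = x + y" by (simp add: x_def y_def wn_diff)
  have "x * y \<le> weight (l - j) * weight j"
    using mult_mono[OF wn_le_weight[of "l - j"] wn_le_weight[of j]] weight_pos[of "l - j"]
    unfolding x_def y_def abs_mult[symmetric] by (simp add: abs_le_iff)
  then have "1 + (x + y)\<^sup>2 \<le> (weight (l - j) + weight j)\<^sup>2"
    by (simp add: power2_sum weight_sq flip: x_def y_def)
  then show ?thesis
    unfolding weight_def[of l] l using weight_pos[of j] weight_pos[of "l - j"]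
    by (intro real_le_lsqrt) auto
qed

lemma weight_power_triangle:
  "weight l ^ k \<le> 2 ^ k * (weight (l - j) ^ k + weight j ^ k)"
proof -
  have "weight l \<le> 2 * max (weight (l - j)) (weight j)"
    using weight_triangle[of l j] by linarith
  then have "weight l ^ k \<le> (2 * max (weight (l - j)) (weight j)) ^ k"
    using weight_pos[of l] by (intro power_mono) auto
  also have "\<dots> = 2 ^ k * max (weight (l - j)) (weight j) ^ k"
    by (simp add: power_mult_distrib)
  also have "max (weight (l - j)) (weight j) ^ k \<le> weight (l - j) ^ k + weight j ^ k"
    using weight_pos[of j] weight_pos[of "l - j"] by (auto simp: max_def)
  finally show ?thesis by simp
qed

text \<open>
  A bound by \<open>C\<close> on the norm of \<open>H\<^sup>k\<close>, stated for finite sets of modes so that no summability has to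
  be tracked and that it passes to limits in time.
\<close>

definition Hbound :: "nat \<Rightarrow> real \<Rightarrow> (int \<Rightarrow> complex) \<Rightarrow> bool" where
  "Hbound k C c \<longleftrightarrow> (\<forall>F. finite F \<longrightarrow> L2_set (\<lambda>l. weight l ^ k * cmod (c l)) F \<le> C)"

lemma HboundD: "Hbound k C c \<Longrightarrow> finite F \<Longrightarrow> L2_set (\<lambda>l. weight l ^ k * cmod (c l)) F \<le> C"
  by (simp add: Hbound_def)

lemma Hbound_nonneg: "Hbound k C c \<Longrightarrow> 0 \<le> C"
  using HboundD[of k C c "{}"] by simp

lemma Hbound_mono:
  assumes "Hbound k C c" "j \<le> k" "C \<le> C'"
  shows "Hbound j C' c"
  unfolding Hbound_def
proof (intro allI impI)
  fix F :: "int set" assume "finite F"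
  have "L2_set (\<lambda>l. weight l ^ j * cmod (c l)) F \<le> L2_set (\<lambda>l. weight l ^ k * cmod (c l)) F"
    using assms(2) weight_ge_1 less_imp_le[OF weight_pos]
    by (intro L2_set_mono mult_right_mono power_increasing) auto
  also have "\<dots> \<le> C'" using HboundD[OF assms(1) \<open>finite F\<close>] assms(3) by simp
  finally show "L2_set (\<lambda>l. weight l ^ j * cmod (c l)) F \<le> C'" .
qed

text \<open>Conjugating a function reflects and conjugates its coefficients, and the weight is even.
  This serves the factor \<open>cnj z\<close> of the cubic term.\<close>

lemma Hbound_cnj_reflect:
  assumes "Hbound k C c"
  shows "Hbound k C (\<lambda>l. cnj (c (- l)))"
  unfolding Hbound_def
proof (intro allI impI)
  fix F :: "int set" assume "finite F"
  have "L2_set (\<lambda>l. weight l ^ k * cmod (cnj (c (- l)))) F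
      = L2_set (\<lambda>l. (\<lambda>i. weight i ^ k * cmod (c i)) (- l)) F"
    by (simp add: weight_minus)
  also have "\<dots> = L2_set (\<lambda>i. weight i ^ k * cmod (c i)) (uminus ` F)"
    by (rule L2_set_reindex) simp
  also have "\<dots> \<le> C" using HboundD[OF assms] \<open>finite F\<close> by simp
  finally show "L2_set (\<lambda>l. weight l ^ k * cmod (cnj (c (- l)))) F \<le> C" .
qed

text \<open>The embedding constant of H^1 into the absolutely convergent series. Its square exceeds
  \<open>1 + 4 * (b - a)\<^sup>2\<close>, where 1 belongs to mode 0 and the rest to the sum of
  \<open>(b - a)\<^sup>2 / l\<^sup>2\<close> over the other modes.\<close>

definition sobolev_const :: real where
  "sobolev_const = 1 + 2 * (b - a)"

lemma sobolev_const_ge_1: "1 \<le> sobolev_const"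
  using a_less_b by (simp add: sobolev_const_def)

lemma L2_set_inverse_weight:
  assumes "finite F"
  shows "L2_set (\<lambda>l. 1 / weight l) F \<le> sobolev_const"
proof -
  have "(\<Sum>l\<in>F. (1 / weight l)\<^sup>2) \<le> (\<Sum>l\<in>insert 0 F. (1 / weight l)\<^sup>2)"
    using assms by (intro sum_mono2) auto
  also have "\<dots> = 1 + (\<Sum>l\<in>F - {0}. (1 / weight l)\<^sup>2)"
    using assms by (simp add: sum.insert_remove weight_def)
  also have "(\<Sum>l\<in>F - {0}. (1 / weight l)\<^sup>2) \<le> (\<Sum>l\<in>F - {0}. (b - a)\<^sup>2 * (1 / (real_of_int l)\<^sup>2))"
  proof (rule sum_mono)
    fix l assume "l \<in> F - {0}"
    have "1 \<le> 2 * pi" using pi_gt3 by linarith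
    then have "real_of_int \<bar>l\<bar> / (b - a) \<le> 2 * pi * real_of_int \<bar>l\<bar> / (b - a)"
      using a_less_b by (intro divide_right_mono) (auto simp: mult_le_cancel_right1)
    also have "\<dots> \<le> weight l"
      using wn_le_weight[of l] a_less_b by (simp add: wavenum_def abs_mult abs_divide)
    finally have "(real_of_int \<bar>l\<bar> / (b - a))\<^sup>2 \<le> (weight l)\<^sup>2"
      using a_less_b by (intro power_mono) auto
    then have "1 / (weight l)\<^sup>2 \<le> 1 / (real_of_int \<bar>l\<bar> / (b - a))\<^sup>2"
      using \<open>l \<in> F - {0}\<close> a_less_b
      by (intro divide_left_mono mult_pos_pos zero_less_power divide_pos_pos weight_pos) auto
    then show "(1 / weight l)\<^sup>2 \<le> (b - a)\<^sup>2 * (1 / (real_of_int l)\<^sup>2)"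
      by (simp add: power_divide)
  qed
  also have "\<dots> \<le> (b - a)\<^sup>2 * 4"
    unfolding sum_distrib_left[symmetric]
    using assms by (intro mult_left_mono sum_inverse_squares_le) auto
  finally have "(\<Sum>l\<in>F. (1 / weight l)\<^sup>2) \<le> 1 + (b - a)\<^sup>2 * 4" by simp
  also have "\<dots> \<le> sobolev_const\<^sup>2"
    using a_less_b by (simp add: sobolev_const_def power2_eq_square algebra_simps)
  finally show ?thesis
    unfolding L2_set_def using sobolev_const_ge_1 by (intro real_le_lsqrt) (auto intro: sum_nonneg)
qed

text \<open>Cauchy-Schwarz, with \<open>1 / weight l\<close> paired against
  \<open>weight l * cmod (c l)\<close>.\<close>

lemma Hbound_sum_le:
  assumes "Hbound 1 C c" "finite F"
  shows "(\<Sum>l\<in>F. cmod (c l)) \<le> sobolev_const * C"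
proof -
  have "(\<Sum>l\<in>F. cmod (c l)) = (\<Sum>l\<in>F. \<bar>1 / weight l\<bar> * \<bar>weight l * cmod (c l)\<bar>)"
    using weight_pos less_imp_neq[OF weight_pos] by (intro sum.cong) (auto simp: abs_mult)
  also have "\<dots> \<le> L2_set (\<lambda>l. 1 / weight l) F * L2_set (\<lambda>l. weight l * cmod (c l)) F"
    by (rule L2_set_mult_ineq)
  also have "\<dots> \<le> sobolev_const * C"
    using L2_set_inverse_weight[OF assms(2)] HboundD[OF assms] sobolev_const_ge_1
    by (intro mult_mono) auto
  finally show ?thesis .
qed

lemma Hbound_abs_summable:
  assumes "Hbound 1 C c"
  shows "(\<lambda>l. cmod (c l)) summable_on UNIV"
  using Hbound_sum_le[OF assms] by (intro nonneg_bounded_partial_sums_imp_summable_on) auto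

lemma Hbound_infsum_le:
  assumes "Hbound 1 C c"
  shows "(\<Sum>\<^sub>\<infinity>l. cmod (c l)) \<le> sobolev_const * C"
  using Hbound_sum_le[OF assms] Hbound_abs_summable[OF assms] by (intro infsum_le_finite_sums) auto

definition conv :: "(int \<Rightarrow> complex) \<Rightarrow> (int \<Rightarrow> complex) \<Rightarrow> int \<Rightarrow> complex" where
  "conv c d l = (\<Sum>\<^sub>\<infinity>j. c (l - j) * d j)"

lemma conv_has_sum:
  assumes "Hbound 1 C c" "Hbound 1 D d"
  shows "((\<lambda>j. c (l - j) * d j) has_sum conv c d l) UNIV"
proof -
  have "cmod (c i) \<le> sobolev_const * C" for i
    using Hbound_sum_le[OF assms(1), of "{i}"] by simp
  then have "norm (cmod (c (l - j) * d j)) \<le> sobolev_const * C * cmod (d j)" for j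
    by (simp add: norm_mult mult_right_mono)
  then have "(\<lambda>j. norm (c (l - j) * d j)) summable_on UNIV"
    by (intro Infinite_Sum.abs_summable_on_comparison_test'[OF
          summable_on_cmult_right[OF Hbound_abs_summable[OF assms(2)]]]) auto
  then show ?thesis
    unfolding conv_def by (rule has_sum_infsum[OF abs_summable_summable])
qed

text \<open>Young's inequality for the two halves into which the triangle inequality splits the weight.\<close>

lemma Hbound_conv:
  assumes "Hbound (Suc k) C c" "Hbound (Suc k) D d"
  shows "Hbound (Suc k) (2 ^ (Suc k + 1) * sobolev_const * C * D) (conv c d)"
  unfolding Hbound_def
proof (intro allI impI)
  fix F :: "int set" assume F: "finite F"
  let ?w = "\<lambda>l. weight l ^ Suc k"
  have c1: "Hbound 1 C c" and d1: "Hbound 1 D d"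
    using assms by (auto elim!: Hbound_mono)
  note nonneg = Hbound_nonneg[OF assms(1)] Hbound_nonneg[OF assms(2)]
  show "L2_set (\<lambda>l. ?w l * cmod (conv c d l)) F \<le> 2 ^ (Suc k + 1) * sobolev_const * C * D"
  proof (rule L2_set_has_sum_le)
    show "((\<lambda>j. c (l - j) * d j) has_sum conv c d l) UNIV" for l
      by (rule conv_has_sum[OF c1 d1])
    fix J :: "int set" assume J: "finite J"
    \<comment> \<open>The half of the weight that falls on \<open>d\<close> is treated by the
      substitution \<open>i = l - j\<close>. Collecting all such differences in one set
      \<open>I\<close> makes the range of \<open>i\<close> independent of \<open>l\<close>.\<close>
    define I where "I = (\<lambda>(l, j). l - j) ` (F \<times> J)"
    have I: "finite I" using F J by (simp add: I_def)
    define P where "P l = (\<Sum>j\<in>J. cmod (d j) * (?w (l - j) * cmod (c (l - j))))" for l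
    define Q where "Q l = (\<Sum>i\<in>I. cmod (c i) * (?w (l - i) * cmod (d (l - i))))" for l
    have pointwise: "?w l * cmod (\<Sum>j\<in>J. c (l - j) * d j) \<le> 2 ^ Suc k * (P l + Q l)"
      if l: "l \<in> F" for l
    proof -
      have "?w l * cmod (\<Sum>j\<in>J. c (l - j) * d j) \<le> ?w l * (\<Sum>j\<in>J. cmod (c (l - j) * d j))"
        using weight_pos[of l] by (intro mult_left_mono norm_sum) auto
      also have "\<dots> = (\<Sum>j\<in>J. ?w l * (cmod (c (l - j)) * cmod (d j)))"
        by (simp add: sum_distrib_left norm_mult)
      also have "\<dots> \<le> (\<Sum>j\<in>J. (2 ^ Suc k * (?w (l - j) + ?w j)) * (cmod (c (l - j)) * cmod (d j)))"
        by (intro sum_mono mult_right_mono weight_power_triangle) auto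
      also have "\<dots> = 2 ^ Suc k * (P l + (\<Sum>j\<in>J. cmod (c (l - j)) * (?w j * cmod (d j))))"
        unfolding P_def sum.distrib[symmetric] sum_distrib_left
        by (intro sum.cong) (auto simp: algebra_simps)
      also have "(\<Sum>j\<in>J. cmod (c (l - j)) * (?w j * cmod (d j)))
          = (\<Sum>i\<in>(\<lambda>j. l - j) ` J. cmod (c i) * (?w (l - i) * cmod (d (l - i))))"
        by (subst sum.reindex) (auto simp: inj_on_def)
      also have "\<dots> \<le> Q l"
        unfolding Q_def using l I
        by (intro sum_mono2)
          (auto simp: I_def intro!: mult_nonneg_nonneg zero_le_power less_imp_le[OF weight_pos])
      finally show ?thesis by simp
    qed
    have shift: "L2_set (\<lambda>l. ?w (l - j) * cmod (c' (l - j))) F \<le> C'"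
      if "Hbound (Suc k) C' c'" for j C' c'
    proof -
      have "L2_set (\<lambda>l. ?w (l - j) * cmod (c' (l - j))) F
          = L2_set (\<lambda>l. ?w l * cmod (c' l)) ((\<lambda>l. l - j) ` F)"
        by (rule L2_set_reindex) (auto simp: inj_on_def)
      also have "\<dots> \<le> C'" using HboundD[OF that] F by simp
      finally show ?thesis .
    qed
    \<comment> \<open>Minkowski's inequality: every translate obeys the same bound, so the
      absolutely summable factor contributes only its sum.\<close>
    have half: "L2_set (\<lambda>l. \<Sum>j\<in>J'. cmod (c'' j) * (?w (l - j) * cmod (c' (l - j)))) F
        \<le> sobolev_const * C'' * C'"
      if "Hbound (Suc k) C' c'" "Hbound 1 C'' c''" "finite J'" for C' C'' c' c'' J'
    proof -
      have "L2_set (\<lambda>l. \<Sum>j\<in>J'. cmod (c'' j) * (?w (l - j) * cmod (c' (l - j)))) F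
          \<le> (\<Sum>j\<in>J'. L2_set (\<lambda>l. cmod (c'' j) * (?w (l - j) * cmod (c' (l - j)))) F)"
        by (rule L2_set_sum_le)
      also have "\<dots> = (\<Sum>j\<in>J'. cmod (c'' j) * L2_set (\<lambda>l. ?w (l - j) * cmod (c' (l - j))) F)"
        by (simp add: L2_set_right_distrib)
      also have "\<dots> \<le> (\<Sum>j\<in>J'. cmod (c'' j) * C')"
        by (intro sum_mono mult_left_mono shift[OF that(1)]) auto
      also have "\<dots> \<le> sobolev_const * C'' * C'"
        unfolding sum_distrib_right[symmetric]
        using Hbound_sum_le[OF that(2,3)] Hbound_nonneg[OF that(1)] by (intro mult_right_mono)
      finally show ?thesis .
    qed
    have "L2_set (\<lambda>l. ?w l * cmod (\<Sum>j\<in>J. c (l - j) * d j)) F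
        \<le> L2_set (\<lambda>l. 2 ^ Suc k * (P l + Q l)) F"
      using pointwise less_imp_le[OF weight_pos] by (intro L2_set_mono) auto
    also have "\<dots> = 2 ^ Suc k * L2_set (\<lambda>l. P l + Q l) F"
      by (rule L2_set_right_distrib[symmetric]) simp
    also have "\<dots> \<le> 2 ^ Suc k * (L2_set P F + L2_set Q F)"
      by (intro mult_left_mono L2_set_triangle_ineq) auto
    also have "\<dots> \<le> 2 ^ Suc k * (sobolev_const * D * C + sobolev_const * C * D)"
      unfolding P_def Q_def using half[OF assms(1) d1 J] half[OF assms(2) c1 I]
      by (intro mult_left_mono add_mono) auto
    finally show "L2_set (\<lambda>l. ?w l * cmod (\<Sum>j\<in>J. c (l - j) * d j)) F
        \<le> 2 ^ (Suc k + 1) * sobolev_const * C * D"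
      by (simp add: algebra_simps)
  qed
qed

text \<open>Pointwise convergence, endpoints included, rather than convergence in L^2: the scheme
  evaluates functions at grid points. Summation is unconditional, so that indices can be rearranged
  freely.\<close>

definition fseries :: "(int \<Rightarrow> complex) \<Rightarrow> (real \<Rightarrow> complex) \<Rightarrow> bool" where
  "fseries c u \<longleftrightarrow> (\<forall>x\<in>{a..b}. ((\<lambda>l. c l * cis (wn l * (x - a))) has_sum u x) UNIV)"

lemma fseriesD: "fseries c u \<Longrightarrow> x \<in> {a..b} \<Longrightarrow> ((\<lambda>l. c l * cis (wn l * (x - a))) has_sum u x) UNIV"
  by (simp add: fseries_def)

lemma fseries_norm_le:
  assumes "fseries c u" "Hbound 1 C c" "x \<in> {a..b}"
  shows "cmod (u x) \<le> sobolev_const * C"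
proof -
  have "((\<lambda>l. norm (c l * cis (wn l * (x - a)))) has_sum (\<Sum>\<^sub>\<infinity>l. cmod (c l))) UNIV"
    using Hbound_abs_summable[OF assms(2)] by (simp add: norm_mult)
  from norm_has_sum_bound[OF this fseriesD[OF assms(1,3)]] Hbound_infsum_le[OF assms(2)]
  show ?thesis by linarith
qed

lemma fseries_cnj:
  assumes "fseries c u"
  shows "fseries (\<lambda>l. cnj (c (- l))) (\<lambda>x. cnj (u x))"
  unfolding fseries_def
proof
  fix x assume x: "x \<in> {a..b}"
  have "((\<lambda>l. cnj (c l * cis (wn l * (x - a)))) has_sum cnj (u x)) UNIV"
    using fseriesD[OF assms x] by (simp only: has_sum_cnj_iff)
  then have "((\<lambda>l. cnj (c (- l) * cis (wn (- l) * (x - a)))) has_sum cnj (u x)) UNIV"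
    by (subst has_sum_reindex_bij_betw[of uminus UNIV UNIV]) (auto intro: bij_uminus)
  then show "((\<lambda>l. cnj (c (- l)) * cis (wn l * (x - a))) has_sum cnj (u x)) UNIV"
    by (simp add: wn_minus cis_cnj)
qed

text \<open>Both series converge absolutely, so the family of all products of terms is summable over
  pairs of indices and may be summed in any order.\<close>

lemma fseries_mult:
  assumes c: "fseries c u" "Hbound 1 C c" and d: "fseries d v" "Hbound 1 D d"
  shows "fseries (conv c d) (\<lambda>x. u x * v x)"
  unfolding fseries_def
proof
  fix x assume x: "x \<in> {a..b}"
  define E where "E l = cis (wn l * (x - a))" for l
  define A where "A l = c l * E l" for l
  define B where "B l = d l * E l" for l
  have normA: "norm (A l) = cmod (c l)" and normB: "norm (B l) = cmod (d l)" for l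
    by (simp_all add: A_def B_def E_def norm_mult)
  have A: "(A has_sum u x) UNIV" and B: "(B has_sum v x) UNIV"
    using fseriesD[OF c(1) x] fseriesD[OF d(1) x] by (simp_all add: A_def[abs_def] B_def[abs_def] E_def)
  have nA: "(\<lambda>l. norm (A l)) summable_on UNIV" and nB: "(\<lambda>l. norm (B l)) summable_on UNIV"
    using Hbound_abs_summable[OF c(2)] Hbound_abs_summable[OF d(2)] by (simp_all add: normA normB)
  have "(\<lambda>p. norm (A (fst p) * B (snd p))) summable_on UNIV \<times> UNIV"
  proof (rule summable_on_SigmaI)
    show "((\<lambda>j. norm (A (fst (i, j)) * B (snd (i, j)))) has_sum norm (A i) * (\<Sum>\<^sub>\<infinity>j. norm (B j))) UNIV" for i
      using has_sum_cmult_right[OF has_sum_infsum[OF nB]] by (simp add: norm_mult)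
    show "(\<lambda>i. norm (A i) * (\<Sum>\<^sub>\<infinity>j. norm (B j))) summable_on UNIV"
      by (rule summable_on_cmult_left[OF nA])
  qed auto
  then have summ: "(\<lambda>p. A (fst p) * B (snd p)) summable_on UNIV \<times> UNIV"
    by (rule abs_summable_summable)
  have "((\<lambda>p. A (fst p) * B (snd p)) has_sum u x * v x) (UNIV \<times> UNIV)"
  proof (rule has_sum_SigmaI[OF _ _ summ])
    show "((\<lambda>j. A (fst (i, j)) * B (snd (i, j))) has_sum A i * v x) UNIV" for i
      using has_sum_cmult_right[OF B] by simp
    show "((\<lambda>i. A i * v x) has_sum u x * v x) UNIV"
      by (rule has_sum_cmult_left[OF A])
  qed
  \<comment> \<open>The shear from \<open>(i, j)\<close> to \<open>(i + j, j)\<close> groups the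
    pairs by the frequency of the product; summing over \<open>j\<close> first produces the
    convolution.\<close>
  then have "((\<lambda>p. A (fst p - snd p) * B (snd p)) has_sum u x * v x) (UNIV \<times> UNIV)"
    by (subst (asm) has_sum_reindex_bij_witness[of _ "\<lambda>p. (fst p - snd p, snd p)" "\<lambda>p. (fst p + snd p, snd p)"
           _ "\<lambda>p. A (fst p - snd p) * B (snd p)" _ "u x * v x"]) auto
  then show "((\<lambda>l. conv c d l * cis (wn l * (x - a))) has_sum u x * v x) UNIV"
  proof (rule has_sum_SigmaD)
    fix l :: int
    have "A (l - j) * B j = (c (l - j) * d j) * cis (wn l * (x - a))" for j
      by (simp add: A_def B_def E_def wn_diff cis_mult algebra_simps)
    then show "((\<lambda>j. A (fst (l, j) - snd (l, j)) * B (snd (l, j)))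
        has_sum conv c d l * cis (wn l * (x - a))) UNIV"
      using has_sum_cmult_left[OF conv_has_sum[OF c(2) d(2)]] by simp
  qed
qed

text \<open>One factor of the convolution constant for each of the two products in
  \<open>z * z * cnj z\<close>.\<close>

definition cubic_const :: "nat \<Rightarrow> real" where
  "cubic_const k = (2 ^ (Suc k + 1) * sobolev_const)\<^sup>2"

lemma cubic_const_nonneg: "0 \<le> cubic_const k"
  by (simp add: cubic_const_def)

lemma fseries_cubic:
  assumes "fseries c u" "Hbound (Suc k) C c"
  obtains d where "fseries d (\<lambda>x. cubic (u x))" "Hbound (Suc k) (cubic_const k * C ^ 3) d"
proof
  let ?cc = "\<lambda>l. cnj (c (- l))"
  have c1: "Hbound 1 C c" "Hbound 1 C ?cc"
    using assms(2) by (auto intro!: Hbound_cnj_reflect elim!: Hbound_mono)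
  note cc = Hbound_conv[OF assms(2) assms(2)]
  have cc1: "Hbound 1 (2 ^ (Suc k + 1) * sobolev_const * C * C) (conv c c)"
    using cc by (rule Hbound_mono) auto
  show "fseries (conv (conv c c) ?cc) (\<lambda>x. cubic (u x))"
    unfolding cubic_eq
    by (rule fseries_mult[OF fseries_mult[OF assms(1) c1(1) assms(1) c1(1)] cc1
          fseries_cnj[OF assms(1)] c1(2)])
  show "Hbound (Suc k) (cubic_const k * C ^ 3) (conv (conv c c) ?cc)"
    using Hbound_conv[OF cc Hbound_cnj_reflect[OF assms(2)]]
    by (simp add: cubic_const_def power2_eq_square power3_eq_cube mult_ac)
qed

end

section \<open>Fourier coefficients of continuous functions\<close>

lemma has_vector_derivative_cis_affine [derivative_intros]:
  "((\<lambda>x. cis (k * (x - c))) has_vector_derivative \<i> * of_real k * cis (k * (x - c))) (at x within S)"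
proof -
  have "((\<lambda>x. cis (k * (x - c))) has_derivative (\<lambda>h. h *\<^sub>R (\<i> * of_real k * cis (k * (x - c))))) (at x within S)"
    by (auto intro!: derivative_eq_intros simp: scaleR_conv_of_real)
  then show ?thesis by (simp add: has_vector_derivative_def)
qed

lemma has_vector_derivative_of_real_shift [derivative_intros]:
  "((\<lambda>s. of_real (s - p)) has_vector_derivative (1 :: complex)) (at s within A)"
proof -
  have "((\<lambda>s. of_real (s - p)) has_vector_derivative (of_real 1 :: complex)) (at s within A)"
    by (rule has_vector_derivative_of_real)
      (auto intro!: derivative_eq_intros simp: has_real_derivative_iff_has_vector_derivative[symmetric])
  then show ?thesis by simp
qed

context periodic_interval
begin

abbreviation fc :: "(real \<Rightarrow> complex) \<Rightarrow> int \<Rightarrow> complex" where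
  "fc \<equiv> fourier_coeff a b"

abbreviation em :: "int \<Rightarrow> real \<Rightarrow> complex" where
  "em l x \<equiv> cis (wn l * (x - a))"

lemma em_b [simp]: "em l b = 1"
proof -
  have "wn l * (b - a) = 2 * pi * real_of_int l"
    using a_less_b by (simp add: wavenum_def)
  then show ?thesis by (simp add: cis_multiple_2pi)
qed

lemma continuous_on_em [continuous_intros]: "continuous_on S (\<lambda>x. em l x)"
  by (intro continuous_intros)

lemma continuous_on_em_minus [continuous_intros]: "continuous_on S (\<lambda>x. cis (- (wn l * (x - a))))"
  by (intro continuous_intros)

lemma fc_integral:
  assumes "continuous_on {a..b} u"
  shows "fc u l = integral {a..b} (\<lambda>x. u x * cis (- (wn l * (x - a)))) / of_real (b - a)"
proof -
  have "integrable (lebesgue_on {a..b}) (\<lambda>x. u x * cis (- (wn l * (x - a))))"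
    by (intro continuous_imp_integrable_real continuous_intros assms)
  then show ?thesis
    unfolding fourier_coeff_def by (subst lebesgue_integral_eq_integral) auto
qed

lemma fc_integrable:
  assumes "continuous_on {a..b} u"
  shows "(\<lambda>x. u x * cis (- (wn l * (x - a)))) integrable_on {a..b}"
  by (intro integrable_continuous_interval continuous_intros assms)

lemma fc_cong:
  assumes "\<And>x. x \<in> {a..b} \<Longrightarrow> u x = v x"
  shows "fc u l = fc v l"
  unfolding fourier_coeff_def by (auto intro!: Bochner_Integration.integral_cong simp: assms)

lemma fc_add:
  assumes "continuous_on {a..b} u" "continuous_on {a..b} v"
  shows "fc (\<lambda>x. u x + v x) l = fc u l + fc v l"
  using assms
  by (simp add: fc_integral continuous_on_add integral_add fc_integrable distrib_right add_divide_distrib)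

lemma fc_diff:
  assumes "continuous_on {a..b} u" "continuous_on {a..b} v"
  shows "fc (\<lambda>x. u x - v x) l = fc u l - fc v l"
  using assms
  by (simp add: fc_integral continuous_on_diff integral_diff fc_integrable left_diff_distrib diff_divide_distrib)

lemma fc_cmult:
  assumes "continuous_on {a..b} u"
  shows "fc (\<lambda>x. c * u x) l = c * fc u l"
  using assms by (simp add: fc_integral continuous_on_mult_left mult.assoc)

lemma fc_sum:
  assumes "\<And>j. j \<in> J \<Longrightarrow> continuous_on {a..b} (u j)"
  shows "fc (\<lambda>x. \<Sum>j\<in>J. u j x) l = (\<Sum>j\<in>J. fc (u j) l)"
  using assms
proof (induction J rule: infinite_finite_induct)
  case (insert j J)
  then show ?case by (simp add: fc_add continuous_on_sum)
qed (simp_all add: fourier_coeff_def)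

lemma fc_norm_le:
  assumes "continuous_on {a..b} u" "\<And>x. x \<in> {a..b} \<Longrightarrow> cmod (u x) \<le> B"
  shows "cmod (fc u l) \<le> B"
proof -
  have "cmod (integral {a..b} (\<lambda>x. u x * cis (- (wn l * (x - a))))) \<le> B * (b - a)"
    using a_less_b assms by (intro integral_bound continuous_intros) (auto simp: norm_mult)
  then show ?thesis
    using a_less_b by (simp add: fc_integral[OF assms(1)] norm_divide divide_le_eq del: of_real_diff)
qed

text \<open>Integration by parts. The boundary term is kept because the formula is also applied to
  functions that are not periodic, such as the polynomials in
  \<open>riemann_lebesgue\<close>.\<close>

lemma fc_vector_derivative:
  assumes "\<And>x. x \<in> {a..b} \<Longrightarrow> (u has_vector_derivative u' x) (at x within {a..b})"
    and "continuous_on {a..b} u'"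
  shows "fc u' l = (u b - u a) / of_real (b - a) + \<i> * of_real (wn l) * fc u l"
proof -
  have cont: "continuous_on {a..b} u"
    using assms(1) by (meson continuous_on_eq_continuous_within has_vector_derivative_continuous)
  have conj: "cis (- (wn l * (x - a))) = cis (- wn l * (x - a))" for x
    by simp
  have "((\<lambda>x. u x * (\<i> * of_real (- wn l) * cis (- wn l * (x - a))) + u' x * cis (- wn l * (x - a)))
      has_integral (u b * cis (- wn l * (b - a)) - u a * cis (- wn l * (a - a)))) {a..b}"
    using a_less_b
    by (intro fundamental_theorem_of_calculus has_vector_derivative_mult assms(1)
          has_vector_derivative_cis_affine) auto
  moreover have "cis (- wn l * (b - a)) = 1"
    using em_b[of "- l"] by (simp add: wn_minus)
  ultimately have "((\<lambda>x. u x * (\<i> * of_real (- wn l) * cis (- wn l * (x - a))) + u' x * cis (- wn l * (x - a)))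
      has_integral (u b - u a)) {a..b}" by simp
  then have "u b - u a = integral {a..b} (\<lambda>x. (- \<i> * of_real (wn l)) * (u x * cis (- (wn l * (x - a)))) + u' x * cis (- (wn l * (x - a))))"
    by (simp add: integral_unique algebra_simps)
  also have "\<dots> = - \<i> * of_real (wn l) * integral {a..b} (\<lambda>x. u x * cis (- (wn l * (x - a))))
      + integral {a..b} (\<lambda>x. u' x * cis (- (wn l * (x - a))))"
    by (subst integral_add)
      (auto intro!: integrable_continuous_interval continuous_intros cont assms(2))
  finally have parts: "integral {a..b} (\<lambda>x. u' x * cis (- (wn l * (x - a))))
      = (u b - u a) + \<i> * of_real (wn l) * integral {a..b} (\<lambda>x. u x * cis (- (wn l * (x - a))))"
    by simp
  show ?thesis
    unfolding fc_integral[OF cont] fc_integral[OF assms(2)] parts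
    by (simp only: add_divide_distrib times_divide_eq_right)
qed

lemma fc_const: "fc (\<lambda>x. c) l = (if l = 0 then c else 0)"
proof (cases "l = 0")
  case True
  then show ?thesis
    using a_less_b by (simp add: fc_integral scaleR_conv_of_real del: of_real_diff)
next
  case False
  then have "wn l \<noteq> 0" using a_less_b by (simp add: wavenum_def)
  moreover have "fc (\<lambda>x. 0) l = \<i> * of_real (wn l) * fc (\<lambda>x. c) l"
    using fc_vector_derivative[of "\<lambda>_. c" "\<lambda>_. 0" l] by simp
  ultimately show ?thesis using False by (simp add: fourier_coeff_def)
qed

lemma fc_shift: "fc (\<lambda>x. u x * em j x) l = fc u (l - j)"
  unfolding fourier_coeff_def
  by (simp add: wn_diff cis_mult mult.assoc algebra_simps)

lemma fc_em: "fc (em j) l = (if l = j then 1 else 0)"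
  using fc_shift[of "\<lambda>_. 1" j l] by (simp add: fc_const)

lemma fseries_uniform_limit:
  assumes "fseries c u" "Hbound 1 C c"
  shows "uniform_limit {a..b} (\<lambda>X x. \<Sum>l\<in>X. c l * em l x) u (finite_subsets_at_top UNIV)"
  using fseriesD[OF assms(1)] Hbound_abs_summable[OF assms(2)]
  by (intro Weierstrass_m_test_general'[where M = "\<lambda>l. cmod (c l)"]) (auto simp: norm_mult)

lemma fseries_continuous:
  assumes "fseries c u" "Hbound 1 C c"
  shows "continuous_on {a..b} u"
proof (rule uniform_limit_theorem[OF _ fseries_uniform_limit[OF assms]])
  show "\<forall>\<^sub>F X in finite_subsets_at_top UNIV. continuous_on {a..b} (\<lambda>x. \<Sum>l\<in>X. c l * em l x)"
    by (intro always_eventually allI continuous_intros)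
qed simp

text \<open>Coefficients depend continuously on the function in the sup norm, and every finite
  partial sum that contains the index \<open>l\<close> already has the coefficient
  \<open>c l\<close>.\<close>

lemma fc_fseries:
  assumes "fseries c u" "Hbound 1 C c"
  shows "fc u l = c l"
proof -
  have cont: "continuous_on {a..b} u" by (rule fseries_continuous[OF assms])
  have small: "cmod (fc u l - c l) \<le> e" if "0 < e" for e
  proof -
    from uniform_limitD[OF fseries_uniform_limit[OF assms] \<open>0 < e\<close>] obtain X where "finite X"
      and X: "\<And>Y. finite Y \<Longrightarrow> X \<subseteq> Y \<Longrightarrow> \<forall>x\<in>{a..b}. dist (\<Sum>l\<in>Y. c l * em l x) (u x) < e"
      unfolding eventually_finite_subsets_at_top by auto
    define Y where "Y = insert l X"
    have Y: "finite Y" "l \<in> Y" "\<forall>x\<in>{a..b}. dist (\<Sum>l\<in>Y. c l * em l x) (u x) < e"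
      using \<open>finite X\<close> X[of Y] by (auto simp: Y_def)
    have "fc (\<lambda>x. \<Sum>j\<in>Y. c j * em j x) l = (\<Sum>j\<in>Y. if j = l then c l else 0)"
      by (subst fc_sum) (auto intro!: continuous_intros sum.cong simp: fc_cmult continuous_on_em fc_em)
    also have "\<dots> = c l" using Y by simp
    finally have "fc (\<lambda>x. u x - (\<Sum>j\<in>Y. c j * em j x)) l = fc u l - c l"
      by (subst fc_diff) (auto intro!: continuous_intros cont)
    moreover have "cmod (fc (\<lambda>x. u x - (\<Sum>j\<in>Y. c j * em j x)) l) \<le> e"
      using Y(3) by (intro fc_norm_le continuous_intros cont) (auto simp: dist_norm norm_minus_commute less_imp_le)
    ultimately show ?thesis by simp
  qed
  have "cmod (fc u l - c l) \<le> 0"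
    by (rule field_le_epsilon) (use small in simp)
  then show ?thesis by simp
qed

section \<open>Completeness of the trigonometric system\<close>

lemma riemann_lebesgue:
  assumes v: "continuous_on {a..b} v" and "0 < e"
  shows "\<exists>N. \<forall>l. N < \<bar>l\<bar> \<longrightarrow> cmod (fc v l) \<le> e"
proof -
  obtain p where p: "polynomial_function p" "\<And>x. x \<in> {a..b} \<Longrightarrow> norm (v x - p x) < e / 2"
    using Stone_Weierstrass_polynomial_function[OF compact_Icc v, of "e / 2"] \<open>0 < e\<close> by auto
  obtain p' where p': "polynomial_function p'" "\<And>x. (p has_vector_derivative p' x) (at x)"
    using has_vector_derivative_polynomial_function[OF p(1)] by blast
  have cont: "continuous_on {a..b} p" "continuous_on {a..b} p'"
    using p(1) p'(1) by (auto intro: continuous_on_polymonial_function)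
  have "bounded (p' ` {a..b})"
    by (intro compact_imp_bounded compact_continuous_image cont(2)) simp
  then obtain B where "\<forall>z\<in>p' ` {a..b}. cmod z \<le> B"
    unfolding bounded_iff by blast
  then have B: "\<And>x. x \<in> {a..b} \<Longrightarrow> cmod (p' x) \<le> B" by blast
  \<comment> \<open>Integration by parts bounds \<open>\<bar>wn l\<bar> * cmod (fc p l)\<close> by
    \<open>D\<close>, whose second summand accounts for the jump of the polynomial between the
    endpoints. Beyond \<open>N\<close> the coefficients of \<open>p\<close> are therefore at most
    \<open>e / 2\<close>.\<close>
  define D where "D = B + cmod (p b - p a) / (b - a)"
  define N where "N = \<lceil>2 * D * (b - a) / e\<rceil>"
  have "cmod (fc v l) \<le> e" if l: "N < \<bar>l\<bar>" "0 < \<bar>l\<bar>" for l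
  proof -
    have "fc p' l = (p b - p a) / of_real (b - a) + \<i> * of_real (wn l) * fc p l"
      using p'(2) cont(2) by (intro fc_vector_derivative) (auto intro: has_vector_derivative_at_within)
    then have "\<i> * of_real (wn l) * fc p l = fc p' l - (p b - p a) / of_real (b - a)"
      by simp
    then have "cmod (\<i> * of_real (wn l) * fc p l) \<le> cmod (fc p' l) + cmod ((p b - p a) / of_real (b - a))"
      by (simp only: norm_triangle_ineq4)
    also have "cmod (fc p' l) \<le> B" by (rule fc_norm_le[OF cont(2) B])
    finally have "\<bar>wn l\<bar> * cmod (fc p l) \<le> D"
      using a_less_b unfolding D_def norm_mult norm_divide norm_of_real by simp
    moreover have "2 * D / e \<le> \<bar>wn l\<bar>"
    proof -
      have "2 * D * (b - a) / e \<le> real_of_int \<bar>l\<bar>"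
        using l(1) unfolding N_def by linarith
      also have "\<dots> \<le> 2 * pi * real_of_int \<bar>l\<bar>"
        using pi_gt3 by (simp add: mult_le_cancel_right1)
      finally show ?thesis using a_less_b \<open>0 < e\<close>
        by (simp add: wavenum_def abs_mult abs_divide field_simps)
    qed
    ultimately have "2 * D / e * cmod (fc p l) \<le> D"
      by (meson mult_right_mono norm_ge_zero order_trans)
    moreover have "0 < \<bar>wn l\<bar>"
      using l(2) a_less_b by (simp add: wavenum_def)
    ultimately have "cmod (fc p l) \<le> e / 2"
    proof (cases "D = 0")
      case True
      with \<open>\<bar>wn l\<bar> * cmod (fc p l) \<le> D\<close> \<open>0 < \<bar>wn l\<bar>\<close> have "cmod (fc p l) = 0"
        by (metis mult_le_0_iff norm_ge_zero not_less order_antisym)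
      then show ?thesis using \<open>0 < e\<close> by simp
    next
      case False
      have "0 \<le> B" using B[of a] a_less_b order_trans[OF norm_ge_zero] by simp
      then have "0 \<le> D" using a_less_b by (simp add: D_def)
      with False have "0 < D" by simp
      with \<open>2 * D / e * cmod (fc p l) \<le> D\<close> \<open>0 < e\<close> show ?thesis
        by (simp add: field_simps)
    qed
    moreover have "cmod (fc v l - fc p l) \<le> e / 2"
      unfolding fc_diff[OF v cont(1), symmetric]
      using p(2) by (intro fc_norm_le continuous_intros v cont less_imp_le)
    ultimately show ?thesis
      using norm_triangle_ineq2[of "fc v l" "fc p l"] by linarith
  qed
  then show ?thesis by (intro exI[of _ "max N 0"]) auto
qed

text \<open>
  Chernoff's argument: dividing \<open>U - U x0\<close> by \<open>em 1 - em 1 x0\<close> gives a continuous function, and its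
  Fourier coefficients have constant modulus on either side of \<open>0\<close>, so they vanish.
\<close>

lemma fc_zero_imp_constant:
  assumes U: "\<And>x. x \<in> {a..b} \<Longrightarrow> (U has_vector_derivative U' x) (at x within {a..b})"
    and zero: "\<And>l. l \<noteq> 0 \<Longrightarrow> fc U l = 0" and x0: "x0 \<in> {a<..<b}"
  shows "U x0 = fc U 0"
proof -
  have contU: "continuous_on {a..b} U"
    using U by (meson continuous_on_eq_continuous_within has_vector_derivative_continuous)
  have wn1: "wn 1 \<noteq> 0" using a_less_b by (simp add: wavenum_def)
  define d where "d = \<i> * of_real (wn 1) * em 1 x0"
  have d0: "d \<noteq> 0" using wn1 by (simp add: d_def)
  define q where "q x = (U x - U x0) / (em 1 x - em 1 x0)" for x
  define v where "v = q(x0 := U' x0 / d)"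
  \<comment> \<open>\<open>em 1\<close> winds around the circle once over the interval. Since
    \<open>x0\<close> is an interior point, the distance from \<open>x\<close> to \<open>x0\<close>
    is shorter than a full period.\<close>
  have neq: "em 1 x - em 1 x0 \<noteq> 0" if "x \<in> {a..b}" "x \<noteq> x0" for x
  proof
    define y where "y = (x - x0) / (b - a)"
    assume "em 1 x - em 1 x0 = 0"
    then have "em 1 x / em 1 x0 = 1" by simp
    then have "cis (wn 1 * (x - x0)) = 1"
      by (simp add: cis_divide right_diff_distrib)
    then have "cos (2 * pi * y) = 1"
      by (simp add: complex_eq_iff wavenum_def y_def)
    then obtain n :: int where "2 * pi * y = real_of_int n * 2 * pi"
      using cos_one_2pi_int by blast
    then have n: "y = real_of_int n" by simp
    moreover have "\<bar>y\<bar> < 1"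
      using that x0 a_less_b by (auto simp: y_def abs_divide divide_less_eq)
    ultimately have "n = 0" by linarith
    then show False using n that a_less_b by (simp add: y_def)
  qed
  have v_eq: "v x * (em 1 x - em 1 x0) = U x - U x0" if "x \<in> {a..b}" for x
    using neq[OF that] by (cases "x = x0") (auto simp: v_def q_def)
  have quot: "((\<lambda>x. (f x - f x0) /\<^sub>R (x - x0)) \<longlongrightarrow> f') (at x0 within {a..b})"
    if "(f has_vector_derivative f') (at x0 within {a..b})" for f :: "real \<Rightarrow> complex" and f'
  proof -
    have "((\<lambda>x. norm ((f x - f x0) - (x - x0) *\<^sub>R f') / norm (x - x0)) \<longlongrightarrow> 0) (at x0 within {a..b})"
      using that unfolding has_vector_derivative_def has_derivative_iff_norm by blast
    moreover have "\<forall>\<^sub>F x in at x0 within {a..b}.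
        norm ((f x - f x0) - (x - x0) *\<^sub>R f') / norm (x - x0) = norm ((f x - f x0) /\<^sub>R (x - x0) - f')"
      unfolding eventually_at_filter
    proof (intro always_eventually allI impI)
      fix x assume "x \<noteq> x0"
      then have "(f x - f x0) /\<^sub>R (x - x0) - f' = ((f x - f x0) - (x - x0) *\<^sub>R f') /\<^sub>R (x - x0)"
        by (simp add: scaleR_diff_right)
      then show "norm ((f x - f x0) - (x - x0) *\<^sub>R f') / norm (x - x0) = norm ((f x - f x0) /\<^sub>R (x - x0) - f')"
        by (simp add: divide_inverse mult.commute)
    qed
    ultimately have "((\<lambda>x. norm ((f x - f x0) /\<^sub>R (x - x0) - f')) \<longlongrightarrow> 0) (at x0 within {a..b})"
      by (rule Lim_transform_eventually)
    then show ?thesis by (rule LIM_zero_cancel[OF tendsto_norm_zero_cancel])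
  qed
  have "((\<lambda>x. ((U x - U x0) /\<^sub>R (x - x0)) / ((em 1 x - em 1 x0) /\<^sub>R (x - x0))) \<longlongrightarrow> U' x0 / d) (at x0 within {a..b})"
    using x0 unfolding d_def
    by (intro tendsto_divide quot U has_vector_derivative_cis_affine)
      (use d0 in \<open>auto simp: d_def\<close>)
  moreover have "\<forall>\<^sub>F x in at x0 within {a..b}.
      ((U x - U x0) /\<^sub>R (x - x0)) / ((em 1 x - em 1 x0) /\<^sub>R (x - x0)) = q x"
    by (auto simp: eventually_at_filter q_def scaleR_conv_of_real)
  ultimately have "(q \<longlongrightarrow> U' x0 / d) (at x0 within {a..b})"
    by (rule Lim_transform_eventually)
  moreover have v_ev: "\<forall>\<^sub>F y in at x within {a..b}. q y = v y" for x
    using eventually_neq_at_within[of x0 x "{a..b}"] by eventually_elim (simp add: v_def)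
  ultimately have "(v \<longlongrightarrow> U' x0 / d) (at x0 within {a..b})"
    by (rule Lim_transform_eventually)
  moreover have "v x0 = U' x0 / d" by (simp add: v_def)
  ultimately have at_x0: "continuous (at x0 within {a..b}) v"
    unfolding continuous_within by simp
  have contv: "continuous_on {a..b} v"
    unfolding continuous_on_eq_continuous_within
  proof
    fix x assume x: "x \<in> {a..b}"
    show "continuous (at x within {a..b}) v"
    proof (cases "x = x0")
      case False
      have "(U \<longlongrightarrow> U x) (at x within {a..b})" "(em 1 \<longlongrightarrow> em 1 x) (at x within {a..b})"
        using contU continuous_on_em[of "{a..b}" 1] x by (auto simp: continuous_on_def)
      then have "(q \<longlongrightarrow> q x) (at x within {a..b})"
        unfolding q_def by (intro tendsto_divide tendsto_diff tendsto_const neq x False)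
      then have "(q \<longlongrightarrow> v x) (at x within {a..b})"
        using False by (simp add: v_def)
      then show ?thesis
        unfolding continuous_within using v_ev by (rule Lim_transform_eventually)
    qed (simp add: at_x0)
  qed
  \<comment> \<open>Multiplication by \<open>em 1\<close> shifts coefficients by one, so
    \<open>v_eq\<close> becomes a two-term recursion that is homogeneous except at
    \<open>l = 0\<close>. Its instance at \<open>l = 0\<close> is the claim once
    \<open>fc v 0\<close> and \<open>fc v (- 1)\<close> vanish.\<close>
  have rec: "fc v (l - 1) - em 1 x0 * fc v l = (if l = 0 then fc U 0 - U x0 else 0)" for l
  proof -
    have "fc v (l - 1) - em 1 x0 * fc v l = fc (\<lambda>x. v x * em 1 x - em 1 x0 * v x) l"
      by (subst fc_diff) (auto intro!: continuous_intros contv simp: fc_shift fc_cmult[OF contv])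
    also have "\<dots> = fc (\<lambda>x. U x - U x0) l"
      using v_eq by (intro fc_cong) (simp add: algebra_simps)
    also have "\<dots> = fc U l - (if l = 0 then U x0 else 0)"
      by (subst fc_diff) (auto intro!: contU simp: fc_const)
    finally show ?thesis using zero[of l] by auto
  qed
  have step: "cmod (fc v (l - 1)) = cmod (fc v l)" if "l \<noteq> 0" for l
  proof -
    have "fc v (l - 1) = em 1 x0 * fc v l" using rec[of l] that by simp
    then show ?thesis by (simp add: norm_mult)
  qed
  have up: "cmod (fc v (int n)) = cmod (fc v 0)" for n
    by (induction n) (use step[of "int (Suc _)"] in auto)
  have down: "cmod (fc v (- 1 - int n)) = cmod (fc v (- 1))" for n
  proof (induction n)
    case (Suc n)
    then show ?case using step[of "- 1 - int n"] by (simp add: algebra_simps)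
  qed simp
  have small: "cmod (fc v 0) \<le> e" "cmod (fc v (- 1)) \<le> e" if "0 < e" for e
  proof -
    obtain N where N: "\<And>l. N < \<bar>l\<bar> \<Longrightarrow> cmod (fc v l) \<le> e"
      using riemann_lebesgue[OF contv \<open>0 < e\<close>] by blast
    show "cmod (fc v 0) \<le> e" "cmod (fc v (- 1)) \<le> e"
      using N[of "int (nat \<bar>N\<bar> + 1)"] N[of "- 1 - int (nat \<bar>N\<bar> + 1)"]
        up[of "nat \<bar>N\<bar> + 1"] down[of "nat \<bar>N\<bar> + 1"] by simp_all
  qed
  have "cmod (fc v 0) \<le> 0" by (rule field_le_epsilon) (use small in simp)
  moreover have "cmod (fc v (- 1)) \<le> 0" by (rule field_le_epsilon) (use small in simp)
  ultimately have "fc v 0 = 0" "fc v (- 1) = 0" by simp_all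
  then show ?thesis using rec[of 0] by simp
qed

text \<open>The primitive \<open>U\<close> supplies the differentiability that
  \<open>fc_zero_imp_constant\<close> requires. Since \<open>u\<close> has mean zero,
  \<open>U\<close> has equal values at both ends, and integration by parts passes the vanishing
  coefficients on to it. So \<open>U\<close> is constant in the interior, and its derivative is
  \<open>u\<close>.\<close>

lemma fc_zero_imp_zero:
  assumes u: "continuous_on {a..b} u" and zero: "\<And>l. fc u l = 0" and x: "x \<in> {a..b}"
  shows "u x = 0"
proof -
  define U where "U x = integral {a..x} u" for x
  have U: "(U has_vector_derivative u x) (at x within {a..b})" if "x \<in> {a..b}" for x
    unfolding U_def by (rule integral_has_vector_derivative[OF u that])
  have "integral {a..b} u = 0"
    using zero[of 0] a_less_b by (simp add: fc_integral[OF u])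
  then have Uab: "U a = 0" "U b = 0" by (simp_all add: U_def)
  have "fc U l = 0" if "l \<noteq> 0" for l
    using fc_vector_derivative[OF U u, of l] zero[of l] Uab that a_less_b by (auto simp: wavenum_def)
  then have const: "U y = fc U 0" if "y \<in> {a<..<b}" for y
    using fc_zero_imp_constant[OF U _ that] by blast
  have "u y = 0" if y: "y \<in> {a<..<b}" for y
  proof -
    have "(U has_vector_derivative u y) (at y)"
      using U[of y] y by (simp add: at_within_Icc_at)
    moreover have "(U has_vector_derivative 0) (at y)"
      by (rule has_vector_derivative_transform_within_open[of "\<lambda>_. fc U 0" _ _ "{a<..<b}"])
        (use const y in auto)
    ultimately show ?thesis by (rule vector_derivative_unique_at)
  qed
  moreover have "closure {a<..<b} = {a..b}" using a_less_b by simp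
  ultimately show ?thesis
    using continuous_constant_on_closure[of "{a<..<b}" u 0 x] u x by simp
qed

text \<open>Fourier inversion for coefficients in H^1: the sum of the series is continuous and has
  the same coefficients as \<open>u\<close>, so uniqueness identifies the two at every point,
  endpoints included.\<close>

lemma fseries_fc:
  assumes u: "continuous_on {a..b} u" and H: "Hbound 1 C (fc u)"
  shows "fseries (fc u) u"
proof -
  define s where "s x = (\<Sum>\<^sub>\<infinity>l. fc u l * em l x)" for x
  have s: "fseries (fc u) s"
    unfolding fseries_def s_def
  proof
    fix x
    have "(\<lambda>l. norm (fc u l * em l x)) summable_on UNIV"
      using Hbound_abs_summable[OF H] by (simp add: norm_mult)
    then show "((\<lambda>l. fc u l * em l x) has_sum (\<Sum>\<^sub>\<infinity>l. fc u l * em l x)) UNIV"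
      by (rule has_sum_infsum[OF abs_summable_summable])
  qed
  have cont: "continuous_on {a..b} s" by (rule fseries_continuous[OF s H])
  have "u x - s x = 0" if "x \<in> {a..b}" for x
    by (rule fc_zero_imp_zero[OF continuous_on_diff[OF u cont] _ that])
      (simp add: fc_diff[OF u cont] fc_fseries[OF s H])
  then show ?thesis using s unfolding fseries_def by simp
qed

end

section \<open>The discrete Fourier transform and aliasing\<close>

text \<open>At a point of violation continuity yields a nonempty open interval of violations, which
  is not negligible. This converts essential suprema in space and in time into bounds at every
  point.\<close>

lemma continuous_ae_le_imp_le:
  fixes g :: "real \<Rightarrow> real"
  assumes "p < q" and cont: "continuous_on {p..q} g"
    and ae: "AE x in lebesgue_on {p..q}. g x \<le> K" and x: "x \<in> {p..q}"
  shows "g x \<le> K"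
proof (rule ccontr)
  assume "\<not> g x \<le> K"
  then have gx: "g x - K > 0" by simp
  obtain d where d: "0 < d" "\<And>y. y \<in> {p..q} \<Longrightarrow> dist y x < d \<Longrightarrow> dist (g y) (g x) < g x - K"
    using cont x gx unfolding continuous_on_iff by blast
  define I where "I = {max p (x - d)<..<min q (x + d)}"
  have above: "K < g y" if "y \<in> I" for y
    using d(2)[of y] that by (auto simp: I_def dist_real_def abs_less_iff)
  obtain N where N: "N \<in> null_sets (lebesgue_on {p..q})"
    and sub: "{x \<in> space (lebesgue_on {p..q}). \<not> g x \<le> K} \<subseteq> N"
    using ae unfolding eventually_ae_filter by blast
  have "I \<subseteq> N"
    using sub above by (force simp: I_def)
  moreover have "negligible N"
    using N by (simp add: negligible_iff_null_sets null_sets_restrict_space)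
  ultimately have "negligible I" by (rule negligible_subset[rotated])
  moreover have "open I" "I \<noteq> {}"
    using x \<open>p < q\<close> d(1) by (auto simp: I_def)
  ultimately show False using open_not_negligible by blast
qed

lemma sum_roots_of_unity:
  assumes "0 < M"
  shows "(\<Sum>j<M. cis (2 * pi * real_of_int k * real j / real M)) = (if int M dvd k then of_nat M else 0)"
proof -
  define z where "z = cis (2 * pi * real_of_int k / real M)"
  have pow: "cis (2 * pi * real_of_int k * real j / real M) = z ^ j" for j
    unfolding z_def Complex.DeMoivre by (rule arg_cong[of _ _ cis]) (simp add: mult_ac)
  have zM: "z ^ M = 1"
    using assms cis_multiple_2pi[of "real_of_int k"] by (simp add: z_def Complex.DeMoivre)
  show ?thesis
  proof (cases "int M dvd k")
    case True
    then obtain i where "k = int M * i" by blast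
    then have "z = 1" using assms cis_multiple_2pi[of "real_of_int i"] by (simp add: z_def mult.assoc)
    then show ?thesis using True by (simp add: pow)
  next
    case False
    have "z \<noteq> 1"
    proof
      assume "z = 1"
      then have "cos (2 * pi * real_of_int k / real M) = 1" by (simp add: z_def complex_eq_iff)
      then obtain n :: int where "2 * pi * real_of_int k / real M = real_of_int n * 2 * pi"
        using cos_one_2pi_int by blast
      then have "real_of_int k = real_of_int (int M * n)" using assms by (simp add: field_simps)
      then have "k = int M * n" by (simp only: of_int_eq_iff)
      with False show False by simp
    qed
    then have "(\<Sum>j<M. z ^ j) = 0" using zM by (simp add: geometric_sum)
    with False show ?thesis by (simp add: pow)
  qed
qed

lemma has_sum_sum:
  fixes f :: "'i \<Rightarrow> 'a \<Rightarrow> 'b :: topological_comm_monoid_add"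
  assumes "\<And>j. j \<in> J \<Longrightarrow> (f j has_sum S j) A"
  shows "((\<lambda>i. \<Sum>j\<in>J. f j i) has_sum (\<Sum>j\<in>J. S j)) A"
  using assms by (induction J rule: infinite_finite_induct) (auto intro: has_sum_add)

lemma finite_modes [simp]: "finite (modes M)"
  by (simp add: modes_def)

context periodic_interval
begin

lemma gridpt_in: "j \<le> M \<Longrightarrow> 0 < M \<Longrightarrow> gridpt a b M j \<in> {a..b}"
proof -
  assume "j \<le> M" "0 < M"
  then have "real j * (b - a) \<le> real M * (b - a)"
    using a_less_b by (intro mult_right_mono) auto
  then have "real j * ((b - a) / real M) \<le> b - a"
    using \<open>0 < M\<close> by (simp add: field_simps)
  then show ?thesis using a_less_b by (simp add: gridpt_def)
qed

lemma em_gridpt: "em l (gridpt a b M j) = cis (2 * pi * real_of_int l * real j / real M)"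
proof -
  have "wn l * (gridpt a b M j - a) = 2 * pi * real_of_int l * real j / real M"
    using a_less_b by (simp add: wavenum_def gridpt_def)
  then show ?thesis by simp
qed

lemma dft_em:
  assumes "0 < M"
  shows "dft a b M (\<lambda>j. em i (gridpt a b M j)) l = (if int M dvd i - l then 1 else 0)"
proof -
  have "em i (gridpt a b M j) * cis (- (wn l * (gridpt a b M j - a)))
      = cis (2 * pi * real_of_int (i - l) * real j / real M)" for j
    unfolding em_gridpt[symmetric] by (simp add: cis_mult wn_diff algebra_simps)
  then show ?thesis using assms by (simp add: dft_def sum_roots_of_unity del: of_int_diff)
qed

lemma dft_add: "dft a b M (\<lambda>j. u j + v j) l = dft a b M u l + dft a b M v l"
  by (simp add: dft_def distrib_right sum.distrib add_divide_distrib)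

lemma dft_diff: "dft a b M (\<lambda>j. u j - v j) l = dft a b M u l - dft a b M v l"
  by (simp add: dft_def left_diff_distrib sum_subtractf diff_divide_distrib)

lemma dft_cmult: "dft a b M (\<lambda>j. c * u j) l = c * dft a b M u l"
  by (simp add: dft_def sum_distrib_left mult.assoc)

lemma dft_sum: "dft a b M (\<lambda>j. \<Sum>i\<in>I. u i j) l = (\<Sum>i\<in>I. dft a b M (u i) l)"
  unfolding dft_def sum_distrib_right sum_divide_distrib by (rule sum.swap)

lemma dft_cong: "(\<And>j. j < M \<Longrightarrow> u j = v j) \<Longrightarrow> dft a b M u l = dft a b M v l"
  by (simp add: dft_def)

lemma modes_dvd_imp_eq:
  assumes "l \<in> modes M" "i \<in> modes M" "int M dvd i - l"
  shows "i = l"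
proof (rule ccontr)
  assume "i \<noteq> l"
  then have "int M \<le> \<bar>i - l\<bar>"
    using assms(3) by (intro zdvd_imp_le) auto
  moreover have "2 * (int M div 2) \<le> int M" by simp
  ultimately show False using assms(1,2) unfolding modes_def by (auto simp: abs_if split: if_splits)
qed

lemma dft_trig_sum:
  assumes "0 < M" "l \<in> modes M"
  shows "dft a b M (\<lambda>j. trig_sum a b M w (gridpt a b M j)) l = w l"
proof -
  have "dft a b M (\<lambda>j. trig_sum a b M w (gridpt a b M j)) l
      = (\<Sum>i\<in>modes M. w i * (if int M dvd i - l then 1 else 0))"
    unfolding trig_sum_def by (simp add: dft_sum dft_cmult dft_em[OF assms(1)])
  also have "\<dots> = (\<Sum>i\<in>modes M. if i = l then w l else 0)"
    using modes_dvd_imp_eq[OF assms(2)] by (intro sum.cong) auto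
  also have "\<dots> = w l" using assms(2) by simp
  finally show ?thesis .
qed

lemma sum_dft_cnj:
  assumes "0 < M"
  shows "(\<Sum>j<M. v j * cnj (trig_sum a b M d (gridpt a b M j)))
      = of_nat M * (\<Sum>l\<in>modes M. dft a b M v l * cnj (d l))"
proof -
  have "(\<Sum>j<M. v j * cnj (trig_sum a b M d (gridpt a b M j)))
      = (\<Sum>j<M. \<Sum>l\<in>modes M. cnj (d l) * (v j * cis (- (wn l * (gridpt a b M j - a)))))"
    by (simp add: trig_sum_def sum_distrib_left cis_cnj mult_ac)
  also have "\<dots> = (\<Sum>l\<in>modes M. \<Sum>j<M. cnj (d l) * (v j * cis (- (wn l * (gridpt a b M j - a)))))"
    by (rule sum.swap)
  also have "\<dots> = (\<Sum>l\<in>modes M. of_nat M * (dft a b M v l * cnj (d l)))"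
    using assms by (intro sum.cong) (simp_all add: dft_def sum_distrib_left[symmetric])
  finally show ?thesis by (simp add: sum_distrib_left)
qed

text \<open>The mixed sums of \<open>v\<close> and its trigonometric sum \<open>s\<close> over the
  grid all equal \<open>M * D\<close>, so the claim says that the squared distance between
  \<open>v\<close> and \<open>s\<close> is nonnegative.\<close>

lemma dft_bessel:
  assumes "0 < M"
  shows "real M * (\<Sum>l\<in>modes M. (cmod (dft a b M v l))\<^sup>2) \<le> (\<Sum>j<M. (cmod (v j))\<^sup>2)"
proof -
  define d where "d = dft a b M v"
  define s where "s j = trig_sum a b M d (gridpt a b M j)" for j
  define D where "D = (\<Sum>l\<in>modes M. (cmod (d l))\<^sup>2)"
  have D: "(\<Sum>l\<in>modes M. d l * cnj (d l)) = of_real D"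
    by (simp only: D_def of_real_sum complex_norm_square)
  have vs: "(\<Sum>j<M. v j * cnj (s j)) = of_nat M * of_real D"
    unfolding s_def sum_dft_cnj[OF assms] by (simp add: D flip: d_def)
  have "(\<Sum>j<M. s j * cnj (s j)) = of_nat M * (\<Sum>l\<in>modes M. d l * cnj (d l))"
    unfolding s_def sum_dft_cnj[OF assms] using dft_trig_sum[OF assms] by simp
  then have ss: "(\<Sum>j<M. s j * cnj (s j)) = of_nat M * of_real D"
    by (simp only: D)
  have sv: "(\<Sum>j<M. s j * cnj (v j)) = of_nat M * of_real D"
    using arg_cong[OF vs, of cnj] by (simp add: mult.commute)
  have "complex_of_real (\<Sum>j<M. (cmod (v j - s j))\<^sup>2) = (\<Sum>j<M. (v j - s j) * cnj (v j - s j))"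
    by (simp only: of_real_sum complex_norm_square)
  also have "\<dots> = (\<Sum>j<M. v j * cnj (v j)) - (\<Sum>j<M. v j * cnj (s j))
      - (\<Sum>j<M. s j * cnj (v j)) + (\<Sum>j<M. s j * cnj (s j))"
    by (simp add: algebra_simps sum.distrib sum_subtractf)
  also have "\<dots> = complex_of_real ((\<Sum>j<M. (cmod (v j))\<^sup>2) - real M * D)"
    unfolding vs sv ss by (simp only: of_real_diff of_real_sum of_real_mult of_real_of_nat_eq complex_norm_square) simp
  finally have "(\<Sum>j<M. (cmod (v j - s j))\<^sup>2) = (\<Sum>j<M. (cmod (v j))\<^sup>2) - real M * D"
    by (simp only: of_real_eq_iff)
  moreover have "0 \<le> (\<Sum>j<M. (cmod (v j - s j))\<^sup>2)" by (intro sum_nonneg) auto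
  ultimately show ?thesis by (simp add: D_def d_def)
qed

text \<open>The factor \<open>1 / M\<close> in \<open>dft\<close> compensates the number of grid
  points, so a maximum bound on the grid passes to the coefficients with constant 1.\<close>

lemma L2_set_dft_le:
  assumes "0 < M" "0 \<le> B" "\<And>j. j < M \<Longrightarrow> cmod (v j) \<le> B"
  shows "L2_set (\<lambda>l. cmod (dft a b M v l)) (modes M) \<le> B"
proof -
  have "(\<Sum>j<M. (cmod (v j))\<^sup>2) \<le> (\<Sum>j<M. B\<^sup>2)"
    using assms(3) by (intro sum_mono power_mono) auto
  then have "real M * (\<Sum>l\<in>modes M. (cmod (dft a b M v l))\<^sup>2) \<le> real M * B\<^sup>2"
    using dft_bessel[OF assms(1), of v] by simp
  then have "(\<Sum>l\<in>modes M. (cmod (dft a b M v l))\<^sup>2) \<le> B\<^sup>2"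
    using assms(1) by simp
  then show ?thesis unfolding L2_set_def using assms(2) by (intro real_le_lsqrt) (auto intro: sum_nonneg)
qed

text \<open>On the grid \<open>em i\<close> and \<open>em l\<close> coincide when \<open>i\<close>
  and \<open>l\<close> are congruent modulo \<open>M\<close>. Sampling therefore folds a whole
  residue class of coefficients into one.\<close>

lemma aliasing_has_sum:
  assumes M: "0 < M" and u: "fseries c u"
  shows "((\<lambda>p. c (l + p * int M)) has_sum dft a b M (\<lambda>j. u (gridpt a b M j)) l) UNIV"
proof -
  have "((\<lambda>i. c i * em i (gridpt a b M j) * cis (- (wn l * (gridpt a b M j - a))))
      has_sum u (gridpt a b M j) * cis (- (wn l * (gridpt a b M j - a)))) UNIV" if "j < M" for j
    using that M by (intro has_sum_cmult_left fseriesD[OF u] gridpt_in) auto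
  then have "((\<lambda>i. \<Sum>j<M. c i * em i (gridpt a b M j) * cis (- (wn l * (gridpt a b M j - a))))
      has_sum (\<Sum>j<M. u (gridpt a b M j) * cis (- (wn l * (gridpt a b M j - a))))) UNIV"
    by (intro has_sum_sum) auto
  then have "((\<lambda>i. (\<Sum>j<M. c i * em i (gridpt a b M j) * cis (- (wn l * (gridpt a b M j - a)))) / of_nat M)
      has_sum dft a b M (\<lambda>j. u (gridpt a b M j)) l) UNIV"
    unfolding dft_def by (rule has_sum_divide_const)
  also have "(\<lambda>i. (\<Sum>j<M. c i * em i (gridpt a b M j) * cis (- (wn l * (gridpt a b M j - a)))) / of_nat M)
      = (\<lambda>i. c i * dft a b M (\<lambda>j. em i (gridpt a b M j)) l)"
    by (simp add: dft_def sum_distrib_left mult.assoc)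
  finally have "((\<lambda>i. c i * (if int M dvd i - l then 1 else 0))
      has_sum dft a b M (\<lambda>j. u (gridpt a b M j)) l) UNIV"
    by (simp add: dft_em[OF M])
  then have "(c has_sum dft a b M (\<lambda>j. u (gridpt a b M j)) l) {i. int M dvd i - l}"
    by (rule has_sum_cong_neutral[THEN iffD1, rotated -1]) auto
  then show ?thesis
    by (subst has_sum_reindex_bij_betw[of _ _ "{i. int M dvd i - l}"])
      (use M in \<open>auto simp: bij_betw_def inj_on_def image_def dvd_def algebra_simps\<close>)
qed

text \<open>A grid mode satisfies \<open>2 * \<bar>l\<bar> \<le> M\<close>, so its alias has index
  at least \<open>\<bar>p\<bar> * M / 2\<close> in modulus; the lost factor 2 is recovered from
  \<open>2 * pi\<close> in the wave number.\<close>

lemma weight_alias_ge: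
  assumes "0 < M" "l \<in> modes M" "p \<noteq> 0"
  shows "\<bar>real_of_int p\<bar> / ((b - a) / real M) \<le> weight (l + p * int M)"
proof -
  have "\<bar>p\<bar> * int M \<le> 2 * \<bar>l + p * int M\<bar>"
  proof -
    have "2 * \<bar>l\<bar> \<le> int M" using assms(2) unfolding modes_def by (auto simp: abs_if)
    also have "1 \<le> \<bar>p\<bar>" using assms(3) by linarith
    then have "int M \<le> \<bar>p\<bar> * int M" using mult_right_mono[of 1 "\<bar>p\<bar>" "int M"] by simp
    finally have "2 * \<bar>l\<bar> \<le> \<bar>p * int M\<bar>" by (simp add: abs_mult)
    moreover have "\<bar>x\<bar> \<le> 2 * \<bar>l + x\<bar>" if "2 * \<bar>l\<bar> \<le> \<bar>x\<bar>" for x :: int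
      using that by (auto simp: abs_if split: if_splits)
    ultimately have "\<bar>p * int M\<bar> \<le> 2 * \<bar>l + p * int M\<bar>" by blast
    then show ?thesis by (simp add: abs_mult)
  qed
  then have "real_of_int (\<bar>p\<bar> * int M) \<le> real_of_int (2 * \<bar>l + p * int M\<bar>)"
    by (simp only: of_int_le_iff)
  also have "\<dots> \<le> 2 * pi * real_of_int \<bar>l + p * int M\<bar>"
    using pi_gt3 mult_right_mono[of 2 "2 * pi" "real_of_int \<bar>l + p * int M\<bar>"] by simp
  finally have "\<bar>real_of_int p\<bar> * real M / (b - a) \<le> 2 * pi * real_of_int \<bar>l + p * int M\<bar> / (b - a)"
    using a_less_b by (intro divide_right_mono) auto
  also have "\<dots> = \<bar>wn (l + p * int M)\<bar>"
    using a_less_b by (simp add: wavenum_def abs_mult abs_divide)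
  finally show ?thesis using wn_le_weight[of "l + p * int M"] by simp
qed

text \<open>For fixed \<open>l\<close>, Cauchy-Schwarz over the nonzero \<open>p\<close> separates
  the powers of \<open>h\<close> from the weighted coefficients; the sum of
  \<open>1 / p\<^sup>2\<close> is at most 4, which gives the factor 2. Distinct pairs
  \<open>(l, p)\<close> address distinct modes \<open>l + p * M\<close>, so what remains is part of
  a single H^(k+1) norm.\<close>

lemma aliasing_L2:
  assumes M: "0 < M" and u: "fseries c u" and H: "Hbound (Suc k) C c"
  shows "L2_set (\<lambda>l. cmod (c l - dft a b M (\<lambda>j. u (gridpt a b M j)) l)) (modes M)
      \<le> 2 * ((b - a) / real M) ^ Suc k * C"
proof -
  define h where "h = (b - a) / real M"
  have h: "0 < h" using M a_less_b by (simp add: h_def)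
  define w where "w l p = weight (l + p * int M) ^ Suc k * cmod (c (l + p * int M))" for l p
  let ?d = "dft a b M (\<lambda>j. u (gridpt a b M j))"
  have sums: "((\<lambda>p. c (l + p * int M)) has_sum ?d l - c l) (UNIV - {0})" for l
  proof -
    have "((\<lambda>p. c (l + p * int M)) has_sum c l) {0}"
      using has_sum_finite[of "{0}" "\<lambda>p. c (l + p * int M)"] by simp
    from has_sum_Diff[OF aliasing_has_sum[OF M u] this] show ?thesis by simp
  qed
  have "L2_set (\<lambda>l. 1 * cmod (?d l - c l)) (modes M) \<le> 2 * h ^ Suc k * C"
  proof (rule L2_set_has_sum_le[OF sums])
    fix J :: "int set" assume J: "finite J" "J \<subseteq> UNIV - {0}"
    have bound: "cmod (\<Sum>p\<in>J. c (l + p * int M)) \<le> 2 * h ^ Suc k * L2_set (w l) J"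
      if l: "l \<in> modes M" for l
    proof -
      have pos: "0 < weight (l + p * int M) ^ Suc k" for p by (simp add: weight_pos)
      have "cmod (\<Sum>p\<in>J. c (l + p * int M)) \<le> (\<Sum>p\<in>J. cmod (c (l + p * int M)))"
        by (rule norm_sum)
      also have "\<dots> = (\<Sum>p\<in>J. \<bar>1 / weight (l + p * int M) ^ Suc k\<bar> * \<bar>w l p\<bar>)"
        using pos by (intro sum.cong refl) (simp add: w_def abs_mult less_imp_neq[OF weight_pos, symmetric])
      also have "\<dots> \<le> L2_set (\<lambda>p. 1 / weight (l + p * int M) ^ Suc k) J * L2_set (w l) J"
        by (rule L2_set_mult_ineq)
      also have "L2_set (\<lambda>p. 1 / weight (l + p * int M) ^ Suc k) J
          \<le> L2_set (\<lambda>p. h ^ Suc k * (1 / \<bar>real_of_int p\<bar>)) J"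
      proof (rule L2_set_mono)
        fix p assume "p \<in> J"
        then have p: "1 \<le> \<bar>real_of_int p\<bar>" "p \<noteq> 0" using J by auto
        have "(\<bar>real_of_int p\<bar> / h) ^ Suc k \<le> weight (l + p * int M) ^ Suc k"
          using weight_alias_ge[OF M l p(2)] a_less_b by (intro power_mono) (auto simp: h_def)
        then have "1 / weight (l + p * int M) ^ Suc k \<le> 1 / (\<bar>real_of_int p\<bar> / h) ^ Suc k"
          using pos[of p] h p by (intro divide_left_mono mult_pos_pos) auto
        also have "\<dots> = h ^ Suc k * (1 / \<bar>real_of_int p\<bar> ^ Suc k)"
          using h p by (simp add: power_divide)
        also have "\<dots> \<le> h ^ Suc k * (1 / \<bar>real_of_int p\<bar>)"
          using h p self_le_power[OF p(1), of "Suc k"] by (intro mult_left_mono divide_left_mono) auto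
        finally show "1 / weight (l + p * int M) ^ Suc k \<le> h ^ Suc k * (1 / \<bar>real_of_int p\<bar>)" .
      qed (use pos in \<open>simp add: less_imp_le\<close>)
      also have "\<dots> = h ^ Suc k * L2_set (\<lambda>p. 1 / \<bar>real_of_int p\<bar>) J"
        using h by (simp add: L2_set_right_distrib)
      also have "L2_set (\<lambda>p. 1 / \<bar>real_of_int p\<bar>) J \<le> 2"
        unfolding L2_set_def using J sum_inverse_squares_le[of J]
        by (intro real_le_lsqrt) (auto simp: power_divide sum_nonneg)
      finally show ?thesis using h by (simp add: mult_right_mono mult_ac)
    qed
    have "L2_set (\<lambda>l. 1 * cmod (\<Sum>p\<in>J. c (l + p * int M))) (modes M)
        \<le> L2_set (\<lambda>l. 2 * h ^ Suc k * L2_set (w l) J) (modes M)"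
      using bound by (intro L2_set_mono) auto
    also have "\<dots> = 2 * h ^ Suc k * L2_set (\<lambda>l. L2_set (w l) J) (modes M)"
      using h by (simp add: L2_set_right_distrib)
    also have "L2_set (\<lambda>l. L2_set (w l) J) (modes M) = sqrt (\<Sum>(l, p)\<in>modes M \<times> J. (w l p)\<^sup>2)"
      by (simp add: L2_set_def sum_nonneg sum.cartesian_product)
    also have "\<dots> = L2_set (\<lambda>q. weight (fst q + snd q * int M) ^ Suc k * cmod (c (fst q + snd q * int M))) (modes M \<times> J)"
      by (simp add: L2_set_def w_def case_prod_beta)
    also have "\<dots> = L2_set (\<lambda>l. weight l ^ Suc k * cmod (c l)) ((\<lambda>q. fst q + snd q * int M) ` (modes M \<times> J))"
    proof (rule L2_set_reindex)
      show "inj_on (\<lambda>q. fst q + snd q * int M) (modes M \<times> J)"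
      proof (rule inj_onI, clarsimp)
        fix l l' p p' assume ll: "l \<in> modes M" "l' \<in> modes M" and eq: "l + p * int M = l' + p' * int M"
        then have "l' - l = (p - p') * int M" by (simp add: algebra_simps)
        then have "l' = l" using modes_dvd_imp_eq[OF ll] by simp
        then show "l = l' \<and> p = p'" using eq M by simp
      qed
    qed
    also have "\<dots> \<le> C" using HboundD[OF H] J by simp
    finally show "L2_set (\<lambda>l. 1 * cmod (\<Sum>p\<in>J. c (l + p * int M))) (modes M) \<le> 2 * h ^ Suc k * C"
      using h by (simp add: mult_left_mono)
  qed
  then show ?thesis by (simp add: h_def norm_minus_commute)
qed

text \<open>Inverse inequality on the grid modes. The 4 bounds \<open>pi\<close>, and the summand
  \<open>b - a\<close> turns into \<open>real M\<close>, which absorbs the 1 in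
  \<open>weight l \<le> 1 + \<bar>wn l\<bar>\<close>.\<close>

lemma weight_modes_le:
  assumes "0 < M" "l \<in> modes M"
  shows "weight l \<le> (b - a + 4) / ((b - a) / real M)"
proof -
  have "weight l \<le> 1 + \<bar>wn l\<bar>"
    unfolding weight_def by (intro real_le_lsqrt) (auto simp: power2_eq_square algebra_simps)
  also have "\<bar>wn l\<bar> = pi * (2 * real_of_int \<bar>l\<bar>) / (b - a)"
    using a_less_b by (simp add: wavenum_def abs_mult abs_divide)
  also have "\<dots> \<le> 4 * real M / (b - a)"
  proof (intro divide_right_mono mult_mono)
    have "2 * \<bar>l\<bar> \<le> int M" using assms(2) unfolding modes_def by (auto simp: abs_if)
    then show "2 * real_of_int \<bar>l\<bar> \<le> real M" by linarith
  qed (use pi_less_4 a_less_b in auto)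
  finally have "weight l \<le> 1 + 4 * real M / (b - a)" by simp
  moreover have "1 \<le> real M" using assms(1) by simp
  moreover have "(b - a + 4) / ((b - a) / real M) = real M + 4 * real M / (b - a)"
    using a_less_b assms(1) by (simp add: divide_simps) (simp add: algebra_simps)
  ultimately show ?thesis by linarith
qed

text \<open>One power of \<open>h\<close> in the L^2 estimate pays for the weight.\<close>

lemma aliasing_H1:
  assumes M: "0 < M" and u: "fseries c u" and H: "Hbound (Suc k) C c"
  shows "L2_set (\<lambda>l. weight l * cmod (c l - dft a b M (\<lambda>j. u (gridpt a b M j)) l)) (modes M)
      \<le> 2 * (b - a + 4) * ((b - a) / real M) ^ k * C"
proof -
  define h where "h = (b - a) / real M"
  have h: "0 < h" using M a_less_b by (simp add: h_def)
  let ?e = "\<lambda>l. cmod (c l - dft a b M (\<lambda>j. u (gridpt a b M j)) l)"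
  have "L2_set (\<lambda>l. weight l * ?e l) (modes M) \<le> L2_set (\<lambda>l. (b - a + 4) / h * ?e l) (modes M)"
    using weight_modes_le[OF M] weight_pos by (intro L2_set_mono mult_right_mono) (auto simp: h_def less_imp_le)
  also have "\<dots> = (b - a + 4) / h * L2_set ?e (modes M)"
    using h a_less_b by (intro L2_set_right_distrib[symmetric]) auto
  also have "\<dots> \<le> (b - a + 4) / h * (2 * h ^ Suc k * C)"
    using aliasing_L2[OF M u H] h a_less_b by (intro mult_left_mono) (auto simp: h_def)
  also have "\<dots> = 2 * (b - a + 4) * h ^ k * C"
    using h by simp
  finally show ?thesis by (simp add: h_def)
qed

text \<open>Off the grid modes \<open>h * weight l\<close> is at least 1, so inserting its
  \<open>k\<close>-th power only enlarges the sum. Evenness of \<open>M\<close> guarantees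
  \<open>M \<le> 2 * \<bar>l\<bar>\<close> also just above the upper end of the range.\<close>

lemma Hbound_tail:
  assumes M: "0 < M" "even M" and H: "Hbound (Suc k) C c" and F: "finite F" "F \<inter> modes M = {}"
  shows "L2_set (\<lambda>l. weight l * cmod (c l)) F \<le> ((b - a) / real M) ^ k * C"
proof -
  define h where "h = (b - a) / real M"
  have h: "0 < h" using M a_less_b by (simp add: h_def)
  have "L2_set (\<lambda>l. weight l * cmod (c l)) F \<le> L2_set (\<lambda>l. h ^ k * (weight l ^ Suc k * cmod (c l))) F"
  proof (rule L2_set_mono)
    fix l assume "l \<in> F"
    then have "l \<notin> modes M" using F by auto
    then have "int M \<le> 2 * \<bar>l\<bar>" using M(2) by (auto simp: modes_def)
    then have "real M \<le> 2 * real_of_int \<bar>l\<bar>" by linarith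
    also have "\<dots> \<le> 2 * pi * real_of_int \<bar>l\<bar>"
      using pi_gt3 by (intro mult_right_mono) auto
    finally have "real M / (b - a) \<le> 2 * pi * real_of_int \<bar>l\<bar> / (b - a)"
      using a_less_b by (intro divide_right_mono) auto
    also have "\<dots> = \<bar>wn l\<bar>"
      using a_less_b by (simp add: wavenum_def abs_mult abs_divide)
    finally have "1 / h \<le> weight l" using wn_le_weight[of l] by (simp add: h_def)
    then have "1 \<le> h * weight l" using h by (simp add: field_simps)
    then have "1 \<le> (h * weight l) ^ k" by (rule one_le_power)
    then have "1 * (weight l * cmod (c l)) \<le> (h * weight l) ^ k * (weight l * cmod (c l))"
      using weight_pos[of l] by (intro mult_right_mono) auto
    then show "weight l * cmod (c l) \<le> h ^ k * (weight l ^ Suc k * cmod (c l))"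
      by (simp add: power_mult_distrib mult_ac)
  qed (simp add: weight_pos less_imp_le)
  also have "\<dots> = h ^ k * L2_set (\<lambda>l. weight l ^ Suc k * cmod (c l)) F"
    using h by (simp add: L2_set_right_distrib)
  also have "\<dots> \<le> h ^ k * C"
    using HboundD[OF H F(1)] h by (intro mult_left_mono) auto
  finally show ?thesis by (simp add: h_def)
qed

section \<open>Translation between \<open>Hbound\<close> and the norms of the theorem\<close>

lemma Hper_weight_eq:
  "(1 + (wn l)\<^sup>2) ^ k * (cmod (fc u l))\<^sup>2 = (weight l ^ k * cmod (fc u l))\<^sup>2"
proof -
  have "(weight l ^ k)\<^sup>2 = ((weight l)\<^sup>2) ^ k"
    by (simp only: power_mult[symmetric] mult.commute)
  then show ?thesis by (simp add: power_mult_distrib weight_sq)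
qed

lemma Hbound_iff_sum:
  "Hbound k C c \<longleftrightarrow> 0 \<le> C \<and> (\<forall>F. finite F \<longrightarrow> (\<Sum>l\<in>F. (weight l ^ k * cmod (c l))\<^sup>2) \<le> C\<^sup>2)"
proof (intro iffI conjI allI impI)
  assume H: "Hbound k C c"
  then show C: "0 \<le> C" by (rule Hbound_nonneg)
  fix F :: "int set" assume "finite F"
  with HboundD[OF H] have "(L2_set (\<lambda>l. weight l ^ k * cmod (c l)) F)\<^sup>2 \<le> C\<^sup>2"
    by (intro power_mono) auto
  then show "(\<Sum>l\<in>F. (weight l ^ k * cmod (c l))\<^sup>2) \<le> C\<^sup>2"
    by (simp add: L2_set_def sum_nonneg)
next
  assume "0 \<le> C \<and> (\<forall>F. finite F \<longrightarrow> (\<Sum>l\<in>F. (weight l ^ k * cmod (c l))\<^sup>2) \<le> C\<^sup>2)"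
  then show "Hbound k C c"
    unfolding Hbound_def L2_set_def by (auto intro!: real_le_lsqrt sum_nonneg)
qed

lemma Hper_norm_le:
  assumes u: "continuous_on {a..b} u" and H: "Hbound k C (fc u)"
  shows "Hper_norm a b k u \<le> ennreal C"
proof -
  let ?w = "\<lambda>l. (weight l ^ k * cmod (fc u l))\<^sup>2"
  have C: "0 \<le> C" and le: "\<And>F. finite F \<Longrightarrow> sum ?w F \<le> C\<^sup>2"
    using H by (auto simp: Hbound_iff_sum)
  have summ: "?w summable_on UNIV"
    using le by (intro nonneg_bounded_partial_sums_imp_summable_on eventually_finite_subsets_at_top_weakI) auto
  have "infsum ?w UNIV \<le> C\<^sup>2" by (rule infsum_le_finite_sums[OF summ le])
  then have "sqrt (infsum ?w UNIV) \<le> C" using C by (intro real_le_lsqrt) (auto intro: infsum_nonneg)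
  moreover have "square_integrable a b u"
    unfolding square_integrable_def
    by (intro conjI continuous_imp_measurable_on_sets_lebesgue continuous_imp_integrable_real continuous_intros u) auto
  ultimately show ?thesis
    using summ by (simp add: Hper_norm_def Hper_weight_eq Let_def ennreal_leI)
qed

lemma Hbound_fc_of_Hper_norm:
  assumes "Hper_norm a b k u \<le> ennreal C" "0 \<le> C"
  shows "Hbound k C (fc u)"
proof -
  let ?w = "\<lambda>l. (weight l ^ k * cmod (fc u l))\<^sup>2"
  have summ: "?w summable_on UNIV" and le: "ennreal (sqrt (infsum ?w UNIV)) \<le> ennreal C"
    using assms(1) by (auto simp: Hper_norm_def Hper_weight_eq Let_def top_unique split: if_splits)
  have "sqrt (infsum ?w UNIV) \<le> C" using le assms(2) by simp
  then have "infsum ?w UNIV \<le> C\<^sup>2" by (rule sqrt_le_D)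
  then show ?thesis
    unfolding Hbound_iff_sum using finite_sum_le_infsum[OF summ] assms(2) by (force intro: order_trans)
qed

lemma norm_le_Linf_norm:
  assumes u: "continuous_on {a..b} u" and x: "x \<in> {a..b}"
  shows "ennreal (cmod (u x)) \<le> Linf_norm a b u"
proof (cases "Linf_norm a b u")
  case (real r)
  have "AE y in lebesgue_on {a..b}. ennreal (cmod (u y)) \<le> Linf_norm a b u"
    unfolding Linf_norm_def by (rule esssup_AE)
  then have "AE y in lebesgue_on {a..b}. cmod (u y) \<le> r"
    using real by simp
  then have "cmod (u x) \<le> r"
    by (intro continuous_ae_le_imp_le[OF a_less_b _ _ x] continuous_intros u) auto
  then show ?thesis using real by (simp add: ennreal_leI)
qed simp

end

section \<open>Duhamel formula for the Fourier modes\<close>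

text \<open>Minkowski's integral inequality by duality: pairing the vector of integrals
  \<open>z\<close> with itself moves the sum under the integral, where Cauchy-Schwarz gives
  \<open>N * B\<close>; one factor \<open>N\<close> cancels.\<close>

lemma L2_set_integral_le:
  fixes v :: "'i \<Rightarrow> real \<Rightarrow> complex"
  assumes "p \<le> q" and cont: "\<And>l. l \<in> F \<Longrightarrow> continuous_on {p..q} (v l)"
    and bound: "\<And>s. s \<in> {p..q} \<Longrightarrow> L2_set (\<lambda>l. cmod (v l s)) F \<le> B"
  shows "L2_set (\<lambda>l. cmod (integral {p..q} (v l))) F \<le> (q - p) * B"
proof -
  define z where "z l = integral {p..q} (v l)" for l
  define N where "N = L2_set (\<lambda>l. cmod (z l)) F"
  have N: "0 \<le> N" by (simp add: N_def)
  have "0 \<le> B" using bound[of p] assms(1) order_trans[OF L2_set_nonneg] by auto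
  have "complex_of_real (N\<^sup>2) = (\<Sum>l\<in>F. cnj (z l) * z l)"
    by (simp only: N_def L2_set_def real_sqrt_pow2[OF sum_nonneg] zero_le_power2 of_real_sum complex_norm_square mult.commute)
  also have "\<dots> = (\<Sum>l\<in>F. integral {p..q} (\<lambda>s. cnj (z l) * v l s))"
    by (simp add: z_def)
  also have "\<dots> = integral {p..q} (\<lambda>s. \<Sum>l\<in>F. cnj (z l) * v l s)"
  proof (cases "finite F")
    case True
    then show ?thesis
      by (intro integral_sum[symmetric] integrable_continuous_interval continuous_intros cont) auto
  qed simp
  finally have eq: "complex_of_real (N\<^sup>2) = integral {p..q} (\<lambda>s. \<Sum>l\<in>F. cnj (z l) * v l s)" .
  have "cmod (integral {p..q} (\<lambda>s. \<Sum>l\<in>F. cnj (z l) * v l s)) \<le> (N * B) * (q - p)"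
  proof (rule integral_bound[OF assms(1)])
    fix s assume s: "s \<in> {p..q}"
    have "cmod (\<Sum>l\<in>F. cnj (z l) * v l s) \<le> (\<Sum>l\<in>F. cmod (cnj (z l) * v l s))"
      by (rule norm_sum)
    also have "\<dots> = (\<Sum>l\<in>F. \<bar>cmod (z l)\<bar> * \<bar>cmod (v l s)\<bar>)"
      by (simp add: norm_mult)
    also have "\<dots> \<le> N * L2_set (\<lambda>l. cmod (v l s)) F"
      unfolding N_def by (rule L2_set_mult_ineq)
    also have "\<dots> \<le> N * B"
      using bound[OF s] N by (rule mult_left_mono)
    finally show "cmod (\<Sum>l\<in>F. cnj (z l) * v l s) \<le> N * B" .
  qed (intro continuous_intros cont)
  then have "N\<^sup>2 \<le> (N * B) * (q - p)"
    unfolding eq[symmetric] by (simp add: norm_power)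
  then have "N * N \<le> N * ((q - p) * B)"
    by (simp add: power2_eq_square algebra_simps)
  then have "N \<le> (q - p) * B"
    using N \<open>0 \<le> B\<close> assms(1) by (cases "N = 0") (auto simp: mult_le_cancel_left)
  then show ?thesis by (simp add: N_def z_def)
qed

locale nlsw_modes = periodic_interval +
  fixes \<alpha> :: real
  assumes \<alpha>_pos: "0 < \<alpha>" and \<alpha>_le_1: "\<alpha> \<le> 1"
begin

abbreviation bp :: "int \<Rightarrow> real" where "bp \<equiv> beta_p a b \<alpha>"
abbreviation bm :: "int \<Rightarrow> real" where "bm \<equiv> beta_m a b \<alpha>"
abbreviation bd :: "int \<Rightarrow> real" where "bd \<equiv> beta_d a b \<alpha>"

lemma bd_eq: "bd l = sqrt (1 + 4 * \<alpha> * (wn l)\<^sup>2) / \<alpha>"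
  using \<alpha>_pos by (simp add: beta_d_def beta_p_def beta_m_def field_simps)

lemma bp_plus_bm: "bp l + bm l = 1 / \<alpha>"
  using \<alpha>_pos by (simp add: beta_p_def beta_m_def field_simps)

lemma bp_minus_bm: "bp l - bm l = bd l"
  by (simp add: beta_d_def)

text \<open>Together with \<open>bp_plus_bm\<close>, Vieta's relations for the characteristic
  equation \<open>\<alpha> * x\<^sup>2 - x - (wn l)\<^sup>2 = 0\<close> of the mode.\<close>

lemma bp_times_bm: "bp l * bm l = - ((wn l)\<^sup>2 / \<alpha>)"
proof -
  have "0 \<le> 1 + 4 * \<alpha> * (wn l)\<^sup>2" using \<alpha>_pos by (simp add: add_nonneg_nonneg)
  then have "(1 + sqrt (1 + 4 * \<alpha> * (wn l)\<^sup>2)) * (1 - sqrt (1 + 4 * \<alpha> * (wn l)\<^sup>2)) = - (4 * \<alpha> * (wn l)\<^sup>2)"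
    by (simp add: algebra_simps flip: power2_eq_square)
  then show ?thesis
    using \<alpha>_pos by (simp add: beta_p_def beta_m_def power2_eq_square field_simps)
qed

lemma bm_nonpos: "bm l \<le> 0"
  using \<alpha>_pos by (simp add: beta_m_def divide_nonpos_pos)

lemma bp_pos: "0 < bp l"
proof -
  have "0 \<le> sqrt (1 + 4 * \<alpha> * (wn l)\<^sup>2)" using \<alpha>_pos by simp
  then show ?thesis using \<alpha>_pos unfolding beta_p_def by (intro divide_pos_pos) linarith+
qed

text \<open>This comparison, which relies on \<alpha> \<le> 1, makes the kernel gain one derivative.
  The opposite one in \<open>bd_le_weight\<close> lets the kernel control the velocity in
  \<open>velocity_bound\<close>.\<close>

lemma weight_le_bd: "weight l \<le> bd l"
proof -
  have "\<alpha> * \<alpha> \<le> 1" using \<alpha>_pos \<alpha>_le_1 by (simp add: mult_le_one)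
  moreover have "(\<alpha> * \<alpha>) * (wn l)\<^sup>2 \<le> (4 * \<alpha>) * (wn l)\<^sup>2"
    using \<alpha>_pos \<alpha>_le_1 by (intro mult_right_mono mult_right_mono) auto
  ultimately have "\<alpha>\<^sup>2 * (1 + (wn l)\<^sup>2) \<le> 1 + 4 * \<alpha> * (wn l)\<^sup>2"
    by (simp add: power2_eq_square algebra_simps)
  then have "sqrt (\<alpha>\<^sup>2) * sqrt (1 + (wn l)\<^sup>2) \<le> sqrt (1 + 4 * \<alpha> * (wn l)\<^sup>2)"
    unfolding real_sqrt_mult[symmetric] by (rule real_sqrt_le_mono)
  then show ?thesis
    using \<alpha>_pos by (simp add: bd_eq weight_def field_simps)
qed

lemma bd_pos: "0 < bd l"
  using weight_le_bd[of l] weight_pos[of l] by linarith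

lemma bd_le_weight: "bd l \<le> 2 / \<alpha> * weight l"
proof -
  have "\<alpha> * (wn l)\<^sup>2 \<le> 1 * (wn l)\<^sup>2"
    using \<alpha>_le_1 by (intro mult_right_mono) auto
  then have "sqrt (1 + 4 * \<alpha> * (wn l)\<^sup>2) \<le> sqrt (2\<^sup>2 * (1 + (wn l)\<^sup>2))"
    by simp
  also have "\<dots> = 2 * weight l" unfolding weight_def real_sqrt_mult by simp
  finally show ?thesis using \<alpha>_pos by (simp add: bd_eq field_simps)
qed

text \<open>
  The responses of mode \<open>l\<close> to a unit initial velocity and to a unit initial position. As functions of
  the step size they are the coefficients \<open>d\<^sup>0\<close> and \<open>c\<^sup>0\<close> of the scheme.
\<close>

definition kern :: "int \<Rightarrow> real \<Rightarrow> complex" where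
  "kern l r = (cis (bp l * r) - cis (bm l * r)) / (\<i> * of_real (bd l))"

definition resp :: "int \<Rightarrow> real \<Rightarrow> complex" where
  "resp l r = (of_real (bp l) * cis (bm l * r) - of_real (bm l) * cis (bp l * r)) / of_real (bd l)"

lemma kern_0 [simp]: "kern l 0 = 0"
  by (simp add: kern_def)

lemma resp_0 [simp]: "resp l 0 = 1"
  using bd_pos[of l] by (simp add: resp_def bp_minus_bm flip: of_real_diff)

lemma coeff_c0_eq: "coeff_c0 a b \<alpha> \<tau> l = resp l \<tau>"
  by (simp add: coeff_c0_def resp_def)

lemma cis_add_half: "cis (x + y) - cis (x - y) = 2 * \<i> * cis x * of_real (sin y)"
  by (simp add: complex_eq_iff cos_add cos_diff sin_add sin_diff)

lemma bp_bm_half: "bp l * r = r / (2 * \<alpha>) + r * bd l / 2" "bm l * r = r / (2 * \<alpha>) - r * bd l / 2"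
  using \<alpha>_pos by (simp_all add: bd_eq beta_p_def beta_m_def field_simps)

lemma kern_eq: "kern l r = 2 / of_real (bd l) * cis (r / (2 * \<alpha>)) * of_real (sin (r * bd l / 2))"
  unfolding kern_def bp_bm_half cis_add_half using bd_pos[of l] by (simp add: field_simps)

lemma coeff_d0_eq: "coeff_d0 a b \<alpha> \<tau> l = kern l \<tau>"
  using bd_pos[of l] by (simp add: coeff_d0_def kern_eq field_simps)

lemma norm_kern: "cmod (kern l r) = 2 / bd l * \<bar>sin (r * bd l / 2)\<bar>"
  using bd_pos[of l] by (simp add: kern_eq norm_mult norm_divide)

lemma weight_norm_kern_le: "weight l * cmod (kern l r) \<le> 2"
proof -
  have "weight l * cmod (kern l r) \<le> bd l * (2 / bd l * 1)"
    unfolding norm_kern using weight_le_bd[of l] weight_pos[of l] bd_pos[of l]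
    by (intro mult_mono mult_left_mono) auto
  then show ?thesis using bd_pos[of l] by simp
qed

text \<open>Since \<open>bp l\<close> is positive and \<open>bm l\<close> is not, the sum of their
  absolute values is their difference \<open>bd l\<close>.\<close>

lemma norm_resp_le: "cmod (resp l r) \<le> 1"
proof -
  have "cmod (of_real (bp l) * cis (bm l * r) - of_real (bm l) * cis (bp l * r)) \<le> \<bar>bp l\<bar> + \<bar>bm l\<bar>"
    by (rule order_trans[OF norm_triangle_ineq4]) (simp add: norm_mult)
  also have "\<dots> = bd l" using bp_pos[of l] bm_nonpos[of l] by (simp add: beta_d_def)
  finally show ?thesis using bd_pos[of l] by (simp add: resp_def norm_divide)
qed

lemma cis_deriv: "((\<lambda>r. cis (k * r)) has_vector_derivative \<i> * of_real k * cis (k * r)) (at r within A)"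
  using has_vector_derivative_cis_affine[of k 0] by simp

definition kern' :: "int \<Rightarrow> real \<Rightarrow> complex" where
  "kern' l r = (of_real (bp l) * cis (bp l * r) - of_real (bm l) * cis (bm l * r)) / of_real (bd l)"

lemma kern_deriv: "(kern l has_vector_derivative kern' l r) (at r within A)"
proof -
  have "(kern l has_vector_derivative
      (\<i> * of_real (bp l) * cis (bp l * r) - \<i> * of_real (bm l) * cis (bm l * r)) / (\<i> * of_real (bd l))) (at r within A)"
    unfolding kern_def[abs_def] by (intro has_vector_derivative_divide has_vector_derivative_diff cis_deriv)
  then show ?thesis
    by (simp add: kern'_def mult.assoc flip: right_diff_distrib)
qed

lemma resp_deriv: "(resp l has_vector_derivative - of_real ((wn l)\<^sup>2 / \<alpha>) * kern l r) (at r within A)"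
proof -
  have "(resp l has_vector_derivative
      (of_real (bp l) * (\<i> * of_real (bm l) * cis (bm l * r)) - of_real (bm l) * (\<i> * of_real (bp l) * cis (bp l * r)))
        / of_real (bd l)) (at r within A)"
    unfolding resp_def[abs_def]
    by (intro has_vector_derivative_divide has_vector_derivative_diff has_vector_derivative_mult_right cis_deriv)
  moreover have "(of_real (bp l) * (\<i> * of_real (bm l) * cis (bm l * r)) - of_real (bm l) * (\<i> * of_real (bp l) * cis (bp l * r)))
        / of_real (bd l) = of_real (bp l * bm l) * kern l r"
    using bd_pos[of l] by (simp add: kern_def field_simps)
  ultimately show ?thesis by (simp add: bp_times_bm)
qed

text \<open>In \<open>duhamel\<close> the terms with \<open>v\<close> combine to this difference,
  which reproduces the first-order term of the equation under the kernel.\<close>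

lemma resp_minus_kern': "resp l r - kern' l r = - (\<i> / of_real \<alpha>) * kern l r"
proof -
  have "resp l r - kern' l r
      = of_real (bp l + bm l) * (cis (bm l * r) - cis (bp l * r)) / of_real (bd l)"
    unfolding resp_def kern'_def diff_divide_distrib[symmetric] by (simp add: algebra_simps)
  also have "\<dots> = - (\<i> / of_real \<alpha>) * kern l r"
    unfolding bp_plus_bm kern_def using bd_pos[of l] \<alpha>_pos by (simp add: field_simps)
  finally show ?thesis .
qed

lemma continuous_on_kern: "continuous_on A (\<lambda>s. kern l (t - s))"
  unfolding kern_def using bd_pos[of l] by (intro continuous_intros) auto

text \<open>Variation of constants: without force the auxiliary function \<open>G\<close> would be
  constant along a solution, and in general its derivative is the kernel times the force. At
  \<open>s = t\<close> it equals \<open>u t\<close>, because \<open>kern l 0 = 0\<close> and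
  \<open>resp l 0 = 1\<close>.\<close>

lemma duhamel:
  assumes t: "0 \<le> t" "t \<le> S"
    and u: "\<And>s. s \<in> {0..S} \<Longrightarrow> (u has_vector_derivative v s) (at s within {0..S})"
    and v: "\<And>s. s \<in> {0..S} \<Longrightarrow> (v has_vector_derivative w s) (at s within {0..S})"
    and ode: "\<And>s. s \<in> {0..S} \<Longrightarrow> w s - \<i> / of_real \<alpha> * v s + of_real ((wn l)\<^sup>2 / \<alpha>) * u s = \<phi> s"
  shows "((\<lambda>s. kern l (t - s) * \<phi> s) has_integral u t - resp l t * u 0 - kern l t * v 0) {0..t}"
proof -
  define G where "G s = kern l (t - s) * v s + resp l (t - s) * u s" for s
  have minus: "((\<lambda>s. t - s) has_vector_derivative - 1) (at s within A)" for s A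
    using has_vector_derivative_diff[OF has_vector_derivative_const[of t] has_vector_derivative_id] by simp
  have comp: "((\<lambda>s. f (t - s)) has_vector_derivative - f' (t - s)) (at s within A)"
    if "\<And>r. (f has_vector_derivative f' r) (at r)" for f f' :: "real \<Rightarrow> complex" and s A
    using vector_diff_chain_within[OF minus[of s A] has_vector_derivative_at_within[OF that]]
    by (simp add: o_def)
  have "(G has_vector_derivative kern l (t - s) * \<phi> s) (at s within {0..t})" if s: "s \<in> {0..t}" for s
  proof -
    have sub: "(u has_vector_derivative v s) (at s within {0..t})" "(v has_vector_derivative w s) (at s within {0..t})"
      using u[of s] v[of s] s t by (auto intro: has_vector_derivative_within_subset)
    have "(G has_vector_derivative
        (kern l (t - s) * w s + - kern' l (t - s) * v s)
        + (resp l (t - s) * v s + - (- of_real ((wn l)\<^sup>2 / \<alpha>) * kern l (t - s)) * u s)) (at s within {0..t})"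
      unfolding G_def[abs_def]
      by (intro has_vector_derivative_add has_vector_derivative_mult sub comp kern_deriv resp_deriv)
    moreover have "(kern l (t - s) * w s + - kern' l (t - s) * v s)
        + (resp l (t - s) * v s + - (- of_real ((wn l)\<^sup>2 / \<alpha>) * kern l (t - s)) * u s)
        = kern l (t - s) * w s + (resp l (t - s) - kern' l (t - s)) * v s + of_real ((wn l)\<^sup>2 / \<alpha>) * kern l (t - s) * u s"
      by (simp add: algebra_simps)
    also have "\<dots> = kern l (t - s) * (w s - \<i> / of_real \<alpha> * v s + of_real ((wn l)\<^sup>2 / \<alpha>) * u s)"
      unfolding resp_minus_kern' by (simp add: algebra_simps)
    also have "\<dots> = kern l (t - s) * \<phi> s" using ode[of s] s t by simp
    finally show ?thesis by simp
  qed
  from fundamental_theorem_of_calculus[OF t(1) this]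
  have "((\<lambda>s. kern l (t - s) * \<phi> s) has_integral G t - G 0) {0..t}" .
  then show ?thesis by (simp add: G_def algebra_simps)
qed

end

section \<open>Fourier coefficients of functions of space and time\<close>

context periodic_interval
begin

abbreviation cont_rect :: "real \<Rightarrow> (real \<Rightarrow> real \<Rightarrow> complex) \<Rightarrow> bool" where
  "cont_rect S u \<equiv> continuous_on ({a..b} \<times> {0..S}) (\<lambda>(x, t). u x t)"

lemma continuous_on_section:
  assumes "cont_rect S u" "t \<in> {0..S}"
  shows "continuous_on {a..b} (\<lambda>x. u x t)"
proof -
  have "continuous_on {a..b} (\<lambda>x. (x, t))" by (intro continuous_intros)
  moreover have "(\<lambda>x. (x, t)) ` {a..b} \<subseteq> {a..b} \<times> {0..S}" using assms(2) by auto
  ultimately show ?thesis using continuous_on_compose2[OF assms(1), of _ "\<lambda>x. (x, t)"] by simp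
qed

lemma continuous_on_fc_param:
  assumes "cont_rect S u"
  shows "continuous_on {0..S} (\<lambda>t. fc (\<lambda>x. u x t) l)"
proof -
  note continuous_on_swap_args[OF assms]
  then have "continuous_on ({0..S} \<times> cbox a b) (\<lambda>(t, x). u x t * cis (- (wn l * (x - a))))"
    by (auto simp: case_prod_beta intro!: continuous_intros)
  then have "continuous_on {0..S} (\<lambda>t. integral {a..b} (\<lambda>x. u x t * cis (- (wn l * (x - a)))) / of_real (b - a))"
    using a_less_b by (intro continuous_intros integral_continuous_on_param[of _ a b, simplified]) auto
  then show ?thesis
    by (rule continuous_on_eq) (simp add: fc_integral[OF continuous_on_section[OF assms]])
qed

lemma fc_time_derivative:
  assumes u: "cont_rect S u" and C1: "C1_time a b S u" and t: "t \<in> {0..S}"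
  shows "((\<lambda>s. fc (\<lambda>x. u x s) l) has_vector_derivative fc (\<lambda>x. dt S u x t) l) (at t within {0..S})"
proof -
  have dcont: "continuous_on ({a..b} \<times> {0..S}) (\<lambda>(x, t). dt S u x t)"
    using C1 by (simp add: C1_time_def)
  note continuous_on_swap_args[OF dcont]
  then have cont: "continuous_on ({0..S} \<times> cbox a b) (\<lambda>(t, x). dt S u x t * cis (- (wn l * (x - a))))"
    by (auto simp: case_prod_beta intro!: continuous_intros)
  have deriv: "((\<lambda>s. u x s) has_vector_derivative dt S u x s) (at s within {0..S})"
    if "x \<in> {a..b}" "s \<in> {0..S}" for x s
    using C1 that by (simp add: C1_time_def dt_def vector_derivative_works)
  have "((\<lambda>s. integral (cbox a b) (\<lambda>x. u x s * cis (- (wn l * (x - a))))) has_vector_derivative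
      integral (cbox a b) (\<lambda>x. dt S u x t * cis (- (wn l * (x - a))))) (at t within {0..S})"
  proof (rule leibniz_rule_vector_derivative[OF _ _ cont t])
    fix s x assume "s \<in> {0..S}" "x \<in> cbox a b"
    then show "((\<lambda>s. u x s * cis (- (wn l * (x - a)))) has_vector_derivative
        dt S u x s * cis (- (wn l * (x - a)))) (at s within {0..S})"
      by (intro has_vector_derivative_mult_left deriv) auto
  next
    fix s assume "s \<in> {0..S}"
    then show "(\<lambda>x. u x s * cis (- (wn l * (x - a)))) integrable_on cbox a b"
      using fc_integrable[OF continuous_on_section[OF u]] by simp
  qed simp
  then have der: "((\<lambda>s. integral {a..b} (\<lambda>x. u x s * cis (- (wn l * (x - a)))) / of_real (b - a)) has_vector_derivative
      integral {a..b} (\<lambda>x. dt S u x t * cis (- (wn l * (x - a)))) / of_real (b - a)) (at t within {0..S})"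
    by (intro has_vector_derivative_divide) simp
  show ?thesis
    unfolding fc_integral[OF continuous_on_section[OF dcont t]]
    by (rule has_vector_derivative_transform[OF t fc_integral[OF continuous_on_section[OF u]] der])
qed

text \<open>Two integrations by parts; each of the two periodic boundary conditions cancels one
  boundary term.\<close>

lemma fc_second_derivative:
  assumes u: "C1_space a b S u" "C1_space a b S (dx a b u)" and t: "t \<in> {0..S}"
    and bc: "u a t = u b t" "dx a b u a t = dx a b u b t"
  shows "fc (\<lambda>x. dx a b (dx a b u) x t) l = - of_real ((wn l)\<^sup>2) * fc (\<lambda>x. u x t) l"
proof -
  have parts: "fc (\<lambda>x. dx a b v x t) l = \<i> * of_real (wn l) * fc (\<lambda>x. v x t) l"
    if v: "C1_space a b S v" "v a t = v b t" for v
  proof -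
    have "((\<lambda>x. v x t) has_vector_derivative dx a b v x t) (at x within {a..b})" if "x \<in> {a..b}" for x
      using v(1) that t by (simp add: C1_space_def dx_def vector_derivative_works)
    moreover have "continuous_on {a..b} (\<lambda>x. dx a b v x t)"
      using v(1) t by (intro continuous_on_section) (auto simp: C1_space_def)
    ultimately show ?thesis
      using fc_vector_derivative[of "\<lambda>x. v x t" "\<lambda>x. dx a b v x t" l] v(2) by simp
  qed
  have "fc (\<lambda>x. dx a b (dx a b u) x t) l
      = (\<i> * \<i>) * (of_real (wn l) * of_real (wn l)) * fc (\<lambda>x. u x t) l"
    unfolding parts[OF u(2) bc(2)] parts[OF u(1) bc(1)] by (simp only: mult_ac)
  then show ?thesis by (simp add: power2_eq_square)
qed

text \<open>The essential supremum controls almost every time. For a finite set of modes the norm is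
  continuous in time, so the bound extends to all times, in particular to \<open>t = 0\<close>. The
  general \<open>N\<close> accommodates the sum of two norms in hypothesis (A).\<close>

lemma Hbound_of_Linf_time_norm:
  assumes S: "0 < S" and C: "0 \<le> C"
    and u: "cont_rect S u"
    and le: "Linf_time_norm S N u \<le> ennreal C" and N: "\<And>v. Hper_norm a b k v \<le> N v"
    and t: "t \<in> {0..S}"
  shows "Hbound k C (fc (\<lambda>x. u x t))"
  unfolding Hbound_def
proof (intro allI impI)
  fix F :: "int set" assume F: "finite F"
  have "AE t in lebesgue_on {0..S}. N (\<lambda>x. u x t) \<le> Linf_time_norm S N u"
    unfolding Linf_time_norm_def by (rule esssup_AE)
  then have "AE t in lebesgue_on {0..S}. L2_set (\<lambda>l. weight l ^ k * cmod (fc (\<lambda>x. u x t) l)) F \<le> C"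
  proof eventually_elim
    case (elim t)
    then have "Hper_norm a b k (\<lambda>x. u x t) \<le> ennreal C"
      using N[of "\<lambda>x. u x t"] le by (meson order_trans)
    then show ?case using HboundD[OF Hbound_fc_of_Hper_norm[OF _ C] F] by blast
  qed
  moreover have "continuous_on {0..S} (\<lambda>t. L2_set (\<lambda>l. weight l ^ k * cmod (fc (\<lambda>x. u x t) l)) F)"
    unfolding L2_set_def by (intro continuous_intros continuous_on_fc_param u)
  ultimately show "L2_set (\<lambda>l. weight l ^ k * cmod (fc (\<lambda>x. u x t) l)) F \<le> C"
    using continuous_ae_le_imp_le[OF S _ _ t] by blast
qed

end

section \<open>Duhamel formula for the scheme\<close>

context
  fixes \<tau> :: real
  assumes \<tau>: "0 < \<tau>"
begin

text \<open>The mean of the phase \<open>cis (k * (p + \<tau> - s))\<close> over a step;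
  \<open>sigma_p\<close> and \<open>sigma_m\<close> are its values at the two roots.\<close>

definition phase_mean :: "real \<Rightarrow> complex" where
  "phase_mean k = cis (k * \<tau> / 2) * of_real (sinc (k * \<tau> / 2))"

text \<open>The first moment of the same phase. The value at \<open>k = 0\<close> is needed for
  \<open>bm 0 = 0\<close> and is the origin of the separate formula for mode 0 in the
  scheme.\<close>

definition phase_moment :: "real \<Rightarrow> complex" where
  "phase_moment k = (if k = 0 then of_real (\<tau>\<^sup>2 / 2) else \<i> * of_real \<tau> * (1 - phase_mean k) / of_real k)"

lemma cis_double_minus_1: "cis (2 * x) - 1 = 2 * \<i> * cis x * of_real (sin x)"
  by (simp add: complex_eq_iff cos_double_sin sin_double power2_eq_square)

lemma phase_mean_eq: "k \<noteq> 0 \<Longrightarrow> of_real \<tau> * phase_mean k = \<i> / of_real k * (1 - cis (k * \<tau>))"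
proof -
  assume k: "k \<noteq> 0"
  have "of_real \<tau> * phase_mean k = 2 * cis (k * \<tau> / 2) * of_real (sin (k * \<tau> / 2)) / of_real k"
    using k \<tau> by (simp add: phase_mean_def)
  also have "\<dots> = - \<i> * (2 * \<i> * cis (k * \<tau> / 2) * of_real (sin (k * \<tau> / 2))) / of_real k"
  proof -
    have "\<i> * (2 * \<i> * c * d) = (\<i> * \<i>) * (2 * c * d)" for c d :: complex
      by (simp only: mult_ac)
    then show ?thesis by (simp only: mult_minus_left i_squared) simp
  qed
  also have "2 * \<i> * cis (k * \<tau> / 2) * of_real (sin (k * \<tau> / 2)) = cis (k * \<tau>) - 1"
    using cis_double_minus_1[of "k * \<tau> / 2"] by simp
  finally show ?thesis by (simp add: algebra_simps diff_divide_distrib)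
qed

text \<open>Conjugation amounts to moving the observation time back by one step; in this way the
  starred coefficients come from the same integrals.\<close>

lemma cnj_phase_mean: "cnj (phase_mean k) = cis (- (k * \<tau>)) * phase_mean k"
proof -
  have "cis (- (k * \<tau> / 2)) = cis (- (k * \<tau>)) * cis (k * \<tau> / 2)"
    unfolding cis_mult by (rule arg_cong[of _ _ cis]) simp
  then show ?thesis by (simp add: phase_mean_def cis_cnj)
qed

lemma cis_shift_deriv:
  "((\<lambda>s. cis (k * (p + \<tau> - s))) has_vector_derivative - \<i> * of_real k * cis (k * (p + \<tau> - s))) (at s within A)"
  using has_vector_derivative_cis_affine[of "- k" "p + \<tau>" s A] by (simp add: algebra_simps)

lemma has_integral_phase:
  "((\<lambda>s. cis (k * (p + \<tau> - s))) has_integral of_real \<tau> * phase_mean k) {p..p + \<tau>}"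
proof (cases "k = 0")
  case True
  then show ?thesis
    using has_integral_const_real[of "1::complex" p "p + \<tau>"] \<tau> by (simp add: phase_mean_def scaleR_conv_of_real)
next
  case False
  let ?H = "\<lambda>s. \<i> / of_real k * cis (k * (p + \<tau> - s))"
  have "(?H has_vector_derivative cis (k * (p + \<tau> - s))) (at s within {p..p + \<tau>})" for s
  proof -
    have "(?H has_vector_derivative \<i> / of_real k * (- \<i> * of_real k * cis (k * (p + \<tau> - s)))) (at s within {p..p + \<tau>})"
      by (intro has_vector_derivative_mult_right cis_shift_deriv)
    then show ?thesis using False by simp
  qed
  then have "((\<lambda>s. cis (k * (p + \<tau> - s))) has_integral ?H (p + \<tau>) - ?H p) {p..p + \<tau>}"
    using \<tau> by (intro fundamental_theorem_of_calculus) auto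
  then show ?thesis by (simp add: phase_mean_eq[OF False] right_diff_distrib)
qed

lemma has_integral_phase_moment:
  "((\<lambda>s. of_real (s - p) * cis (k * (p + \<tau> - s))) has_integral phase_moment k) {p..p + \<tau>}"
proof (cases "k = 0")
  case True
  have "((\<lambda>s. of_real ((s - p)\<^sup>2 / 2)) has_vector_derivative (of_real (s - p) :: complex)) (at s within {p..p + \<tau>})" for s
    by (rule has_vector_derivative_of_real) (auto intro!: derivative_eq_intros simp: has_real_derivative_iff_has_vector_derivative[symmetric])
  then have "((\<lambda>s. of_real (s - p)) has_integral (of_real ((p + \<tau> - p)\<^sup>2 / 2) - of_real ((p - p)\<^sup>2 / 2) :: complex)) {p..p + \<tau>}"
    using \<tau> by (intro fundamental_theorem_of_calculus) auto
  with True show ?thesis by (simp add: phase_moment_def)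
next
  case False
  let ?H = "\<lambda>s. of_real (s - p) * (\<i> / of_real k * cis (k * (p + \<tau> - s))) + 1 / of_real (k\<^sup>2) * cis (k * (p + \<tau> - s))"
  have "(?H has_vector_derivative of_real (s - p) * cis (k * (p + \<tau> - s))) (at s within {p..p + \<tau>})" for s
  proof -
    have "(?H has_vector_derivative
        (of_real (s - p) * (\<i> / of_real k * (- \<i> * of_real k * cis (k * (p + \<tau> - s))))
          + 1 * (\<i> / of_real k * cis (k * (p + \<tau> - s))))
        + 1 / of_real (k\<^sup>2) * (- \<i> * of_real k * cis (k * (p + \<tau> - s)))) (at s within {p..p + \<tau>})"
      by (intro has_vector_derivative_add has_vector_derivative_mult has_vector_derivative_mult_right cis_shift_deriv
            has_vector_derivative_of_real_shift)
    then show ?thesis using False by (simp add: power2_eq_square)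
  qed
  then have "((\<lambda>s. of_real (s - p) * cis (k * (p + \<tau> - s))) has_integral ?H (p + \<tau>) - ?H p) {p..p + \<tau>}"
    using \<tau> by (intro fundamental_theorem_of_calculus) auto
  moreover have "?H (p + \<tau>) - ?H p = phase_moment k"
  proof -
    have "phase_moment k = \<i> * of_real \<tau> / of_real k - \<i> / of_real k * (of_real \<tau> * phase_mean k)"
      using False by (simp add: phase_moment_def right_diff_distrib diff_divide_distrib)
    also have "\<dots> = \<i> * of_real \<tau> / of_real k + 1 / of_real (k\<^sup>2) * (1 - cis (k * \<tau>))"
      unfolding phase_mean_eq[OF False] by (simp add: power2_eq_square mult.assoc[symmetric])
    finally show ?thesis by (simp add: right_diff_distrib)
  qed
  ultimately show ?thesis by simp
qed

end

context nlsw_modes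
begin

text \<open>No order between \<open>t\<close> and the step is imposed: the two-step recursion also
  evaluates the response of step \<open>k\<close> at \<open>real k * \<tau>\<close>, the start of
  that step, and the starred coefficients stand for this value.\<close>

definition impulse :: "int \<Rightarrow> real \<Rightarrow> nat \<Rightarrow> real \<Rightarrow> complex \<Rightarrow> complex \<Rightarrow> complex" where
  "impulse l \<tau> k t A B =
     integral {real k * \<tau>..real (Suc k) * \<tau>} (\<lambda>s. kern l (t - s) * (A + of_real (s - real k * \<tau>) * B))"

text \<open>\<open>coeff_d\<close> and \<open>- coeff_c\<close> are the sum and the product of the
  multipliers \<open>cis (bp l * \<tau>)\<close> and \<open>cis (bm l * \<tau>)\<close>, so each
  multiplier is a root of \<open>z\<^sup>2 = coeff_d * z + coeff_c\<close>.\<close>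

lemma cis_recursion:
  assumes "\<beta> = bp l \<or> \<beta> = bm l"
  shows "cis (\<beta> * (r + \<tau>)) = coeff_d a b \<alpha> \<tau> l * cis (\<beta> * r) + coeff_c \<alpha> \<tau> l * cis (\<beta> * (r - \<tau>))"
proof -
  define x where "x = \<tau> / (2 * \<alpha>)"
  define y where "y = \<tau> * bd l / 2"
  have c: "coeff_c \<alpha> \<tau> l = - cis (2 * x)" by (simp add: coeff_c_def x_def)
  have d: "coeff_d a b \<alpha> \<tau> l = cis (x + y) + cis (x - y)"
    by (simp add: coeff_d_def complex_eq_iff cos_add cos_diff sin_add sin_diff flip: x_def y_def)
  have "\<beta> * \<tau> = x + y \<or> \<beta> * \<tau> = x - y"
    using assms bp_bm_half[where l = l and r = \<tau>] by (auto simp: x_def y_def)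
  then obtain z where z: "\<beta> * \<tau> = x + z" "coeff_d a b \<alpha> \<tau> l = cis (x + z) + cis (x - z)"
    using d by (metis add.commute diff_minus_eq_add minus_diff_eq uminus_add_conv_diff)
  have "coeff_d a b \<alpha> \<tau> l * cis (\<beta> * r) + coeff_c \<alpha> \<tau> l * cis (\<beta> * (r - \<tau>))
      = cis (\<beta> * r + (x + z)) + cis (\<beta> * r + (x - z)) - cis (2 * x + (\<beta> * r - (x + z)))"
    unfolding c z(2) right_diff_distrib z(1) by (simp add: distrib_right cis_mult add.commute)
  also have "2 * x + (\<beta> * r - (x + z)) = \<beta> * r + (x - z)" by simp
  finally show ?thesis by (simp add: distrib_left z(1))
qed

lemma kern_recursion:
  "kern l (r + \<tau>) = coeff_d a b \<alpha> \<tau> l * kern l r + coeff_c \<alpha> \<tau> l * kern l (r - \<tau>)"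
  unfolding kern_def cis_recursion[OF disjI1[OF refl]] cis_recursion[OF disjI2[OF refl]]
  using bd_pos[of l] by (simp add: field_simps)

lemma resp_recursion:
  "resp l (r + \<tau>) = coeff_d a b \<alpha> \<tau> l * resp l r + coeff_c \<alpha> \<tau> l * resp l (r - \<tau>)"
  unfolding resp_def cis_recursion[OF disjI1[OF refl]] cis_recursion[OF disjI2[OF refl]]
  using bd_pos[of l] by (simp add: field_simps)

lemma continuous_on_impulse: "continuous_on S (\<lambda>s. kern l (t - s) * (A + of_real (s - p) * B))"
  by (intro continuous_intros continuous_on_kern)

lemma impulse_recursion:
  "impulse l \<tau> k (t + \<tau>) A B = coeff_d a b \<alpha> \<tau> l * impulse l \<tau> k t A B + coeff_c \<alpha> \<tau> l * impulse l \<tau> k (t - \<tau>) A B"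
proof -
  let ?I = "{real k * \<tau>..real (Suc k) * \<tau>}" and ?P = "\<lambda>s. A + of_real (s - real k * \<tau>) * B"
  have "impulse l \<tau> k (t + \<tau>) A B = integral ?I (\<lambda>s. coeff_d a b \<alpha> \<tau> l * (kern l (t - s) * ?P s)
      + coeff_c \<alpha> \<tau> l * (kern l (t - \<tau> - s) * ?P s))"
    unfolding impulse_def
  proof (rule integral_cong)
    fix s
    have "t + \<tau> - s = (t - s) + \<tau>" "t - \<tau> - s = (t - s) - \<tau>" by simp_all
    then show "kern l (t + \<tau> - s) * ?P s = coeff_d a b \<alpha> \<tau> l * (kern l (t - s) * ?P s)
      + coeff_c \<alpha> \<tau> l * (kern l (t - \<tau> - s) * ?P s)"
      by (simp only: kern_recursion) (simp add: algebra_simps)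
  qed
  also have "\<dots> = coeff_d a b \<alpha> \<tau> l * impulse l \<tau> k t A B + coeff_c \<alpha> \<tau> l * impulse l \<tau> k (t - \<tau>) A B"
  proof -
    have "(\<lambda>s. c * (kern l (t' - s) * ?P s)) integrable_on ?I" for c t'
      by (intro integrable_continuous_interval continuous_on_mult_left continuous_on_impulse)
    then show ?thesis unfolding impulse_def by (subst integral_add) simp_all
  qed
  finally show ?thesis .
qed

lemma sigma_eq: "0 < \<tau> \<Longrightarrow> sigma_p a b \<alpha> \<tau> l = phase_mean \<tau> (bp l)" "0 < \<tau> \<Longrightarrow> sigma_m a b \<alpha> \<tau> l = phase_mean \<tau> (bm l)"
  by (simp_all add: sigma_p_def sigma_m_def phase_mean_def)

lemma bm_eq_0_iff: "bm l = 0 \<longleftrightarrow> l = 0"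
  using \<alpha>_pos a_less_b by (simp add: beta_m_def wavenum_def)

text \<open>The offset \<open>r\<close> is 0 for the coefficients \<open>p\<close> and
  \<open>q\<close> and \<tau> for their starred versions. Splitting the kernel into its two phases
  reduces both cases to the mean and the moment of a phase.\<close>

lemma impulse_eq:
  assumes \<tau>: "0 < \<tau>"
  shows "impulse l \<tau> k (real (Suc k) * \<tau> - r) A B =
    (cis (- (bp l * r)) * (of_real \<tau> * phase_mean \<tau> (bp l) * A + phase_moment \<tau> (bp l) * B)
     - cis (- (bm l * r)) * (of_real \<tau> * phase_mean \<tau> (bm l) * A + phase_moment \<tau> (bm l) * B))
    / (\<i> * of_real (bd l))"
proof -
  define p where "p = real k * \<tau>"
  have p: "real (Suc k) * \<tau> = p + \<tau>" by (simp add: p_def distrib_right)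
  have one: "((\<lambda>s. cis (\<beta> * (p + \<tau> - r - s)) * (A + of_real (s - p) * B)) has_integral
      cis (- (\<beta> * r)) * (of_real \<tau> * phase_mean \<tau> \<beta> * A + phase_moment \<tau> \<beta> * B)) {p..p + \<tau>}" for \<beta>
  proof -
    have "((\<lambda>s. cis (- (\<beta> * r)) * (cis (\<beta> * (p + \<tau> - s)) * A + of_real (s - p) * cis (\<beta> * (p + \<tau> - s)) * B)) has_integral
      cis (- (\<beta> * r)) * (of_real \<tau> * phase_mean \<tau> \<beta> * A + phase_moment \<tau> \<beta> * B)) {p..p + \<tau>}"
      by (intro has_integral_mult_right has_integral_add has_integral_mult_left
            has_integral_phase[OF \<tau>] has_integral_phase_moment[OF \<tau>])
    moreover have "cis (- (\<beta> * r)) * (cis (\<beta> * (p + \<tau> - s)) * A + of_real (s - p) * cis (\<beta> * (p + \<tau> - s)) * B)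
        = cis (\<beta> * (p + \<tau> - r - s)) * (A + of_real (s - p) * B)" for s
    proof -
      have "cis (\<beta> * (p + \<tau> - r - s)) = cis (- (\<beta> * r)) * cis (\<beta> * (p + \<tau> - s))"
        by (simp add: cis_mult algebra_simps)
      then show ?thesis by (simp add: algebra_simps)
    qed
    ultimately show ?thesis by simp
  qed
  have "((\<lambda>s. (cis (bp l * (p + \<tau> - r - s)) * (A + of_real (s - p) * B) - cis (bm l * (p + \<tau> - r - s)) * (A + of_real (s - p) * B))
      / (\<i> * of_real (bd l))) has_integral
    (cis (- (bp l * r)) * (of_real \<tau> * phase_mean \<tau> (bp l) * A + phase_moment \<tau> (bp l) * B)
     - cis (- (bm l * r)) * (of_real \<tau> * phase_mean \<tau> (bm l) * A + phase_moment \<tau> (bm l) * B))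
    / (\<i> * of_real (bd l))) {p..p + \<tau>}"
    by (intro has_integral_divide has_integral_diff one)
  moreover have "(\<lambda>s. (cis (bp l * (p + \<tau> - r - s)) * (A + of_real (s - p) * B) - cis (bm l * (p + \<tau> - r - s)) * (A + of_real (s - p) * B))
      / (\<i> * of_real (bd l))) = (\<lambda>s. kern l (p + \<tau> - r - s) * (A + of_real (s - p) * B))"
    by (simp add: kern_def left_diff_distrib)
  ultimately show ?thesis
    unfolding impulse_def p by (simp add: integral_unique p_def)
qed

lemma impulse_new:
  assumes "0 < \<tau>"
  shows "- of_real (\<epsilon>\<^sup>2 / \<alpha>) * impulse l \<tau> k (real (Suc k) * \<tau>) A B
      = coeff_p a b \<alpha> \<epsilon> \<tau> l * A + coeff_q a b \<alpha> \<epsilon> \<tau> l * B"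
proof -
  define K where "K = \<i> * of_real (\<epsilon>\<^sup>2 / (\<alpha> * bd l))"
  have K: "- of_real (\<epsilon>\<^sup>2 / \<alpha>) * (x / (\<i> * of_real (bd l))) = K * x" for x
    using bd_pos[of l] \<alpha>_pos by (simp add: K_def field_simps)
  have p: "coeff_p a b \<alpha> \<epsilon> \<tau> l = K * (of_real \<tau> * phase_mean \<tau> (bp l) - of_real \<tau> * phase_mean \<tau> (bm l))"
    by (simp add: coeff_p_def K_def sigma_eq[OF assms] right_diff_distrib diff_divide_distrib mult_ac)
  have q: "coeff_q a b \<alpha> \<epsilon> \<tau> l = K * (phase_moment \<tau> (bp l) - phase_moment \<tau> (bm l))"
  proof (cases "l = 0")
    \<comment> \<open>For mode 0 the root \<open>bm 0\<close> vanishes, so the moment takes its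
      separate value and matches the explicit branch of \<open>coeff_q\<close>.\<close>
    case True
    then have "bm l = 0" by (simp add: bm_eq_0_iff)
    with True show ?thesis
      using bp_pos[of 0] \<alpha>_pos bd_pos[of 0] assms
      by (simp add: coeff_q_def K_def sigma_eq[OF assms] phase_moment_def[OF assms]) (simp add: field_simps power2_eq_square)
  next
    case False
    then have "bm l \<noteq> 0" by (simp add: bm_eq_0_iff)
    with False show ?thesis
      using bp_pos[of l] \<alpha>_pos bd_pos[of l]
      by (simp add: coeff_q_def K_def sigma_eq[OF assms] phase_moment_def[OF assms]) (simp add: field_simps power2_eq_square)
  qed
  show ?thesis
    using impulse_eq[OF assms, of l k 0 A B] unfolding p q
    by (simp only: diff_0_right K mult_zero_right minus_zero cis_zero mult_1) (simp add: algebra_simps)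
qed

lemma impulse_old:
  assumes "0 < \<tau>"
  shows "- of_real (\<epsilon>\<^sup>2 / \<alpha>) * (coeff_c \<alpha> \<tau> l * impulse l \<tau> k (real k * \<tau>) A B)
      = - (coeff_p_star a b \<alpha> \<epsilon> \<tau> l * A) - coeff_q_star a b \<alpha> \<epsilon> \<tau> l * B"
proof -
  define K where "K = \<i> * of_real (\<epsilon>\<^sup>2 / (\<alpha> * bd l)) * cis (\<tau> / \<alpha>)"
  have K: "- of_real (\<epsilon>\<^sup>2 / \<alpha>) * (coeff_c \<alpha> \<tau> l * (x / (\<i> * of_real (bd l)))) = - (K * x)" for x
    using bd_pos[of l] \<alpha>_pos by (simp add: K_def coeff_c_def field_simps)
  \<comment> \<open>These phases shift back by one step; in \<open>coeff_q_star\<close> they appear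
    as divisions by \<open>cis (bp l * \<tau>)\<close> and
    \<open>cis (bm l * \<tau>)\<close>.\<close>
  define ep where "ep = cis (- (bp l * \<tau>))"
  define em' where "em' = cis (- (bm l * \<tau>))"
  have ep: "1 / cis (bp l * \<tau>) = ep" "1 / cis (bm l * \<tau>) = em'"
    by (simp_all add: ep_def em'_def cis_inverse divide_inverse)
  have p: "coeff_p_star a b \<alpha> \<epsilon> \<tau> l = K * (ep * (of_real \<tau> * phase_mean \<tau> (bp l)) - em' * (of_real \<tau> * phase_mean \<tau> (bm l)))"
    by (simp add: coeff_p_star_def K_def sigma_eq[OF assms] cnj_phase_mean[OF assms] ep_def em'_def right_diff_distrib diff_divide_distrib mult_ac)
  have q: "coeff_q_star a b \<alpha> \<epsilon> \<tau> l = K * (ep * phase_moment \<tau> (bp l) - em' * phase_moment \<tau> (bm l))"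
  proof (cases "l = 0")
    case True
    then have "bm l = 0" by (simp add: bm_eq_0_iff)
    with True show ?thesis
      using bp_pos[of 0] \<alpha>_pos bd_pos[of 0] assms
      by (simp add: coeff_q_star_def K_def sigma_eq[OF assms] phase_moment_def[OF assms] ep[symmetric])
        (simp add: field_simps power2_eq_square)
  next
    case False
    then have "bm l \<noteq> 0" by (simp add: bm_eq_0_iff)
    with False show ?thesis
      using bp_pos[of l] \<alpha>_pos bd_pos[of l]
      by (simp add: coeff_q_star_def K_def sigma_eq[OF assms] phase_moment_def[OF assms] ep[symmetric])
        (simp add: field_simps power2_eq_square)
  qed
  have "real (Suc k) * \<tau> - \<tau> = real k * \<tau>" by (simp add: distrib_right)
  then show ?thesis
    using impulse_eq[OF assms, of l k \<tau> A B] unfolding p q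
    by (simp only: K ep_def[symmetric] em'_def[symmetric]) (simp add: algebra_simps)
qed

definition scheme_g :: "real \<Rightarrow> real \<Rightarrow> nat \<Rightarrow> (real \<Rightarrow> complex) \<Rightarrow> (real \<Rightarrow> complex) \<Rightarrow> nat \<Rightarrow> nat \<Rightarrow> complex" where
  "scheme_g \<epsilon> \<tau> M \<psi>0 \<psi>1 n j =
     (if n = 0 then 2 * of_real ((cmod (\<psi>0 (gridpt a b M j)))\<^sup>2) * \<psi>1 (gridpt a b M j)
                  + (\<psi>0 (gridpt a b M j))\<^sup>2 * cnj (\<psi>1 (gridpt a b M j))
      else (cubic (ewi_fp a b \<alpha> \<epsilon> \<tau> M \<psi>0 \<psi>1 n j) - cubic (ewi_fp a b \<alpha> \<epsilon> \<tau> M \<psi>0 \<psi>1 (n - 1) j)) / of_real \<tau>)"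

text \<open>
  The two-step scheme is a discrete Duhamel formula with a piecewise linear nonlinearity. In this form
  the frequencies where \<open>sin (\<tau> * bd l / 2)\<close> vanishes, at which the two-step recursion has a double
  root, do no harm, so that no relation between \<open>\<tau>\<close> and \<open>M\<close> is needed.
\<close>

lemma dft_ewi_fp:
  fixes \<epsilon> \<tau> :: real and \<psi>0 \<psi>1 :: "real \<Rightarrow> complex"
  assumes \<tau>: "0 < \<tau>" and M: "0 < M" and l: "l \<in> modes M"
  defines "U \<equiv> ewi_fp a b \<alpha> \<epsilon> \<tau> M \<psi>0 \<psi>1"
  shows "dft a b M (U n) l =
      resp l (real n * \<tau>) * dft a b M (\<lambda>j. \<psi>0 (gridpt a b M j)) l
    + kern l (real n * \<tau>) * dft a b M (\<lambda>j. \<psi>1 (gridpt a b M j)) l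
    - of_real (\<epsilon>\<^sup>2 / \<alpha>) * (\<Sum>k<n. impulse l \<tau> k (real n * \<tau>)
        (dft a b M (\<lambda>j. cubic (U k j)) l) (dft a b M (scheme_g \<epsilon> \<tau> M \<psi>0 \<psi>1 k) l))"
proof -
  define A where "A k = dft a b M (\<lambda>j. cubic (U k j)) l" for k
  define B where "B k = dft a b M (scheme_g \<epsilon> \<tau> M \<psi>0 \<psi>1 k) l" for k
  define x0 where "x0 = dft a b M (\<lambda>j. \<psi>0 (gridpt a b M j)) l"
  define x1 where "x1 = dft a b M (\<lambda>j. \<psi>1 (gridpt a b M j)) l"
  define D where "D n = resp l (real n * \<tau>) * x0 + kern l (real n * \<tau>) * x1
    - of_real (\<epsilon>\<^sup>2 / \<alpha>) * (\<Sum>k<n. impulse l \<tau> k (real n * \<tau>) (A k) (B k))" for n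
  have g: "scheme_g \<epsilon> \<tau> M \<psi>0 \<psi>1 0 = (\<lambda>j. 2 * of_real ((cmod (\<psi>0 (gridpt a b M j)))\<^sup>2) * \<psi>1 (gridpt a b M j)
                  + (\<psi>0 (gridpt a b M j))\<^sup>2 * cnj (\<psi>1 (gridpt a b M j)))"
    "scheme_g \<epsilon> \<tau> M \<psi>0 \<psi>1 (Suc n) = (\<lambda>j. (cubic (U (Suc n) j) - cubic (U n j)) / of_real \<tau>)"
    "scheme_g \<epsilon> \<tau> M \<psi>0 \<psi>1 n = (if n = 0
                then (\<lambda>j. 2 * of_real ((cmod (\<psi>0 (gridpt a b M j)))\<^sup>2) * \<psi>1 (gridpt a b M j)
                        + (\<psi>0 (gridpt a b M j))\<^sup>2 * cnj (\<psi>1 (gridpt a b M j)))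
                else (\<lambda>j. (cubic (U n j) - cubic (U (n - 1) j)) / of_real \<tau>))" for n
    by (auto simp: scheme_g_def U_def fun_eq_iff)
  have U0: "dft a b M (U 0) l = x0" by (simp add: U_def x0_def)
  have U1: "dft a b M (U (Suc 0)) l = coeff_c0 a b \<alpha> \<tau> l * x0 + coeff_d0 a b \<alpha> \<tau> l * x1
      + coeff_p a b \<alpha> \<epsilon> \<tau> l * A 0 + coeff_q a b \<alpha> \<epsilon> \<tau> l * B 0"
    unfolding U_def ewi_fp.simps Let_def dft_trig_sum[OF M l]
    by (simp add: x0_def x1_def A_def B_def g(1) U_def)
  have U2: "dft a b M (U (Suc (Suc n))) l = coeff_c \<alpha> \<tau> l * dft a b M (U n) l + coeff_d a b \<alpha> \<tau> l * dft a b M (U (Suc n)) l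
      + coeff_p a b \<alpha> \<epsilon> \<tau> l * A (Suc n) + coeff_q a b \<alpha> \<epsilon> \<tau> l * B (Suc n)
      - coeff_p_star a b \<alpha> \<epsilon> \<tau> l * A n - coeff_q_star a b \<alpha> \<epsilon> \<tau> l * B n" for n
    unfolding A_def B_def g(2) g(3)[of n]
    unfolding U_def ewi_fp.simps Let_def dft_trig_sum[OF M l] by (rule refl)
  have D0: "D 0 = x0" by (simp add: D_def)
  have D1: "D (Suc 0) = coeff_c0 a b \<alpha> \<tau> l * x0 + coeff_d0 a b \<alpha> \<tau> l * x1
      + coeff_p a b \<alpha> \<epsilon> \<tau> l * A 0 + coeff_q a b \<alpha> \<epsilon> \<tau> l * B 0"
    using impulse_new[OF \<tau>, of \<epsilon> l 0 "A 0" "B 0"] by (simp add: D_def coeff_c0_eq coeff_d0_eq)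
  have D2: "D (Suc (Suc n)) = coeff_c \<alpha> \<tau> l * D n + coeff_d a b \<alpha> \<tau> l * D (Suc n)
      + coeff_p a b \<alpha> \<epsilon> \<tau> l * A (Suc n) + coeff_q a b \<alpha> \<epsilon> \<tau> l * B (Suc n)
      - coeff_p_star a b \<alpha> \<epsilon> \<tau> l * A n - coeff_q_star a b \<alpha> \<epsilon> \<tau> l * B n" for n
  proof -
    let ?t = "\<lambda>n. real n * \<tau>"
    let ?c = "coeff_c \<alpha> \<tau> l" and ?d = "coeff_d a b \<alpha> \<tau> l" and ?e = "complex_of_real (\<epsilon>\<^sup>2 / \<alpha>)"
    have t: "?t (Suc (Suc n)) = ?t (Suc n) + \<tau>" "?t n = ?t (Suc n) - \<tau>"
      by (simp_all add: distrib_right)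
    \<comment> \<open>Applying the recursion in \<open>t\<close> to the responses of steps 0 to
      \<open>n\<close> leaves one extra term at time \<open>real n * \<tau>\<close>, that of step
      \<open>n\<close> itself. It yields the starred coefficients, and the response of the new step
      \<open>Suc n\<close> yields \<open>p\<close> and \<open>q\<close>.\<close>
    have sum: "(\<Sum>k<Suc (Suc n). impulse l \<tau> k (?t (Suc (Suc n))) (A k) (B k))
        = ?d * (\<Sum>k<Suc n. impulse l \<tau> k (?t (Suc n)) (A k) (B k))
          + ?c * (\<Sum>k<n. impulse l \<tau> k (?t n) (A k) (B k))
          + ?c * impulse l \<tau> n (?t n) (A n) (B n)
          + impulse l \<tau> (Suc n) (?t (Suc (Suc n))) (A (Suc n)) (B (Suc n))"
    proof -
      have "(\<Sum>k<Suc n. impulse l \<tau> k (?t (Suc (Suc n))) (A k) (B k))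
          = ?d * (\<Sum>k<Suc n. impulse l \<tau> k (?t (Suc n)) (A k) (B k))
            + ?c * (\<Sum>k<Suc n. impulse l \<tau> k (?t n) (A k) (B k))"
        unfolding t impulse_recursion by (simp only: sum.distrib sum_distrib_left)
      then show ?thesis by (simp add: distrib_left)
    qed
    have "D (Suc (Suc n)) = (?d * resp l (?t (Suc n)) + ?c * resp l (?t n)) * x0
        + (?d * kern l (?t (Suc n)) + ?c * kern l (?t n)) * x1
        - ?e * (\<Sum>k<Suc (Suc n). impulse l \<tau> k (?t (Suc (Suc n))) (A k) (B k))"
      unfolding D_def t(2) by (simp only: t(1) resp_recursion kern_recursion)
    also have "\<dots> = ?c * D n + ?d * D (Suc n)
        + - ?e * (?c * impulse l \<tau> n (?t n) (A n) (B n))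
        + - ?e * impulse l \<tau> (Suc n) (?t (Suc (Suc n))) (A (Suc n)) (B (Suc n))"
      unfolding sum D_def by (simp add: algebra_simps del: sum.lessThan_Suc of_nat_Suc of_real_divide)
    finally show ?thesis
      unfolding impulse_new[OF \<tau>] impulse_old[OF \<tau>] by (simp add: algebra_simps)
  qed
  have "dft a b M (U n) l = D n \<and> dft a b M (U (Suc n)) l = D (Suc n)" for n
    by (induction n) (simp_all add: U0 D0 U1 D1 U2 D2 del: of_nat_Suc)
  then show ?thesis by (simp add: D_def A_def B_def x0_def x1_def)
qed

end

section \<open>Bounds for the exact solution\<close>

lemma continuous_on_cubic [continuous_intros]:
  "continuous_on A f \<Longrightarrow> continuous_on A (\<lambda>x. cubic (f x))"
  unfolding cubic_def by (intro continuous_intros)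

text \<open>The three factors are exchanged one at a time, each at the cost of
  \<open>R\<^sup>2\<close>.\<close>

lemma cubic_lipschitz:
  assumes "cmod z \<le> R" "cmod w \<le> R"
  shows "cmod (cubic z - cubic w) \<le> 3 * R\<^sup>2 * cmod (z - w)"
proof -
  have R: "0 \<le> R" using assms(1) norm_ge_zero order_trans by blast
  have "cubic z - cubic w = (z - w) * (z * cnj z) + w * ((z - w) * cnj z) + w * (w * cnj (z - w))"
    by (simp add: cubic_def complex_norm_square[symmetric] algebra_simps)
  also have "cmod \<dots> \<le> cmod ((z - w) * (z * cnj z)) + cmod (w * ((z - w) * cnj z)) + cmod (w * (w * cnj (z - w)))"
    by (intro order_trans[OF norm_triangle_ineq] add_mono order_refl)
  also have "\<dots> = cmod (z - w) * (cmod z * cmod z) + cmod (z - w) * (cmod w * cmod z) + cmod (z - w) * (cmod w * cmod w)"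
    by (simp add: norm_mult mult_ac flip: complex_cnj_diff)
  also have "\<dots> \<le> cmod (z - w) * (R * R) + cmod (z - w) * (R * R) + cmod (z - w) * (R * R)"
    using assms R by (intro add_mono mult_left_mono mult_mono) auto
  finally show ?thesis by (simp add: power2_eq_square algebra_simps)
qed

definition cubic_deriv :: "complex \<Rightarrow> complex \<Rightarrow> complex" where
  "cubic_deriv z z' = 2 * of_real ((cmod z)\<^sup>2) * z' + z\<^sup>2 * cnj z'"

lemma cubic_deriv_eq: "cubic_deriv z z' = 2 * (z * cnj z * z') + z * z * cnj z'"
  unfolding cubic_deriv_def complex_norm_square by (simp add: power2_eq_square mult_ac)

lemma cubic_has_vector_derivative:
  assumes "(z has_vector_derivative z') (at t within A)"
  shows "((\<lambda>t. cubic (z t)) has_vector_derivative cubic_deriv (z t) z') (at t within A)"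
proof -
  have "((\<lambda>t. z t * z t * cnj (z t)) has_vector_derivative
      z t * z t * cnj z' + (z t * z' + z' * z t) * cnj (z t)) (at t within A)"
    by (intro has_vector_derivative_mult assms bounded_linear.has_vector_derivative[OF bounded_linear_cnj])
  then show ?thesis
    by (simp add: cubic_eq cubic_deriv_eq algebra_simps)
qed

text \<open>The expression is the second derivative of the cubic along a curve with value
  \<open>z\<close>, velocity \<open>z'\<close> and acceleration \<open>z''\<close>. It consists of
  nine monomials of degree three.\<close>

lemma norm_cubic_deriv2_le:
  assumes "cmod z \<le> P" "cmod z' \<le> P" "cmod z'' \<le> P"
  shows "cmod (2 * (z * cnj z * z'' + (z * cnj z' + z' * cnj z) * z') + (z * z * cnj z'' + (z * z' + z' * z) * cnj z'))
      \<le> 9 * P ^ 3"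
proof -
  have P: "0 \<le> P" using assms(1) norm_ge_zero order_trans by blast
  have b: "cmod (x * y * w) \<le> P * P * P" if "cmod x \<le> P" "cmod y \<le> P" "cmod w \<le> P" for x y w
    unfolding norm_mult using that P by (intro mult_mono) auto
  have expand: "2 * (z * cnj z * z'' + (z * cnj z' + z' * cnj z) * z') + (z * z * cnj z'' + (z * z' + z' * z) * cnj z')
     = z * cnj z * z'' + z * cnj z * z'' + z * cnj z' * z' + z * cnj z' * z' + z' * cnj z * z' + z' * cnj z * z'
       + z * z * cnj z'' + z * z' * cnj z' + z' * z * cnj z'"
    by (simp add: algebra_simps)
  show ?thesis
    unfolding expand
  proof (rule order_trans)
    show "cmod (z * cnj z * z'' + z * cnj z * z'' + z * cnj z' * z' + z * cnj z' * z' + z' * cnj z * z' + z' * cnj z * z'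
       + z * z * cnj z'' + z * z' * cnj z' + z' * z * cnj z')
       \<le> P*P*P + P*P*P + P*P*P + P*P*P + P*P*P + P*P*P + P*P*P + P*P*P + P*P*P"
      by (intro order_trans[OF norm_triangle_ineq] add_mono b) (use assms in simp_all)
  qed (simp add: power3_eq_cube)
qed

lemma discrete_gronwall:
  fixes x :: "nat \<Rightarrow> real"
  assumes step: "\<And>i. i \<le> n \<Longrightarrow> x i \<le> A + r * (\<Sum>k<i. x k)" and r: "0 \<le> r" and A: "0 \<le> A"
  shows "x n \<le> A * exp (r * real n)"
proof -
  \<comment> \<open>The induction runs on the right-hand side of the hypothesis, which grows by at
    most the factor \<open>1 + r\<close> in each step, whereas \<open>x\<close> itself need not be
    monotone.\<close>
  have "A + r * (\<Sum>k<i. x k) \<le> A * (1 + r) ^ i" if "i \<le> n" for i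
    using that
  proof (induction i)
    case (Suc i)
    have "A + r * (\<Sum>k<Suc i. x k) = (A + r * (\<Sum>k<i. x k)) + r * x i"
      by (simp add: algebra_simps)
    also have "\<dots> \<le> (A + r * (\<Sum>k<i. x k)) + r * (A + r * (\<Sum>k<i. x k))"
      using step[of i] Suc.prems r by (intro add_left_mono mult_left_mono) auto
    also have "\<dots> = (1 + r) * (A + r * (\<Sum>k<i. x k))" by (simp add: algebra_simps)
    also have "\<dots> \<le> (1 + r) * (A * (1 + r) ^ i)"
      using Suc r by (intro mult_left_mono) auto
    finally show ?case by (simp add: algebra_simps)
  qed simp
  then have "x n \<le> A * (1 + r) ^ n" using step[of n] by fastforce
  also have "\<dots> \<le> A * exp r ^ n"
    using A r exp_ge_add_one_self[of r] by (intro mult_left_mono power_mono) auto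
  finally show ?thesis unfolding exp_of_nat2_mult .
qed

lemma integral_split_grid:
  fixes f :: "real \<Rightarrow> complex"
  assumes "0 \<le> \<tau>" "f integrable_on {0..real n * \<tau>}"
  shows "integral {0..real n * \<tau>} f = (\<Sum>k<n. integral {real k * \<tau>..real (Suc k) * \<tau>} f)"
  using assms(2)
proof (induction n)
  case (Suc n)
  have le: "0 \<le> real n * \<tau>" "real n * \<tau> \<le> real (Suc n) * \<tau>"
    using assms(1) by (simp_all add: mult_right_mono)
  have "integral {0..real (Suc n) * \<tau>} f
      = integral {0..real n * \<tau>} f + integral {real n * \<tau>..real (Suc n) * \<tau>} f"
    using Henstock_Kurzweil_Integration.integral_combine[OF le Suc.prems] by simp
  moreover have "f integrable_on {0..real n * \<tau>}"
    using Suc.prems by (rule integrable_on_subinterval) (use le in auto)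
  ultimately show ?case using Suc.IH by simp
qed simp

context periodic_interval
begin

lemma fseries_diff:
  assumes "fseries c u" "fseries d v"
  shows "fseries (\<lambda>l. c l - d l) (\<lambda>x. u x - v x)"
  unfolding fseries_def
proof
  fix x assume x: "x \<in> {a..b}"
  have "((\<lambda>l. - (d l * em l x)) has_sum - v x) UNIV"
    using fseriesD[OF assms(2) x] by (simp add: has_sum_uminus)
  from has_sum_add[OF fseriesD[OF assms(1) x] this]
  show "((\<lambda>l. (c l - d l) * em l x) has_sum (u x - v x)) UNIV"
    by (simp add: left_diff_distrib)
qed

lemma fseries_trig_sum: "fseries (\<lambda>l. if l \<in> modes M then w l else 0) (trig_sum a b M w)"
  unfolding fseries_def
proof
  fix x
  have "((\<lambda>l. w l * em l x) has_sum trig_sum a b M w x) (modes M)"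
    unfolding trig_sum_def by (rule has_sum_finite) simp
  then show "((\<lambda>l. (if l \<in> modes M then w l else 0) * em l x) has_sum trig_sum a b M w x) UNIV"
    by (rule has_sum_cong_neutral[THEN iffD1, rotated -1]) auto
qed

end

text \<open>\<open>Suc (Suc k)\<close> is the order \<open>m\<close> of the theorem, and
  \<open>S\<close> is the horizon. The relations \<open>T \<le> S\<close> and
  \<open>\<epsilon>\<^sup>2 * S \<le> T\<close> replace the exponent \<beta>, so that the constants
  depend on \<open>T\<close> but not on \<open>S\<close> or \<epsilon>.\<close>

locale nlsw_bounded = nlsw_modes +
  fixes \<epsilon> S T K :: real and k :: nat and \<psi>0 \<psi>1 :: "real \<Rightarrow> complex" and \<psi> :: "real \<Rightarrow> real \<Rightarrow> complex"
  assumes T: "0 < T" "T \<le> S" and horizon: "\<epsilon>\<^sup>2 * S \<le> T"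
    and eps: "0 < \<epsilon>" "\<epsilon> \<le> 1"
    and sol: "nlsw_solution a b \<alpha> \<epsilon> S \<psi>0 \<psi>1 \<psi>"
    and H0: "\<And>t. t \<in> {0..S} \<Longrightarrow> Hbound (Suc (Suc k)) K (fc (\<lambda>x. \<psi> x t))"
    and H1: "\<And>t. t \<in> {0..S} \<Longrightarrow> Hbound 1 K (fc (\<lambda>x. dt S \<psi> x t))"
    and H2: "\<And>t. t \<in> {0..S} \<Longrightarrow> Hbound 1 K (fc (\<lambda>x. dt S (dt S \<psi>) x t))"
begin

abbreviation \<psi>t :: "real \<Rightarrow> real \<Rightarrow> complex" where "\<psi>t \<equiv> dt S \<psi>"
abbreviation \<psi>tt :: "real \<Rightarrow> real \<Rightarrow> complex" where "\<psi>tt \<equiv> dt S (dt S \<psi>)"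

abbreviation u_hat :: "real \<Rightarrow> int \<Rightarrow> complex" where "u_hat t \<equiv> fc (\<lambda>x. \<psi> x t)"
abbreviation v_hat :: "real \<Rightarrow> int \<Rightarrow> complex" where "v_hat t \<equiv> fc (\<lambda>x. \<psi>t x t)"
abbreviation w_hat :: "real \<Rightarrow> int \<Rightarrow> complex" where "w_hat t \<equiv> fc (\<lambda>x. \<psi>tt x t)"
abbreviation f_hat :: "real \<Rightarrow> int \<Rightarrow> complex" where "f_hat t \<equiv> fc (\<lambda>x. cubic (\<psi> x t))"
abbreviation \<kappa> :: complex where "\<kappa> \<equiv> - of_real (\<epsilon>\<^sup>2 / \<alpha>)"

definition sup_const :: real where "sup_const = sobolev_const * K"
definition force_const :: real where "force_const = cubic_const k * K ^ 3"

lemma S: "0 < S" using T by simp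

lemma zero_in: "0 \<in> {0..S}" using S by simp

lemma K_nonneg: "0 \<le> K"
  using Hbound_nonneg[OF H0[OF zero_in]] .

lemma sup_const_nonneg: "0 \<le> sup_const"
  using K_nonneg sobolev_const_ge_1 by (simp add: sup_const_def)

lemma force_const_nonneg: "0 \<le> force_const"
  using K_nonneg cubic_const_nonneg by (simp add: force_const_def)

lemma cont: "cont_rect S \<psi>"
  and cont_t: "cont_rect S \<psi>t"
  and cont_tt: "cont_rect S \<psi>tt"
  and cont_xx: "continuous_on ({a..b} \<times> {0..S}) (\<lambda>(x, t). dx a b (dx a b \<psi>) x t)"
  and C1t: "C1_time a b S \<psi>" "C1_time a b S \<psi>t"
  and C1x: "C1_space a b S \<psi>" "C1_space a b S (dx a b \<psi>)"
  using sol by (auto simp: nlsw_solution_def C1_time_def C1_space_def)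

lemma bc: "t \<in> {0..S} \<Longrightarrow> \<psi> a t = \<psi> b t" "t \<in> {0..S} \<Longrightarrow> dx a b \<psi> a t = dx a b \<psi> b t"
  and init: "x \<in> {a..b} \<Longrightarrow> \<psi> x 0 = \<psi>0 x" "x \<in> {a..b} \<Longrightarrow> \<psi>t x 0 = \<psi>1 x"
  using sol by (auto simp: nlsw_solution_def)

lemma cont_cubic: "continuous_on ({a..b} \<times> {0..S}) (\<lambda>(x, t). cubic (\<psi> x t))"
  using continuous_on_cubic[OF cont] by (simp add: case_prod_beta)

lemma H0_1: "t \<in> {0..S} \<Longrightarrow> Hbound 1 K (u_hat t)"
  by (rule Hbound_mono[OF H0]) auto

lemma fseries_\<psi>: "t \<in> {0..S} \<Longrightarrow> fseries (u_hat t) (\<lambda>x. \<psi> x t)"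
  and fseries_\<psi>t: "t \<in> {0..S} \<Longrightarrow> fseries (v_hat t) (\<lambda>x. \<psi>t x t)"
  and fseries_\<psi>tt: "t \<in> {0..S} \<Longrightarrow> fseries (w_hat t) (\<lambda>x. \<psi>tt x t)"
  by (rule fseries_fc[OF continuous_on_section[OF cont] H0_1] fseries_fc[OF continuous_on_section[OF cont_t] H1]
      fseries_fc[OF continuous_on_section[OF cont_tt] H2]; assumption)+

lemma sup_bounds:
  assumes "x \<in> {a..b}" "t \<in> {0..S}"
  shows "cmod (\<psi> x t) \<le> sup_const" "cmod (\<psi>t x t) \<le> sup_const" "cmod (\<psi>tt x t) \<le> sup_const"
  unfolding sup_const_def using assms
  by (auto intro!: fseries_norm_le[OF fseries_\<psi> H0_1] fseries_norm_le[OF fseries_\<psi>t H1] fseries_norm_le[OF fseries_\<psi>tt H2])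

text \<open>One order less than the solution has: in the Duhamel integral the kernel supplies the
  missing derivative, and aliasing in L^2 at order \<open>Suc k\<close> already has the rate
  \<open>h ^ Suc k\<close>.\<close>

lemma cubic_bounds:
  assumes t: "t \<in> {0..S}"
  shows "fseries (f_hat t) (\<lambda>x. cubic (\<psi> x t))"
    and "Hbound (Suc k) force_const (f_hat t)"
proof -
  have "Hbound (Suc k) K (u_hat t)"
    by (rule Hbound_mono[OF H0[OF t]]) auto
  then obtain d where d: "fseries d (\<lambda>x. cubic (\<psi> x t))" "Hbound (Suc k) force_const d"
    unfolding force_const_def by (rule fseries_cubic[OF fseries_\<psi>[OF t]])
  have "Hbound 1 force_const d" by (rule Hbound_mono[OF d(2)]) auto
  then have "f_hat t = d"
    by (intro ext fc_fseries[OF d(1)])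
  with d show "fseries (f_hat t) (\<lambda>x. cubic (\<psi> x t))"
    "Hbound (Suc k) force_const (f_hat t)" by simp_all
qed

text \<open>The equation is given for interior points and positive times. All derivatives in it are
  continuous on the closed rectangle, so it extends to the closure.\<close>

lemma pde:
  assumes "x \<in> {a..b}" "t \<in> {0..S}"
  shows "\<i> * \<psi>t x t - of_real \<alpha> * \<psi>tt x t + dx a b (dx a b \<psi>) x t - of_real (\<epsilon>\<^sup>2) * cubic (\<psi> x t) = 0"
proof -
  define \<Phi> where "\<Phi> p = \<i> * (case p of (x, t) \<Rightarrow> \<psi>t x t) - of_real \<alpha> * (case p of (x, t) \<Rightarrow> \<psi>tt x t)
    + (case p of (x, t) \<Rightarrow> dx a b (dx a b \<psi>) x t) - of_real (\<epsilon>\<^sup>2) * (case p of (x, t) \<Rightarrow> cubic (\<psi> x t))" for p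
  have cl: "closure ({a<..<b} \<times> {0<..<S}) = {a..b} \<times> {0..S}"
    using a_less_b S by (simp add: closure_Times)
  have "continuous_on ({a..b} \<times> {0..S}) \<Phi>"
    unfolding \<Phi>_def by (intro continuous_intros cont_t cont_tt cont_xx cont_cubic)
  then have "continuous_on (closure ({a<..<b} \<times> {0<..<S})) \<Phi>"
    unfolding cl .
  moreover have "\<Phi> p = 0" if "p \<in> {a<..<b} \<times> {0<..<S}" for p
    using sol that by (auto simp: \<Phi>_def nlsw_solution_def)
  moreover have "(x, t) \<in> closure ({a<..<b} \<times> {0<..<S})" using assms by (simp only: cl mem_Sigma_iff)
  ultimately have "\<Phi> (x, t) = 0" by (rule continuous_constant_on_closure)
  then show ?thesis by (simp add: \<Phi>_def)
qed

lemma mode_ode: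
  assumes t: "t \<in> {0..S}"
  shows "w_hat t l - \<i> / of_real \<alpha> * v_hat t l + of_real ((wn l)\<^sup>2 / \<alpha>) * u_hat t l
     = \<kappa> * f_hat t l"
proof -
  note c = continuous_on_section[OF cont_t t] continuous_on_section[OF cont_tt t]
    continuous_on_section[OF cont_xx t] continuous_on_section[OF cont_cubic t]
  have "0 = fc (\<lambda>x. \<i> * \<psi>t x t - of_real \<alpha> * \<psi>tt x t + dx a b (dx a b \<psi>) x t - of_real (\<epsilon>\<^sup>2) * cubic (\<psi> x t)) l"
    using fc_cong[OF pde[OF _ t]] fc_const[of 0 l] by simp
  also have "\<dots> = \<i> * v_hat t l - of_real \<alpha> * w_hat t l
      + fc (\<lambda>x. dx a b (dx a b \<psi>) x t) l - of_real (\<epsilon>\<^sup>2) * f_hat t l"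
    using c by (simp add: fc_diff fc_add fc_cmult continuous_on_mult_left continuous_on_add continuous_on_diff)
  also have "fc (\<lambda>x. dx a b (dx a b \<psi>) x t) l = - of_real ((wn l)\<^sup>2) * u_hat t l"
    by (rule fc_second_derivative[OF C1x t bc[OF t]])
  finally have eq: "of_real \<alpha> * w_hat t l = \<i> * v_hat t l
      - of_real ((wn l)\<^sup>2) * u_hat t l - of_real (\<epsilon>\<^sup>2) * f_hat t l"
    by (simp add: algebra_simps)
  have "w_hat t l = (of_real \<alpha> * w_hat t l) / of_real \<alpha>"
    using \<alpha>_pos by simp
  then show ?thesis
    unfolding eq by (simp add: diff_divide_distrib)
qed

lemma mode_duhamel:
  assumes "t \<in> {0..S}"
  shows "((\<lambda>s. kern l (t - s) * (\<kappa> * f_hat s l)) has_integral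
    u_hat t l - resp l t * u_hat 0 l - kern l t * v_hat 0 l) {0..t}"
proof (rule duhamel[where S = S and v = "\<lambda>t. v_hat t l" and w = "\<lambda>t. w_hat t l"])
  show "0 \<le> t" "t \<le> S" using assms by auto
next
  fix s assume s: "s \<in> {0..S}"
  show "((\<lambda>t. u_hat t l) has_vector_derivative v_hat s l) (at s within {0..S})"
    by (rule fc_time_derivative[OF cont C1t(1) s])
  show "((\<lambda>t. v_hat t l) has_vector_derivative w_hat s l) (at s within {0..S})"
    by (rule fc_time_derivative[OF cont_t C1t(2) s])
qed (rule mode_ode)

lemma continuous_on_force: "A \<subseteq> {0..S} \<Longrightarrow> continuous_on A (\<lambda>s. f_hat s l)"
  by (rule continuous_on_subset[OF continuous_on_fc_param[OF cont_cubic]])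

end

lemma vector_derivative_norm_bound:
  fixes f :: "real \<Rightarrow> complex"
  assumes "p \<le> q" and der: "\<And>r. r \<in> {p..q} \<Longrightarrow> (f has_vector_derivative f' r) (at r within {p..q})"
    and bound: "\<And>r. r \<in> {p..q} \<Longrightarrow> cmod (f' r) \<le> B"
  shows "cmod (f q - f p) \<le> B * (q - p)"
proof -
  have "norm (f q - f p) \<le> B * norm (q - p)"
  proof (rule differentiable_bound[of "{p..q}"])
    show "(f has_derivative (\<lambda>h. h *\<^sub>R f' r)) (at r within {p..q})" if "r \<in> {p..q}" for r
      using der[OF that] by (simp add: has_vector_derivative_def)
    show "onorm (\<lambda>h. h *\<^sub>R f' r) \<le> B" if "r \<in> {p..q}" for r
      using bound[OF that] by (intro onorm_le) (simp add: mult.commute[of B] mult_left_mono)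
  qed (use assms(1) in auto)
  then show ?thesis using assms(1) by simp
qed

lemma has_integral_sin_squared:
  fixes \<beta> T :: real
  assumes "0 < \<beta>" "0 \<le> T"
  shows "((\<lambda>t. (sin (t * \<beta> / 2))\<^sup>2) has_integral (T / 2 - sin (T * \<beta>) / (2 * \<beta>))) {0..T}"
proof -
  have "((\<lambda>t. t / 2 - sin (t * \<beta>) / (2 * \<beta>)) has_vector_derivative (sin (t * \<beta> / 2))\<^sup>2) (at t within {0..T})" for t
  proof -
    have "(sin (t * \<beta> / 2))\<^sup>2 = 1 / 2 - cos (t * \<beta>) * \<beta> / (2 * \<beta>)"
      using cos_double_sin[of "t * \<beta> / 2"] assms(1) by (simp add: diff_divide_distrib)
    then show ?thesis
      unfolding has_real_derivative_iff_has_vector_derivative[symmetric]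
      using assms(1) by (auto intro!: derivative_eq_intros)
  qed
  from fundamental_theorem_of_calculus[OF assms(2) this] show ?thesis by simp
qed

lemma L2_set_Int_Diff_le: "L2_set g F \<le> L2_set g (F \<inter> D) + L2_set g (F - D)"
proof (cases "finite F")
  case True
  then have "(\<Sum>i\<in>F. (g i)\<^sup>2) = (\<Sum>i\<in>F \<inter> D. (g i)\<^sup>2) + (\<Sum>i\<in>F - D. (g i)\<^sup>2)"
    by (rule sum.Int_Diff)
  then show ?thesis
    unfolding L2_set_def by (simp add: sqrt_add_le_add_sqrt sum_nonneg)
qed simp

section \<open>Regularity of the initial velocity, and Taylor expansion of the force\<close>

context nlsw_bounded
begin

text \<open>\<open>2 * K\<close> stems from the positions at time \<open>t\<close> and at time 0,
  the rest from the Duhamel integral over a time of at most \<open>T\<close>.\<close>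

definition free_const :: real where
  "free_const = 2 * K + T * (2 / \<alpha> * force_const)"

text \<open>The two summands belong to the low and the high frequencies in
  \<open>velocity_bound\<close>, which are separated at \<open>T * bd l = 2\<close>.\<close>

definition velocity_const :: real where
  "velocity_const = sqrt ((2 / T) ^ (2 * k) * K\<^sup>2 + 4 / \<alpha>\<^sup>2 * free_const\<^sup>2)"

lemma eps_sq_le: "\<epsilon>\<^sup>2 \<le> 1"
  using eps by (simp add: power_le_one)

text \<open>Duhamel's formula, solved for the velocity term. Of the \<open>Suc (Suc k)\<close>
  weights on the integral, one is spent on the kernel and the others on the force.\<close>

lemma free_evolution_bound:
  assumes F: "finite F" and t: "t \<in> {0..T}"
  shows "L2_set (\<lambda>l. weight l ^ Suc (Suc k) * cmod (kern l t * v_hat 0 l)) F \<le> free_const"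
proof -
  let ?w = "\<lambda>l. weight l ^ Suc (Suc k)"
  have tS: "t \<in> {0..S}" using t T by auto
  let ?v = "\<lambda>l s. of_real (?w l) * (kern l (t - s) * (\<kappa> * f_hat s l))"
  define I where "I l = integral {0..t} (\<lambda>s. kern l (t - s) * (\<kappa> * f_hat s l))" for l
  have split: "kern l t * v_hat 0 l = (u_hat t l - resp l t * u_hat 0 l) - I l" for l
    using integral_unique[OF mode_duhamel[OF tS, of l]] by (simp add: I_def)
  have pull: "cmod (integral {0..t} (?v l))
      = ?w l * cmod (I l)" for l
    unfolding integral_mult_right norm_mult norm_of_real I_def using zero_le_power[OF less_imp_le[OF weight_pos]]
    by (simp only: abs_of_nonneg)
  have "L2_set (\<lambda>l. cmod (integral {0..t} (?v l))) F
      \<le> (t - 0) * (2 / \<alpha> * force_const)"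
  proof (rule L2_set_integral_le)
    show "0 \<le> t" using t by simp
    show "continuous_on {0..t} (?v l)" for l
      using tS by (intro continuous_intros continuous_on_kern continuous_on_force) auto
    fix s assume "s \<in> {0..t}"
    then have s: "s \<in> {0..S}" using tS by auto
    have "L2_set (\<lambda>l. cmod (?v l s)) F
        \<le> L2_set (\<lambda>l. 2 / \<alpha> * (weight l ^ Suc k * cmod (f_hat s l))) F"
    proof (rule L2_set_mono)
      fix l
      have "cmod (?v l s)
          = (weight l * cmod (kern l (t - s))) * (\<epsilon>\<^sup>2 / \<alpha>) * (weight l ^ Suc k * cmod (f_hat s l))"
        using weight_pos[of l] \<alpha>_pos by (simp add: norm_mult norm_divide norm_power mult_ac)
      also have "\<dots> \<le> 2 * (1 / \<alpha>) * (weight l ^ Suc k * cmod (f_hat s l))"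
        using weight_norm_kern_le[of l "t - s"] eps_sq_le \<alpha>_pos weight_pos[of l]
        by (intro mult_right_mono mult_mono divide_right_mono) auto
      finally show "cmod (?v l s)
        \<le> 2 / \<alpha> * (weight l ^ Suc k * cmod (f_hat s l))" by simp
    qed simp
    also have "\<dots> = 2 / \<alpha> * L2_set (\<lambda>l. weight l ^ Suc k * cmod (f_hat s l)) F"
      using \<alpha>_pos by (intro L2_set_right_distrib[symmetric]) simp
    also have "\<dots> \<le> 2 / \<alpha> * force_const"
      using HboundD[OF cubic_bounds(2)[OF s] F] \<alpha>_pos by (intro mult_left_mono) auto
    finally show "L2_set (\<lambda>l. cmod (?v l s)) F
        \<le> 2 / \<alpha> * force_const" .
  qed
  also have "(t - 0) * (2 / \<alpha> * force_const) \<le> T * (2 / \<alpha> * force_const)"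
    using t \<alpha>_pos force_const_nonneg by (intro mult_right_mono) auto
  finally have I: "L2_set (\<lambda>l. ?w l * cmod (I l)) F \<le> T * (2 / \<alpha> * force_const)"
    unfolding pull .
  have "L2_set (\<lambda>l. ?w l * cmod (kern l t * v_hat 0 l)) F
      \<le> L2_set (\<lambda>l. (?w l * cmod (u_hat t l) + ?w l * cmod (u_hat 0 l)) + ?w l * cmod (I l)) F"
  proof (rule L2_set_mono)
    fix l
    have "cmod (kern l t * v_hat 0 l)
        \<le> (cmod (u_hat t l) + cmod (resp l t * u_hat 0 l)) + cmod (I l)"
      unfolding split by (intro order_trans[OF norm_triangle_ineq4] add_mono order_refl)
    also have "cmod (resp l t * u_hat 0 l) \<le> 1 * cmod (u_hat 0 l)"
      unfolding norm_mult by (intro mult_right_mono norm_resp_le) simp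
    finally show "?w l * cmod (kern l t * v_hat 0 l)
        \<le> (?w l * cmod (u_hat t l) + ?w l * cmod (u_hat 0 l)) + ?w l * cmod (I l)"
      unfolding distrib_left[symmetric] using weight_pos[of l] by (intro mult_left_mono) auto
  qed (simp add: weight_pos less_imp_le)
  also have "\<dots> \<le> L2_set (\<lambda>l. ?w l * cmod (u_hat t l)) F + L2_set (\<lambda>l. ?w l * cmod (u_hat 0 l)) F
      + L2_set (\<lambda>l. ?w l * cmod (I l)) F"
    by (intro order_trans[OF L2_set_triangle_ineq] add_mono L2_set_triangle_ineq order_refl)
  also have "\<dots> \<le> K + K + T * (2 / \<alpha> * force_const)"
    by (intro add_mono HboundD H0 F tS zero_in I)
  finally show ?thesis by (simp add: free_const_def)
qed

text \<open>
  The initial velocity is one derivative less regular than the solution: for the wave equation, the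
  time average of the energy of the position over \<open>[0, T]\<close> controls the energy of the velocity,
  because \<open>kern l t\<close> oscillates like \<open>sin (t * bd l / 2)\<close>. Only low frequencies, which do not oscillate
  on \<open>[0, T]\<close>, require the assumed bound on the time derivative.
\<close>

lemma velocity_bound: "Hbound (Suc k) velocity_const (v_hat 0)"
  unfolding Hbound_iff_sum
proof (intro conjI allI impI)
  show "0 \<le> velocity_const" by (simp add: velocity_const_def)
  fix F :: "int set" assume F: "finite F"
  define v where "v l = cmod (v_hat 0 l)" for l
  define c where "c l = (\<alpha> * (weight l ^ Suc k * v l))\<^sup>2" for l
  \<comment> \<open>The integral of \<open>(sin (t * bd l / 2))\<^sup>2\<close> over the interval
    from 0 to \<open>T\<close>.\<close>
  define \<sigma> where "\<sigma> l = T / 2 - sin (T * bd l) / (2 * bd l)" for l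
  have le: "(\<Sum>l\<in>F. c l * (sin (t * bd l / 2))\<^sup>2) \<le> free_const\<^sup>2" if t: "t \<in> {0..T}" for t
  proof -
    have "(\<Sum>l\<in>F. c l * (sin (t * bd l / 2))\<^sup>2)
        \<le> (\<Sum>l\<in>F. (weight l ^ Suc (Suc k) * cmod (kern l t * v_hat 0 l))\<^sup>2)"
    proof (rule sum_mono)
      fix l
      have "\<alpha> \<le> weight l * (2 / bd l)"
        using bd_le_weight[of l] bd_pos[of l] \<alpha>_pos by (simp add: field_simps)
      then have "\<alpha> * (weight l ^ Suc k * v l * \<bar>sin (t * bd l / 2)\<bar>)
          \<le> weight l * (2 / bd l) * (weight l ^ Suc k * v l * \<bar>sin (t * bd l / 2)\<bar>)"
        using weight_pos[of l] by (intro mult_right_mono) (auto simp: v_def)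
      also have "\<dots> = weight l ^ Suc (Suc k) * cmod (kern l t * v_hat 0 l)"
        by (simp add: norm_mult norm_kern v_def mult_ac)
      finally have "(\<alpha> * (weight l ^ Suc k * v l * \<bar>sin (t * bd l / 2)\<bar>))\<^sup>2
          \<le> (weight l ^ Suc (Suc k) * cmod (kern l t * v_hat 0 l))\<^sup>2"
        using weight_pos[of l] \<alpha>_pos by (intro power_mono) (auto simp: v_def)
      then show "c l * (sin (t * bd l / 2))\<^sup>2
          \<le> (weight l ^ Suc (Suc k) * cmod (kern l t * v_hat 0 l))\<^sup>2"
        by (simp add: c_def power_mult_distrib mult_ac)
    qed
    also have "\<dots> = (L2_set (\<lambda>l. weight l ^ Suc (Suc k) * cmod (kern l t * v_hat 0 l)) F)\<^sup>2"
      by (simp add: L2_set_def sum_nonneg)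
    also have "\<dots> \<le> free_const\<^sup>2"
      using free_evolution_bound[OF F t] by (intro power_mono) auto
    finally show ?thesis .
  qed
  have int_sum: "((\<lambda>t. \<Sum>l\<in>F. c l * (sin (t * bd l / 2))\<^sup>2) has_integral (\<Sum>l\<in>F. c l * \<sigma> l)) {0..T}"
    unfolding \<sigma>_def using T
    by (intro has_integral_sum F has_integral_mult_right has_integral_sin_squared bd_pos) auto
  have int_const: "((\<lambda>t. free_const\<^sup>2) has_integral T * free_const\<^sup>2) {0..T}"
    using has_integral_const_real[of "free_const\<^sup>2" 0 T] T by simp
  have int: "(\<Sum>l\<in>F. c l * \<sigma> l) \<le> T * free_const\<^sup>2"
    by (rule has_integral_le[OF int_sum int_const le])
  have point: "(weight l ^ Suc k * v l)\<^sup>2 \<le> (2 / T) ^ (2 * k) * (weight l ^ 1 * v l)\<^sup>2 + 4 / (T * \<alpha>\<^sup>2) * (c l * \<sigma> l)" for l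
  proof (cases "2 \<le> T * bd l")
    \<comment> \<open>High frequencies: the oscillating part of \<sigma> is at most
      \<open>T / 4\<close>, so the time average of the squared sine stays away from 0.\<close>
    case True
    have "sin (T * bd l) / (2 * bd l) \<le> 1 / (2 * bd l)"
      using bd_pos[of l] by (intro divide_right_mono) auto
    also have "\<dots> \<le> T / 4" using True bd_pos[of l] by (simp add: field_simps)
    finally have "T / 4 \<le> \<sigma> l" by (simp add: \<sigma>_def)
    then have "4 / (T * \<alpha>\<^sup>2) * (c l * (T / 4)) \<le> 4 / (T * \<alpha>\<^sup>2) * (c l * \<sigma> l)"
      using T by (intro mult_left_mono) (auto simp: c_def)
    moreover have "4 / (T * \<alpha>\<^sup>2) * (c l * (T / 4)) = (weight l ^ Suc k * v l)\<^sup>2"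
      using T \<alpha>_pos by (simp add: c_def power_mult_distrib)
    moreover have "0 \<le> (2 / T) ^ (2 * k) * (weight l ^ 1 * v l)\<^sup>2" using T by simp
    ultimately show ?thesis by linarith
  next
    \<comment> \<open>Low frequencies: here \<open>weight l \<le> bd l < 2 / T\<close>, so
      \<open>k\<close> of the weights cost at most \<open>(2 / T) ^ k\<close>, and the H^1 bound on
      the velocity suffices. The other summand is discarded, for which \<sigma> must be
      nonnegative.\<close>
    case False
    have "T * bd l / (2 * bd l) \<ge> sin (T * bd l) / (2 * bd l)"
      using bd_pos[of l] T by (intro divide_right_mono sin_x_le_x) auto
    then have "0 \<le> \<sigma> l" using bd_pos[of l] by (simp add: \<sigma>_def)
    then have "0 \<le> 4 / (T * \<alpha>\<^sup>2) * (c l * \<sigma> l)" using T by (simp add: c_def)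
    moreover have "weight l \<le> 2 / T"
      using False weight_le_bd[of l] T by (simp add: field_simps) (smt (verit) mult_left_mono)
    then have "weight l ^ k \<le> (2 / T) ^ k" using weight_pos[of l] by (intro power_mono) auto
    then have "weight l ^ k * (weight l * v l) \<le> (2 / T) ^ k * (weight l * v l)"
      using weight_pos[of l] by (intro mult_right_mono) (auto simp: v_def)
    then have "(weight l ^ k * (weight l * v l))\<^sup>2 \<le> ((2 / T) ^ k * (weight l * v l))\<^sup>2"
      using weight_pos[of l] by (intro power_mono) (auto simp: v_def)
    then have "(weight l ^ Suc k * v l)\<^sup>2 \<le> (2 / T) ^ (2 * k) * (weight l ^ 1 * v l)\<^sup>2"
      by (simp add: power_mult_distrib power_mult[symmetric] mult_ac)
    ultimately show ?thesis by linarith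
  qed
  have "(\<Sum>l\<in>F. (weight l ^ Suc k * v l)\<^sup>2)
      \<le> (\<Sum>l\<in>F. (2 / T) ^ (2 * k) * (weight l ^ 1 * v l)\<^sup>2 + 4 / (T * \<alpha>\<^sup>2) * (c l * \<sigma> l))"
    by (intro sum_mono point)
  also have "\<dots> = (2 / T) ^ (2 * k) * (\<Sum>l\<in>F. (weight l ^ 1 * v l)\<^sup>2) + 4 / (T * \<alpha>\<^sup>2) * (\<Sum>l\<in>F. c l * \<sigma> l)"
    by (simp add: sum.distrib sum_distrib_left)
  also have "\<dots> \<le> (2 / T) ^ (2 * k) * K\<^sup>2 + 4 / (T * \<alpha>\<^sup>2) * (T * free_const\<^sup>2)"
    using H1[OF zero_in] F int T unfolding Hbound_iff_sum v_def by (intro add_mono mult_left_mono) auto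
  also have "\<dots> = velocity_const\<^sup>2"
    using T by (simp add: velocity_const_def)
  finally show "(\<Sum>l\<in>F. (weight l ^ Suc k * cmod (v_hat 0 l))\<^sup>2) \<le> velocity_const\<^sup>2"
    by (simp add: v_def)
qed

lemma velocity_const_nonneg: "0 \<le> velocity_const"
  using Hbound_nonneg[OF velocity_bound] .

definition taylor_const :: real where
  "taylor_const = 9 * sup_const ^ 3"

lemma taylor_const_nonneg: "0 \<le> taylor_const"
  using sup_const_nonneg by (simp add: taylor_const_def)

lemma time_deriv:
  assumes "x \<in> {a..b}" "t \<in> {0..S}"
  shows "((\<lambda>t. \<psi> x t) has_vector_derivative \<psi>t x t) (at t within {0..S})"
    and "((\<lambda>t. \<psi>t x t) has_vector_derivative \<psi>tt x t) (at t within {0..S})"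
  using C1t assms by (auto simp: C1_time_def dt_def vector_derivative_works)

text \<open>The point \<open>c\<close> of expansion is free: the left end serves the force on the
  current step, the right end the backward difference of the scheme. The mean value inequality is
  used twice, for the derivative \<open>D\<close> and for the cubic minus its linear part.\<close>

lemma cubic_taylor:
  assumes x: "x \<in> {a..b}" and pq: "0 \<le> p" "p \<le> q" "q \<le> S" and c: "c \<in> {p..q}"
  shows "cmod (cubic (\<psi> x q) - cubic (\<psi> x p) - of_real (q - p) * cubic_deriv (\<psi> x c) (\<psi>t x c))
      \<le> taylor_const * (q - p)\<^sup>2"
proof -
  define D where "D t = cubic_deriv (\<psi> x t) (\<psi>t x t)" for t
  define D' where "D' t = 2 * (\<psi> x t * cnj (\<psi> x t) * \<psi>tt x t + (\<psi> x t * cnj (\<psi>t x t) + \<psi>t x t * cnj (\<psi> x t)) * \<psi>t x t)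
      + (\<psi> x t * \<psi> x t * cnj (\<psi>tt x t) + (\<psi> x t * \<psi>t x t + \<psi>t x t * \<psi> x t) * cnj (\<psi>t x t))" for t
  have sub: "(f has_vector_derivative d) (at t within {p'..q'})"
    if "(f has_vector_derivative d) (at t within {0..S})" "p \<le> p'" "q' \<le> q" for f :: "real \<Rightarrow> complex" and d t p' q'
    by (rule has_vector_derivative_within_subset[OF that(1)]) (use that pq in auto)
  have derD: "(D has_vector_derivative D' t) (at t within {0..S})" if "t \<in> {0..S}" for t
    unfolding D_def[abs_def] D'_def cubic_deriv_eq
    by (intro has_vector_derivative_add has_vector_derivative_mult has_vector_derivative_mult_right
        bounded_linear.has_vector_derivative[OF bounded_linear_cnj] time_deriv x that)
  have normD: "cmod (D' t) \<le> taylor_const" if "t \<in> {0..S}" for t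
    unfolding D'_def taylor_const_def by (intro norm_cubic_deriv2_le sup_bounds x that)
  have lip_le: "cmod (D r' - D r) \<le> taylor_const * (r' - r)" if "p \<le> r" "r \<le> r'" "r' \<le> q" for r r'
  proof (rule vector_derivative_norm_bound[OF that(2), where f' = D'])
    fix t assume "t \<in> {r..r'}"
    then have t: "t \<in> {0..S}" using that pq by auto
    show "(D has_vector_derivative D' t) (at t within {r..r'})"
      by (rule sub[OF derD[OF t] that(1,3)])
    show "cmod (D' t) \<le> taylor_const" by (rule normD[OF t])
  qed
  have lip: "cmod (D r - D c) \<le> taylor_const * (q - p)" if r: "r \<in> {p..q}" for r
  proof -
    have "cmod (D r - D c) \<le> taylor_const * \<bar>r - c\<bar>"
    proof (cases "c \<le> r")
      case True
      then show ?thesis using lip_le[of c r] r c by simp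
    next
      case False
      then show ?thesis using lip_le[of r c] r c by (simp add: norm_minus_commute)
    qed
    also have "\<dots> \<le> taylor_const * (q - p)"
      using r c taylor_const_nonneg by (intro mult_left_mono) auto
    finally show ?thesis .
  qed
  have "cmod ((cubic (\<psi> x q) - of_real (q - p) * D c) - (cubic (\<psi> x p) - of_real (p - p) * D c)) \<le> taylor_const * (q - p) * (q - p)"
  proof (rule vector_derivative_norm_bound[OF pq(2), where f' = "\<lambda>r. D r - 1 * D c"])
    fix r assume r: "r \<in> {p..q}"
    then have rS: "r \<in> {0..S}" using pq by auto
    have "((\<lambda>r. cubic (\<psi> x r)) has_vector_derivative D r) (at r within {p..q})"
      unfolding D_def by (rule sub[OF cubic_has_vector_derivative[OF time_deriv(1)[OF x rS]]]) auto
    then show "((\<lambda>r. cubic (\<psi> x r) - of_real (r - p) * D c) has_vector_derivative D r - 1 * D c) (at r within {p..q})"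
      by (intro has_vector_derivative_diff has_vector_derivative_mult_left
            has_vector_derivative_of_real_shift)
    show "cmod (D r - 1 * D c) \<le> taylor_const * (q - p)"
      using lip[OF r] by simp
  qed
  then show ?thesis by (simp add: D_def power2_eq_square algebra_simps)
qed

end

section \<open>Error estimate\<close>

locale ewi_run = nlsw_bounded +
  fixes M :: nat and \<tau> :: real
  assumes M: "0 < M" "even M" and \<tau>: "0 < \<tau>"
begin

abbreviation h :: real where "h \<equiv> (b - a) / real M"
abbreviation U :: "nat \<Rightarrow> nat \<Rightarrow> complex" where "U \<equiv> ewi_fp a b \<alpha> \<epsilon> \<tau> M \<psi>0 \<psi>1"
abbreviation g :: "nat \<Rightarrow> nat \<Rightarrow> complex" where "g \<equiv> scheme_g \<epsilon> \<tau> M \<psi>0 \<psi>1"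
abbreviation xg :: "nat \<Rightarrow> real" where "xg \<equiv> gridpt a b M"

definition err :: "nat \<Rightarrow> int \<Rightarrow> complex" where
  "err n l = u_hat (real n * \<tau>) l - dft a b M (U n) l"

definition energy :: "nat \<Rightarrow> real" where
  "energy n = L2_set (\<lambda>l. weight l * cmod (err n l)) (modes M)"

definition grid_error_le :: "nat \<Rightarrow> real \<Rightarrow> bool" where
  "grid_error_le n r \<longleftrightarrow> (\<forall>j<M. cmod (\<psi> (xg j) (real n * \<tau>) - U n j) \<le> r)"

definition defect :: "nat \<Rightarrow> int \<Rightarrow> real \<Rightarrow> complex" where
  "defect i l s = f_hat s l
     - (dft a b M (\<lambda>j. cubic (U i j)) l + of_real (s - real i * \<tau>) * dft a b M (g i) l)"

lemma h_pos: "0 < h"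
  using M a_less_b by simp

lemma xg_in: "j < M \<Longrightarrow> xg j \<in> {a..b}"
  using M(1) by (intro gridpt_in) auto

lemma energy_nonneg: "0 \<le> energy n"
  by (simp add: energy_def)

lemma step_in:
  assumes "real n * \<tau> \<le> S" "i < n"
  shows "{real i * \<tau>..real (Suc i) * \<tau>} \<subseteq> {0..S}"
proof -
  have "real (Suc i) * \<tau> \<le> real n * \<tau>"
    using assms(2) \<tau> by (intro mult_right_mono) auto
  then have "real (Suc i) * \<tau> \<le> S" using assms(1) by linarith
  moreover have "0 \<le> real i * \<tau>" using \<tau> by simp
  ultimately show ?thesis by (auto simp del: of_nat_Suc)
qed

lemma continuous_on_defect:
  "A \<subseteq> {0..S} \<Longrightarrow> continuous_on A (\<lambda>s. kern l (t - s) * (c * defect i l s))"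
  unfolding defect_def by (intro continuous_intros continuous_on_kern continuous_on_force)

text \<open>The exact Duhamel formula minus the discrete one of \<open>dft_ewi_fp\<close>. The
  scheme starts from samples of the exact data, so the initial terms are pure aliasing
  errors.\<close>

lemma err_eq:
  assumes l: "l \<in> modes M" and n: "real n * \<tau> \<le> S"
  shows "err n l =
      resp l (real n * \<tau>) * (u_hat 0 l - dft a b M (\<lambda>j. \<psi> (xg j) 0) l)
    + kern l (real n * \<tau>) * (v_hat 0 l - dft a b M (\<lambda>j. \<psi>t (xg j) 0) l)
    + (\<Sum>i<n. integral {real i * \<tau>..real (Suc i) * \<tau>}
        (\<lambda>s. kern l (real n * \<tau> - s) * (\<kappa> * defect i l s)))"
proof -
  define t where "t = real n * \<tau>"
  let ?I = "\<lambda>i. {real i * \<tau>..real (Suc i) * \<tau>}"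
  let ?F = "\<lambda>s. f_hat s l"
  let ?A = "\<lambda>i. dft a b M (\<lambda>j. cubic (U i j)) l" and ?B = "\<lambda>i. dft a b M (g i) l"
  have t: "t \<in> {0..S}" using n \<tau> by (simp add: t_def)
  have int: "(\<lambda>s. kern l (t - s) * (\<kappa> * ?F s)) integrable_on A" if "A = {p..q}" "A \<subseteq> {0..S}" for A p q
    unfolding that(1) using that
    by (intro integrable_continuous_interval continuous_intros continuous_on_kern continuous_on_force) auto
  have "u_hat t l - resp l t * u_hat 0 l - kern l t * v_hat 0 l
      = integral {0..t} (\<lambda>s. kern l (t - s) * (\<kappa> * ?F s))"
    using integral_unique[OF mode_duhamel[OF t, of l]] by simp
  also have "\<dots> = (\<Sum>i<n. integral (?I i) (\<lambda>s. kern l (t - s) * (\<kappa> * ?F s)))"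
    unfolding t_def by (rule integral_split_grid) (use \<tau> t int[of "{0..t}" 0 t] in \<open>auto simp: t_def\<close>)
  finally have exact: "u_hat t l = resp l t * u_hat 0 l + kern l t * v_hat 0 l
      + (\<Sum>i<n. integral (?I i) (\<lambda>s. kern l (t - s) * (\<kappa> * ?F s)))"
    by (simp add: algebra_simps)
  have init_dft: "dft a b M (\<lambda>j. \<psi>0 (xg j)) l = dft a b M (\<lambda>j. \<psi> (xg j) 0) l"
    "dft a b M (\<lambda>j. \<psi>1 (xg j)) l = dft a b M (\<lambda>j. \<psi>t (xg j) 0) l"
    by (auto intro!: dft_cong init[OF xg_in, symmetric])
  have numeric: "dft a b M (U n) l = resp l t * dft a b M (\<lambda>j. \<psi> (xg j) 0) l + kern l t * dft a b M (\<lambda>j. \<psi>t (xg j) 0) l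
      + (\<Sum>i<n. \<kappa> * impulse l \<tau> i t (?A i) (?B i))"
    using dft_ewi_fp[OF \<tau> M(1) l, of \<epsilon> \<psi>0 \<psi>1 n]
    by (simp add: init_dft t_def sum_distrib_left sum_negf)
  have diff: "integral (?I i) (\<lambda>s. kern l (t - s) * (\<kappa> * ?F s)) - \<kappa> * impulse l \<tau> i t (?A i) (?B i)
      = integral (?I i) (\<lambda>s. kern l (t - s) * (\<kappa> * defect i l s))" if i: "i < n" for i
  proof -
    let ?P = "\<lambda>s. ?A i + of_real (s - real i * \<tau>) * ?B i"
    have "(\<lambda>s. \<kappa> * (kern l (t - s) * ?P s)) integrable_on ?I i"
      by (intro integrable_continuous_interval continuous_on_mult_left continuous_on_impulse)
    then have "integral (?I i) (\<lambda>s. kern l (t - s) * (\<kappa> * ?F s)) - integral (?I i) (\<lambda>s. \<kappa> * (kern l (t - s) * ?P s))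
        = integral (?I i) (\<lambda>s. kern l (t - s) * (\<kappa> * ?F s) - \<kappa> * (kern l (t - s) * ?P s))"
      by (intro integral_diff[symmetric] int[OF refl step_in[OF n i]])
    also have "\<dots> = integral (?I i) (\<lambda>s. kern l (t - s) * (\<kappa> * defect i l s))"
      by (intro integral_cong) (simp add: defect_def algebra_simps)
    finally show ?thesis by (simp add: impulse_def)
  qed
  have "err n l = resp l t * (u_hat 0 l - dft a b M (\<lambda>j. \<psi> (xg j) 0) l)
    + kern l t * (v_hat 0 l - dft a b M (\<lambda>j. \<psi>t (xg j) 0) l)
    + (\<Sum>i<n. integral (?I i) (\<lambda>s. kern l (t - s) * (\<kappa> * ?F s)) - \<kappa> * impulse l \<tau> i t (?A i) (?B i))"
    unfolding err_def t_def[symmetric] exact numeric sum_subtractf by (simp add: algebra_simps)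
  also have "(\<Sum>i<n. integral (?I i) (\<lambda>s. kern l (t - s) * (\<kappa> * ?F s)) - \<kappa> * impulse l \<tau> i t (?A i) (?B i))
      = (\<Sum>i<n. integral (?I i) (\<lambda>s. kern l (t - s) * (\<kappa> * defect i l s)))"
    by (intro sum.cong refl diff) simp
  finally show ?thesis by (simp only: t_def)
qed

text \<open>The response to the initial position is bounded without gain, so this error is measured
  in H^1. The kernel absorbs the weight at the price of a factor 2, so the initial velocity and the
  defects are measured in L^2.\<close>

lemma energy_le:
  assumes n: "real n * \<tau> \<le> S"
    and \<delta>: "\<And>i s. i < n \<Longrightarrow> s \<in> {real i * \<tau>..real (Suc i) * \<tau>} \<Longrightarrow> L2_set (\<lambda>l. cmod (defect i l s)) (modes M) \<le> \<delta> i"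
  shows "energy n \<le> 2 * (b - a + 4) * h ^ Suc k * K + 4 * h ^ Suc k * velocity_const
      + 2 * \<epsilon>\<^sup>2 / \<alpha> * \<tau> * (\<Sum>i<n. \<delta> i)"
proof -
  define t where "t = real n * \<tau>"
  let ?I = "\<lambda>i. {real i * \<tau>..real (Suc i) * \<tau>}"
  define e0 where "e0 l = u_hat 0 l - dft a b M (\<lambda>j. \<psi> (xg j) 0) l" for l
  define e1 where "e1 l = v_hat 0 l - dft a b M (\<lambda>j. \<psi>t (xg j) 0) l" for l
  define J where "J i l = integral (?I i) (\<lambda>s. of_real (weight l) * (kern l (t - s) * (\<kappa> * defect i l s)))" for i l
  let ?v = "\<lambda>i l s. of_real (weight l) * (kern l (t - s) * (\<kappa> * defect i l s))"
  have J: "L2_set (\<lambda>l. cmod (J i l)) (modes M) \<le> \<tau> * (2 * \<epsilon>\<^sup>2 / \<alpha> * \<delta> i)" if i: "i < n" for i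
  proof -
    have "L2_set (\<lambda>l. cmod (J i l)) (modes M) \<le> (real (Suc i) * \<tau> - real i * \<tau>) * (2 * \<epsilon>\<^sup>2 / \<alpha> * \<delta> i)"
      unfolding J_def
    proof (rule L2_set_integral_le)
      show "real i * \<tau> \<le> real (Suc i) * \<tau>" using \<tau> by simp
      show "continuous_on (?I i) (?v i l)" for l
        by (intro continuous_on_mult_left continuous_on_defect step_in[OF n i])
      fix s assume s: "s \<in> ?I i"
      have "L2_set (\<lambda>l. cmod (?v i l s)) (modes M)
          \<le> L2_set (\<lambda>l. 2 * \<epsilon>\<^sup>2 / \<alpha> * cmod (defect i l s)) (modes M)"
      proof (rule L2_set_mono)
        fix l
        have "cmod (?v i l s)
            = (weight l * cmod (kern l (t - s))) * (\<epsilon>\<^sup>2 / \<alpha> * cmod (defect i l s))"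
          using weight_pos[of l] \<alpha>_pos by (simp add: norm_mult norm_divide norm_power mult_ac)
        also have "\<dots> \<le> 2 * (\<epsilon>\<^sup>2 / \<alpha> * cmod (defect i l s))"
          using \<alpha>_pos by (intro mult_right_mono weight_norm_kern_le) auto
        finally show "cmod (?v i l s)
            \<le> 2 * \<epsilon>\<^sup>2 / \<alpha> * cmod (defect i l s)" by simp
      qed simp
      also have "\<dots> = 2 * \<epsilon>\<^sup>2 / \<alpha> * L2_set (\<lambda>l. cmod (defect i l s)) (modes M)"
        using \<alpha>_pos by (intro L2_set_right_distrib[symmetric]) simp
      also have "\<dots> \<le> 2 * \<epsilon>\<^sup>2 / \<alpha> * \<delta> i"
        using \<delta>[OF i s] \<alpha>_pos by (intro mult_left_mono) auto
      finally show "L2_set (\<lambda>l. cmod (?v i l s)) (modes M)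
          \<le> 2 * \<epsilon>\<^sup>2 / \<alpha> * \<delta> i" .
    qed
    then show ?thesis by (simp add: algebra_simps)
  qed
  have "energy n \<le> L2_set (\<lambda>l. (weight l * cmod (e0 l) + 2 * cmod (e1 l)) + (\<Sum>i<n. cmod (J i l))) (modes M)"
    unfolding energy_def
  proof (rule L2_set_mono)
    fix l assume l: "l \<in> modes M"
    have "of_real (weight l) * err n l = of_real (weight l) * (resp l t * e0 l) + of_real (weight l) * (kern l t * e1 l) + (\<Sum>i<n. J i l)"
      unfolding err_eq[OF l n] J_def integral_mult_right e0_def e1_def t_def
      by (simp add: distrib_left sum_distrib_left)
    then have "cmod (of_real (weight l) * err n l)
        \<le> cmod (of_real (weight l) * (resp l t * e0 l)) + cmod (of_real (weight l) * (kern l t * e1 l)) + (\<Sum>i<n. cmod (J i l))"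
      by (auto intro!: order_trans[OF norm_triangle_ineq] add_mono norm_sum)
    also have "cmod (of_real (weight l) * (resp l t * e0 l)) \<le> weight l * (1 * cmod (e0 l))"
      unfolding norm_mult norm_of_real using weight_pos[of l] norm_resp_le[of l t]
      by (simp only: abs_of_pos) (intro mult_left_mono mult_right_mono, auto)
    also have "cmod (of_real (weight l) * (kern l t * e1 l)) \<le> 2 * cmod (e1 l)"
    proof -
      have "cmod (of_real (weight l) * (kern l t * e1 l)) = (weight l * cmod (kern l t)) * cmod (e1 l)"
        using weight_pos[of l] by (simp add: norm_mult)
      then show ?thesis using weight_norm_kern_le[of l t] by (simp add: mult_right_mono)
    qed
    finally show "weight l * cmod (err n l) \<le> (weight l * cmod (e0 l) + 2 * cmod (e1 l)) + (\<Sum>i<n. cmod (J i l))"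
      using weight_pos[of l] by (simp add: norm_mult)
  qed (simp add: weight_pos less_imp_le)
  also have "\<dots> \<le> (L2_set (\<lambda>l. weight l * cmod (e0 l)) (modes M) + L2_set (\<lambda>l. 2 * cmod (e1 l)) (modes M))
      + (\<Sum>i<n. L2_set (\<lambda>l. cmod (J i l)) (modes M))"
    by (rule order_trans[OF L2_set_triangle_ineq add_mono[OF L2_set_triangle_ineq L2_set_sum_le]])
  also have "L2_set (\<lambda>l. weight l * cmod (e0 l)) (modes M) \<le> 2 * (b - a + 4) * h ^ Suc k * K"
    unfolding e0_def by (rule aliasing_H1[OF M(1) fseries_\<psi>[OF zero_in] H0[OF zero_in]])
  also have "L2_set (\<lambda>l. 2 * cmod (e1 l)) (modes M) = 2 * L2_set (\<lambda>l. cmod (e1 l)) (modes M)"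
    by (intro L2_set_right_distrib[symmetric]) simp
  also have "L2_set (\<lambda>l. cmod (e1 l)) (modes M) \<le> 2 * h ^ Suc k * velocity_const"
    unfolding e1_def by (rule aliasing_L2[OF M(1) fseries_\<psi>t[OF zero_in] velocity_bound])
  also have "(\<Sum>i<n. L2_set (\<lambda>l. cmod (J i l)) (modes M)) \<le> (\<Sum>i<n. \<tau> * (2 * \<epsilon>\<^sup>2 / \<alpha> * \<delta> i))"
    by (intro sum_mono J) simp
  also have "\<dots> = 2 * \<epsilon>\<^sup>2 / \<alpha> * \<tau> * (\<Sum>i<n. \<delta> i)"
    unfolding sum_distrib_left by (intro sum.cong refl) simp
  finally show ?thesis by simp
qed

text \<open>Lipschitz constant of the cubic on the disc of radius \<open>sup_const + 1\<close>,
  which contains the numerical values as long as the grid error is at most 1.\<close>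

definition lip_const :: real where
  "lip_const = 3 * (sup_const + 1)\<^sup>2"

lemma lip_const_nonneg: "0 \<le> lip_const"
  by (simp add: lip_const_def)

lemma cubic_grid_error:
  assumes "real i * \<tau> \<le> S" "grid_error_le i 1" "grid_error_le i r" "j < M"
  shows "cmod (cubic (\<psi> (xg j) (real i * \<tau>)) - cubic (U i j)) \<le> lip_const * r"
proof -
  let ?z = "\<psi> (xg j) (real i * \<tau>)"
  have z: "cmod ?z \<le> sup_const"
    using assms(1) \<tau> by (intro sup_bounds xg_in assms(4)) auto
  moreover have "cmod (U i j) \<le> cmod ?z + cmod (?z - U i j)"
    using norm_triangle_ineq4[of ?z "?z - U i j"] by simp
  moreover have d: "cmod (?z - U i j) \<le> 1" "cmod (?z - U i j) \<le> r"
    using assms by (auto simp: grid_error_le_def)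
  ultimately have "cmod (cubic ?z - cubic (U i j)) \<le> 3 * (sup_const + 1)\<^sup>2 * cmod (?z - U i j)"
    by (intro cubic_lipschitz) auto
  also have "\<dots> \<le> lip_const * r"
    using d(2) by (simp add: lip_const_def mult_left_mono)
  finally show ?thesis .
qed

text \<open>The defect splits into a forward Taylor remainder, the remainder of the backward
  difference scaled by a number \<rho> of at most 1, and grid errors. The grid error at
  \<open>i\<close> counts twice, in the value and in the difference quotient; the one at
  \<open>i - 1\<close> counts once.\<close>

lemma nonlinear_defect:
  assumes iS: "real (Suc i) * \<tau> \<le> S" and s: "s \<in> {real i * \<tau>..real (Suc i) * \<tau>}" and j: "j < M"
    and err: "grid_error_le i 1" "grid_error_le (i - 1) 1" "grid_error_le i r" "grid_error_le (i - 1) r'"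
  shows "cmod (cubic (\<psi> (xg j) s) - (cubic (U i j) + of_real (s - real i * \<tau>) * g i j))
      \<le> 2 * taylor_const * \<tau>\<^sup>2 + lip_const * (2 * r + r')"
proof -
  let ?x = "xg j" and ?t = "real i * \<tau>"
  define \<phi> where "\<phi> t = cubic (\<psi> ?x t)" for t
  define D where "D = cubic_deriv (\<psi> ?x ?t) (\<psi>t ?x ?t)"
  have x: "?x \<in> {a..b}" by (rule xg_in[OF j])
  have tS: "?t \<le> S" "0 \<le> ?t" using iS \<tau> by (simp_all add: algebra_simps)
  have \<sigma>: "0 \<le> s - ?t" "s - ?t \<le> \<tau>" using s by (simp_all add: algebra_simps)
  have fwd: "cmod (\<phi> s - \<phi> ?t - of_real (s - ?t) * D) \<le> taylor_const * \<tau>\<^sup>2"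
  proof -
    have "cmod (\<phi> s - \<phi> ?t - of_real (s - ?t) * D) \<le> taylor_const * (s - ?t)\<^sup>2"
      unfolding \<phi>_def D_def using s tS iS by (intro cubic_taylor x) auto
    also have "\<dots> \<le> taylor_const * \<tau>\<^sup>2"
      using \<sigma> taylor_const_nonneg by (intro mult_left_mono power_mono) auto
    finally show ?thesis .
  qed
  have r: "0 \<le> r" "0 \<le> r'"
    using err(3,4) M(1) order_trans[OF norm_ge_zero] unfolding grid_error_le_def by blast+
  have e: "cmod (\<phi> ?t - cubic (U i j)) \<le> lip_const * r"
    unfolding \<phi>_def by (rule cubic_grid_error[OF tS(1) err(1,3) j])
  show ?thesis
  proof (cases i)
    \<comment> \<open>At the first step the data are exact and the scheme uses the exact time
      derivative, so the forward remainder is all there is.\<close>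
    case 0
    have "U i j = \<psi> ?x 0" "g i j = D"
      using 0 x by (simp_all add: init scheme_g_def D_def cubic_deriv_def)
    then have "cubic (\<psi> ?x s) - (cubic (U i j) + of_real (s - ?t) * g i j) = \<phi> s - \<phi> ?t - of_real (s - ?t) * D"
      using 0 by (simp add: \<phi>_def)
    then have "cmod (cubic (\<psi> ?x s) - (cubic (U i j) + of_real (s - ?t) * g i j)) \<le> taylor_const * \<tau>\<^sup>2"
      using fwd by simp
    also have "\<dots> \<le> 2 * taylor_const * \<tau>\<^sup>2 + lip_const * (2 * r + r')"
      using r taylor_const_nonneg lip_const_nonneg by (simp add: mult_nonneg_nonneg)
    finally show ?thesis .
  next
    case (Suc i')
    let ?t' = "real i' * \<tau>"
    have t': "?t = ?t' + \<tau>" by (simp add: Suc distrib_right)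
    define \<rho> where "\<rho> = (s - ?t) / \<tau>"
    have \<rho>: "0 \<le> \<rho>" "\<rho> \<le> 1" "s - ?t = \<rho> * \<tau>" using \<sigma> \<tau> by (simp_all add: \<rho>_def)
    have bwd: "cmod (\<phi> ?t - \<phi> ?t' - of_real \<tau> * D) \<le> taylor_const * \<tau>\<^sup>2"
      unfolding \<phi>_def D_def using cubic_taylor[OF x, of ?t' ?t ?t] tS \<tau> t' by simp
    have e': "cmod (\<phi> ?t' - cubic (U i' j)) \<le> lip_const * r'"
      unfolding \<phi>_def using err(2,4) Suc tS t' \<tau> by (intro cubic_grid_error j) auto
    have g: "of_real (s - ?t) * g i j = of_real \<rho> * (cubic (U i j) - cubic (U i' j))"
    proof -
      have "g i j = (cubic (U i j) - cubic (U i' j)) / of_real \<tau>" by (simp add: scheme_g_def Suc)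
      then show ?thesis unfolding \<rho>(3) using \<tau> by simp
    qed
    have triangle: "cmod (X1 - of_real \<rho> * X2 + X3 + of_real \<rho> * X3 - of_real \<rho> * X4)
        \<le> cmod X1 + cmod X2 + cmod X3 + cmod X3 + cmod X4" for X1 X2 X3 X4 :: complex
    proof -
      have "cmod (of_real \<rho> * X) \<le> cmod X" for X :: complex
        using \<rho> by (simp add: norm_mult mult_left_le_one_le)
      from this[of X2] this[of X3] this[of X4] show ?thesis
        using norm_triangle_ineq4[of "X1 - of_real \<rho> * X2 + X3 + of_real \<rho> * X3" "of_real \<rho> * X4"]
          norm_triangle_ineq[of "X1 - of_real \<rho> * X2 + X3" "of_real \<rho> * X3"]
          norm_triangle_ineq[of "X1 - of_real \<rho> * X2" X3] norm_triangle_ineq4[of X1 "of_real \<rho> * X2"]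
        by linarith
    qed
    \<comment> \<open>The derivative \<open>D\<close> cancels between the two remainders, because
      \<open>s - ?t = \<rho> * \<tau>\<close>.\<close>
    have "cubic (\<psi> ?x s) - (cubic (U i j) + of_real (s - ?t) * g i j)
        = (\<phi> s - \<phi> ?t - of_real (s - ?t) * D) - of_real \<rho> * (\<phi> ?t - \<phi> ?t' - of_real \<tau> * D)
          + (\<phi> ?t - cubic (U i j)) + of_real \<rho> * (\<phi> ?t - cubic (U i j)) - of_real \<rho> * (\<phi> ?t' - cubic (U i' j))"
      unfolding g unfolding \<rho>(3) \<phi>_def by (simp add: algebra_simps)
    also have "cmod \<dots> \<le> taylor_const * \<tau>\<^sup>2 + taylor_const * \<tau>\<^sup>2 + lip_const * r + lip_const * r + lip_const * r'"
      by (rule order_trans[OF triangle]) (intro add_mono fwd bwd e e')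
    finally show ?thesis by (simp add: algebra_simps)
  qed
qed

text \<open>Inserting the discrete coefficients of the exact force separates aliasing from the
  pointwise defect on the grid.\<close>

lemma defect_le:
  assumes iS: "real (Suc i) * \<tau> \<le> S" and s: "s \<in> {real i * \<tau>..real (Suc i) * \<tau>}"
    and err: "grid_error_le i 1" "grid_error_le (i - 1) 1" "grid_error_le i r" "grid_error_le (i - 1) r'"
  shows "L2_set (\<lambda>l. cmod (defect i l s)) (modes M)
      \<le> 2 * h ^ Suc k * force_const + (2 * taylor_const * \<tau>\<^sup>2 + lip_const * (2 * r + r'))"
proof -
  let ?e = "\<lambda>l. f_hat s l - dft a b M (\<lambda>j. cubic (\<psi> (xg j) s)) l"
  let ?d = "\<lambda>j. cubic (\<psi> (xg j) s) - (cubic (U i j) + of_real (s - real i * \<tau>) * g i j)"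
  have sS: "s \<in> {0..S}" using s iS \<tau> by (auto intro: order_trans[rotated])
  have r: "0 \<le> r" "0 \<le> r'"
    using err(3,4) M(1) order_trans[OF norm_ge_zero] unfolding grid_error_le_def by blast+
  have split: "defect i l s = ?e l + dft a b M ?d l" for l
    by (simp add: defect_def dft_diff dft_add dft_cmult)
  have "L2_set (\<lambda>l. cmod (defect i l s)) (modes M) \<le> L2_set (\<lambda>l. cmod (?e l) + cmod (dft a b M ?d l)) (modes M)"
    unfolding split by (intro L2_set_mono norm_triangle_ineq) simp
  also have "\<dots> \<le> L2_set (\<lambda>l. cmod (?e l)) (modes M) + L2_set (\<lambda>l. cmod (dft a b M ?d l)) (modes M)"
    by (rule L2_set_triangle_ineq)
  also have "L2_set (\<lambda>l. cmod (?e l)) (modes M) \<le> 2 * h ^ Suc k * force_const"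
    by (rule aliasing_L2[OF M(1) cubic_bounds[OF sS]])
  also have "L2_set (\<lambda>l. cmod (dft a b M ?d l)) (modes M) \<le> 2 * taylor_const * \<tau>\<^sup>2 + lip_const * (2 * r + r')"
    using r taylor_const_nonneg lip_const_nonneg
    by (intro L2_set_dft_le M(1) nonlinear_defect[OF iS s _ err]) auto
  finally show ?thesis by simp
qed

lemma ewi_fp_trig_sum: "n \<noteq> 0 \<Longrightarrow> \<exists>w. U n = (\<lambda>j. trig_sum a b M w (xg j))"
  by (cases n; cases "n - 1") (auto simp: Let_def)

text \<open>From the first step on, the grid values are by construction samples of a trigonometric
  sum over the grid modes, which interpolation reproduces.\<close>

lemma trig_interp_grid:
  assumes "n \<noteq> 0"
  shows "trig_interp a b M (U n) (xg j) = U n j"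
proof -
  obtain w where w: "U n = (\<lambda>j. trig_sum a b M w (xg j))" using ewi_fp_trig_sum[OF assms] by blast
  have "trig_sum a b M (dft a b M (U n)) (xg j) = trig_sum a b M w (xg j)"
    unfolding trig_sum_def w using dft_trig_sum[OF M(1)] by (intro sum.cong) (auto simp: trig_sum_def)
  then show ?thesis by (simp add: trig_interp_def w)
qed

text \<open>On the grid modes the coefficients of the error are \<open>err\<close>; the other modes
  carry the tail of the exact solution. The grid error follows by the Sobolev embedding.\<close>

lemma solution_error:
  assumes n: "real n * \<tau> \<le> S"
  defines "d \<equiv> \<lambda>x. \<psi> x (real n * \<tau>) - trig_interp a b M (U n) x"
  shows "continuous_on {a..b} d" and "Hbound 1 (energy n + h ^ Suc k * K) (fc d)"
    and "grid_error_le n (sobolev_const * (energy n + h ^ Suc k * K))"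
proof -
  let ?t = "real n * \<tau>"
  define c where "c l = u_hat ?t l - (if l \<in> modes M then dft a b M (U n) l else 0)" for l
  have t: "?t \<in> {0..S}" using n \<tau> by simp
  have ser: "fseries c d"
    unfolding c_def d_def trig_interp_def by (rule fseries_diff[OF fseries_\<psi>[OF t] fseries_trig_sum])
  have H: "Hbound 1 (energy n + h ^ Suc k * K) c"
    unfolding Hbound_def
  proof (intro allI impI)
    fix F :: "int set" assume F: "finite F"
    have "L2_set (\<lambda>l. weight l ^ 1 * cmod (c l)) F
        \<le> L2_set (\<lambda>l. weight l * cmod (c l)) (F \<inter> modes M) + L2_set (\<lambda>l. weight l * cmod (c l)) (F - modes M)"
      using L2_set_Int_Diff_le[of "\<lambda>l. weight l * cmod (c l)"] by simp
    also have "L2_set (\<lambda>l. weight l * cmod (c l)) (F \<inter> modes M) = L2_set (\<lambda>l. weight l * cmod (err n l)) (F \<inter> modes M)"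
      by (rule L2_set_cong) (auto simp: c_def err_def)
    also have "\<dots> \<le> energy n"
      unfolding energy_def by (rule L2_set_mono_subset) auto
    also have "L2_set (\<lambda>l. weight l * cmod (c l)) (F - modes M) = L2_set (\<lambda>l. weight l * cmod (u_hat ?t l)) (F - modes M)"
      by (rule L2_set_cong) (auto simp: c_def)
    also have "\<dots> \<le> h ^ Suc k * K"
      using F by (intro Hbound_tail[OF M H0[OF t]]) auto
    finally show "L2_set (\<lambda>l. weight l ^ 1 * cmod (c l)) F \<le> energy n + h ^ Suc k * K" by simp
  qed
  show "continuous_on {a..b} d" by (rule fseries_continuous[OF ser H])
  have "fc d = c" using fc_fseries[OF ser H] by blast
  with H show "Hbound 1 (energy n + h ^ Suc k * K) (fc d)" by simp
  show "grid_error_le n (sobolev_const * (energy n + h ^ Suc k * K))"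
    unfolding grid_error_le_def
  proof (intro allI impI)
    fix j assume j: "j < M"
    show "cmod (\<psi> (xg j) ?t - U n j) \<le> sobolev_const * (energy n + h ^ Suc k * K)"
    proof (cases "n = 0")
      \<comment> \<open>Initially the grid values are exact, so there is no error;
        \<open>trig_interp_grid\<close> speaks of the later steps.\<close>
      case True
      then show ?thesis
        using xg_in[OF j] sobolev_const_ge_1 Hbound_nonneg[OF H] by (simp add: init)
    next
      case False
      then show ?thesis
        using fseries_norm_le[OF ser H xg_in[OF j]] by (simp add: d_def trig_interp_grid)
    qed
  qed
qed

text \<open>In \<open>energy_step\<close>, the last summand arises as the factor of
  \<open>\<epsilon>\<^sup>2 * S * \<tau>\<^sup>2\<close> and the others as factors of
  \<open>h ^ Suc k\<close>; their sum serves for both.\<close>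

definition base_const :: real where
  "base_const = 2 * (b - a + 4) * K + 4 * velocity_const
     + 2 / \<alpha> * T * (2 * force_const + 3 * lip_const * sobolev_const * K) + 4 / \<alpha> * taylor_const"

text \<open>The exponent bounds the Gronwall rate of \<open>energy_step\<close> times the number of
  steps, by \<open>\<epsilon>\<^sup>2 * (real n * \<tau>) \<le> T\<close>.\<close>

definition error_const :: real where
  "error_const = base_const * exp (8 / \<alpha> * lip_const * sobolev_const * T)"

lemma base_const_nonneg: "0 \<le> base_const"
  unfolding base_const_def
  using a_less_b K_nonneg velocity_const_nonneg \<alpha>_pos T force_const_nonneg lip_const_nonneg
    sobolev_const_ge_1 taylor_const_nonneg
  by (intro add_nonneg_nonneg mult_nonneg_nonneg divide_nonneg_nonneg) auto

lemma error_const_nonneg: "0 \<le> error_const"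
  using base_const_nonneg by (simp add: error_const_def)

lemma energy_step:
  assumes n: "real n * \<tau> \<le> S" and bounded: "\<And>i. i < n \<Longrightarrow> grid_error_le i 1"
  shows "energy n \<le> base_const * (h ^ Suc k + \<epsilon>\<^sup>2 * S * \<tau>\<^sup>2)
      + 8 * \<epsilon>\<^sup>2 * \<tau> / \<alpha> * lip_const * sobolev_const * (\<Sum>i<n. energy i)"
proof -
  define H where "H = h ^ Suc k"
  have H: "0 \<le> H" unfolding H_def by (rule zero_le_power[OF less_imp_le[OF h_pos]])
  define L where "L = lip_const * sobolev_const"
  have L: "0 \<le> L" using lip_const_nonneg sobolev_const_ge_1 by (simp add: L_def)
  define r where "r i = sobolev_const * (energy i + H * K)" for i
  define \<delta> where "\<delta> i = 2 * H * force_const + (2 * taylor_const * \<tau>\<^sup>2 + lip_const * (2 * r i + r (i - 1)))" for i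
  \<comment> \<open>The part of \<open>\<delta> i\<close> without energies; the 3 comes from
    \<open>2 * r i + r (i - 1)\<close>.\<close>
  define c where "c = 2 * H * force_const + 2 * taylor_const * \<tau>\<^sup>2 + 3 * L * H * K"
  have c: "0 \<le> c"
    unfolding c_def using H L force_const_nonneg taylor_const_nonneg K_nonneg by simp
  have iS: "real (Suc i) * \<tau> \<le> S" if "i < n" for i
    using step_in[OF n that] \<tau> by (simp add: mult_right_mono del: of_nat_Suc)
  have iS': "real i * \<tau> \<le> S" if "i < n" for i
    using iS[OF that] \<tau> by (simp add: algebra_simps)
  have E: "energy n \<le> 2 * (b - a + 4) * H * K + 4 * H * velocity_const
      + 2 * \<epsilon>\<^sup>2 / \<alpha> * \<tau> * (\<Sum>i<n. \<delta> i)"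
    unfolding H_def
  proof (rule energy_le[OF n])
    fix i s assume i: "i < n" and s: "s \<in> {real i * \<tau>..real (Suc i) * \<tau>}"
    have i': "i - 1 < n" using i by simp
    show "L2_set (\<lambda>l. cmod (defect i l s)) (modes M) \<le> \<delta> i"
      unfolding \<delta>_def H_def r_def
      by (rule defect_le[OF iS[OF i] s bounded[OF i] bounded[OF i']
            solution_error(3)[OF iS'[OF i]] solution_error(3)[OF iS'[OF i']]])
  qed
  have sum_\<delta>: "(\<Sum>i<n. \<delta> i) \<le> real n * c + 4 * L * (\<Sum>i<n. energy i)"
  proof -
    \<comment> \<open>Since \<open>0 - 1 = 0\<close> on natural numbers, the first energy may occur
      twice; the factor 2 is a crude allowance for it.\<close>
    have "(\<Sum>i<n. energy (i - 1)) \<le> 2 * (\<Sum>i<n. energy i)"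
    proof (cases n)
      case (Suc n')
      have "(\<Sum>i<n. energy (i - 1)) = energy 0 + (\<Sum>i<n'. energy i)"
        unfolding Suc by (subst sum.lessThan_Suc_shift) simp
      also have "energy 0 \<le> (\<Sum>i<n. energy i)"
        using Suc energy_nonneg by (intro member_le_sum) auto
      also have "(\<Sum>i<n'. energy i) \<le> (\<Sum>i<n. energy i)"
        using Suc energy_nonneg by (intro sum_mono2) auto
      finally show ?thesis by simp
    qed simp
    then have "L * (\<Sum>i<n. energy (i - 1)) \<le> L * (2 * (\<Sum>i<n. energy i))"
      using L by (intro mult_left_mono)
    moreover have "(\<Sum>i<n. \<delta> i) = (\<Sum>i<n. c + 2 * L * energy i + L * energy (i - 1))"
      by (intro sum.cong refl) (simp add: \<delta>_def c_def r_def L_def algebra_simps)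
    ultimately show ?thesis
      by (simp add: sum.distrib sum_distrib_left[symmetric])
  qed
  have "2 * \<epsilon>\<^sup>2 / \<alpha> * \<tau> * (\<Sum>i<n. \<delta> i) \<le> 2 * \<epsilon>\<^sup>2 / \<alpha> * \<tau> * (real n * c + 4 * L * (\<Sum>i<n. energy i))"
    using \<alpha>_pos \<tau> by (intro mult_left_mono sum_\<delta>) auto
  with E have "energy n \<le> 2 * (b - a + 4) * H * K + 4 * H * velocity_const
      + 2 * \<epsilon>\<^sup>2 / \<alpha> * \<tau> * (real n * c + 4 * L * (\<Sum>i<n. energy i))"
    by linarith
  also have "\<dots> = 2 * (b - a + 4) * H * K + 4 * H * velocity_const
      + 2 / \<alpha> * (\<epsilon>\<^sup>2 * (real n * \<tau>)) * c + 8 * \<epsilon>\<^sup>2 * \<tau> / \<alpha> * L * (\<Sum>i<n. energy i)"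
    by (simp add: algebra_simps)
  also have "2 / \<alpha> * (\<epsilon>\<^sup>2 * (real n * \<tau>)) * c \<le> 2 / \<alpha> * (\<epsilon>\<^sup>2 * S) * c"
    using n \<alpha>_pos c by (intro mult_right_mono mult_left_mono) auto
  \<comment> \<open>The aliasing part may use \<open>\<epsilon>\<^sup>2 * S \<le> T\<close>, while
    the Taylor part keeps \<open>\<epsilon>\<^sup>2 * S\<close>, the source of the factor
    \<open>\<epsilon> powr (2 - \<beta>)\<close>.\<close>
  also have "2 / \<alpha> * (\<epsilon>\<^sup>2 * S) * c = 2 / \<alpha> * (\<epsilon>\<^sup>2 * S) * ((2 * force_const + 3 * L * K) * H)
      + 4 / \<alpha> * taylor_const * (\<epsilon>\<^sup>2 * S * \<tau>\<^sup>2)"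
    by (simp add: c_def algebra_simps)
  also have "2 / \<alpha> * (\<epsilon>\<^sup>2 * S) * ((2 * force_const + 3 * L * K) * H) \<le> 2 / \<alpha> * T * ((2 * force_const + 3 * L * K) * H)"
    using horizon \<alpha>_pos H L force_const_nonneg K_nonneg by (intro mult_right_mono mult_left_mono) auto
  finally have "energy n \<le> (2 * (b - a + 4) * K + 4 * velocity_const + 2 / \<alpha> * T * (2 * force_const + 3 * L * K)) * H
      + 4 / \<alpha> * taylor_const * (\<epsilon>\<^sup>2 * S * \<tau>\<^sup>2) + 8 * \<epsilon>\<^sup>2 * \<tau> / \<alpha> * L * (\<Sum>i<n. energy i)"
    by (simp add: algebra_simps)
  also have "(2 * (b - a + 4) * K + 4 * velocity_const + 2 / \<alpha> * T * (2 * force_const + 3 * L * K)) * H \<le> base_const * H"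
    using H \<alpha>_pos taylor_const_nonneg by (intro mult_right_mono) (auto simp: base_const_def L_def mult.assoc)
  also have "4 / \<alpha> * taylor_const * (\<epsilon>\<^sup>2 * S * \<tau>\<^sup>2) \<le> base_const * (\<epsilon>\<^sup>2 * S * \<tau>\<^sup>2)"
  proof (rule mult_right_mono)
    have "0 \<le> 2 * (b - a + 4) * K + 4 * velocity_const
     + 2 / \<alpha> * T * (2 * force_const + 3 * lip_const * sobolev_const * K)"
      using a_less_b K_nonneg velocity_const_nonneg \<alpha>_pos T force_const_nonneg lip_const_nonneg sobolev_const_ge_1
      by (intro add_nonneg_nonneg mult_nonneg_nonneg divide_nonneg_nonneg) auto
    then show "4 / \<alpha> * taylor_const \<le> base_const" by (simp add: base_const_def)
  qed (use S in simp)
  finally show ?thesis by (simp add: H_def L_def distrib_left mult.assoc)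
qed

lemma grid_error_le_mono: "grid_error_le n r \<Longrightarrow> r \<le> r' \<Longrightarrow> grid_error_le n r'"
  unfolding grid_error_le_def using order_trans by blast

text \<open>There is no circularity, because the scheme is explicit: the energy at step
  \<open>n\<close> involves grid errors of earlier steps only, and \<open>small\<close> turns the
  resulting energy bound into a grid error of at most 1 at step \<open>n\<close>. Gronwall's
  inequality is applied afresh for each \<open>n\<close>, so the constant does not deteriorate along
  the induction.\<close>

lemma energy_bound:
  assumes small: "sobolev_const * (error_const * (h ^ Suc k + T * \<tau>\<^sup>2) + h ^ Suc k * K) \<le> 1"
    and n: "real n * \<tau> \<le> S"
  shows "energy n \<le> error_const * (h ^ Suc k + \<epsilon>\<^sup>2 * S * \<tau>\<^sup>2) \<and> grid_error_le n 1"
  using n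
proof (induction n rule: less_induct)
  case (less n)
  define r where "r = 8 * \<epsilon>\<^sup>2 * \<tau> / \<alpha> * lip_const * sobolev_const"
  define X where "X = h ^ Suc k + \<epsilon>\<^sup>2 * S * \<tau>\<^sup>2"
  have X: "0 \<le> X"
    unfolding X_def using S by (intro add_nonneg_nonneg zero_le_power[OF less_imp_le[OF h_pos]]) auto
  have LS: "0 \<le> lip_const * sobolev_const" using lip_const_nonneg sobolev_const_ge_1 by simp
  have le: "real i * \<tau> \<le> S" if "i \<le> n" for i
    using less.prems that \<tau> by (meson mult_right_mono of_nat_le_iff order_trans less_imp_le)
  have "energy n \<le> (base_const * X) * exp (r * real n)"
  proof (rule discrete_gronwall)
    fix i assume i: "i \<le> n"
    show "energy i \<le> base_const * X + r * (\<Sum>i<i. energy i)"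
      unfolding X_def r_def
      by (rule energy_step[OF le[OF i]]) (use less.IH le i in auto)
  next
    show "0 \<le> r" using LS \<tau> \<alpha>_pos by (simp add: r_def mult.assoc)
    show "0 \<le> base_const * X" using base_const_nonneg X by simp
  qed
  also have "exp (r * real n) \<le> exp (8 / \<alpha> * lip_const * sobolev_const * T)"
  proof -
    have "\<epsilon>\<^sup>2 * (real n * \<tau>) \<le> \<epsilon>\<^sup>2 * S" using less.prems by (intro mult_left_mono) auto
    then have "\<epsilon>\<^sup>2 * (real n * \<tau>) \<le> T" using horizon by linarith
    then have "8 / \<alpha> * (lip_const * sobolev_const) * (\<epsilon>\<^sup>2 * (real n * \<tau>)) \<le> 8 / \<alpha> * (lip_const * sobolev_const) * T"
      using \<alpha>_pos LS by (intro mult_left_mono) auto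
    then show ?thesis by (simp add: r_def mult_ac)
  qed
  finally have E: "energy n \<le> error_const * X"
    using base_const_nonneg X by (simp add: error_const_def mult_left_mono mult_right_mono mult_ac)
  have "\<epsilon>\<^sup>2 * S * \<tau>\<^sup>2 \<le> T * \<tau>\<^sup>2" using horizon by (intro mult_right_mono) auto
  then have "error_const * X \<le> error_const * (h ^ Suc k + T * \<tau>\<^sup>2)"
    unfolding X_def using error_const_nonneg by (intro mult_left_mono) auto
  with E have "energy n \<le> error_const * (h ^ Suc k + T * \<tau>\<^sup>2)" by linarith
  then have "sobolev_const * (energy n + h ^ Suc k * K)
      \<le> sobolev_const * (error_const * (h ^ Suc k + T * \<tau>\<^sup>2) + h ^ Suc k * K)"
    using sobolev_const_ge_1 by (intro mult_left_mono) auto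
  also note small
  finally have "grid_error_le n 1"
    by (rule grid_error_le_mono[OF solution_error(3)[OF less.prems]])
  with E show ?case by (simp add: X_def)
qed

end

section \<open>Choice of the constants and conclusion\<close>

lemma eps_powr_horizon:
  fixes \<epsilon> \<beta> T :: real
  assumes "0 < \<epsilon>" "\<epsilon> \<le> 1" "0 \<le> \<beta>" "\<beta> \<le> 2" "0 < T"
  shows "T \<le> T / \<epsilon> powr \<beta>" "\<epsilon>\<^sup>2 * (T / \<epsilon> powr \<beta>) = T * \<epsilon> powr (2 - \<beta>)" "\<epsilon> powr (2 - \<beta>) \<le> 1"
proof -
  have p: "0 < \<epsilon> powr \<beta>" "\<epsilon> powr \<beta> \<le> 1"
    using assms by (auto intro: powr_le1)
  then show "T \<le> T / \<epsilon> powr \<beta>" using assms(5) by (simp add: field_simps)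
  have "\<epsilon>\<^sup>2 = \<epsilon> powr 2" using assms(1) by (simp add: powr_numeral)
  then show "\<epsilon>\<^sup>2 * (T / \<epsilon> powr \<beta>) = T * \<epsilon> powr (2 - \<beta>)"
    by (simp add: powr_diff)
  show "\<epsilon> powr (2 - \<beta>) \<le> 1" using assms by (intro powr_le1) auto
qed

lemma grid_max_norm_attained:
  assumes "0 < M"
  obtains j where "j < M" "grid_max_norm M v = cmod (v j)"
proof -
  have "grid_max_norm M v \<in> (\<lambda>j. cmod (v j)) ` {0..M - 1}"
    unfolding grid_max_norm_def by (rule Max_in) auto
  then obtain j where "j \<in> {0..M - 1}" "grid_max_norm M v = cmod (v j)" by blast
  then show thesis using assms by (intro that[of j]) auto
qed

theorem theorem1:
  fixes a b \<alpha> \<beta> T :: real and m :: nat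
    and \<psi>0 \<psi>1 :: "real \<Rightarrow> real \<Rightarrow> complex"
    and \<psi> :: "real \<Rightarrow> real \<Rightarrow> real \<Rightarrow> complex"
  assumes "a < b" and "0 < \<alpha>" and "\<alpha> \<le> 1" and "0 < T"
    and "0 \<le> \<beta>" and "\<beta> \<le> 2" and "2 \<le> m"
    and sol: "\<And>\<epsilon>. 0 < \<epsilon> \<Longrightarrow> \<epsilon> \<le> 1 \<Longrightarrow>
      nlsw_solution a b \<alpha> \<epsilon> (T / \<epsilon> powr \<beta>) (\<psi>0 \<epsilon>) (\<psi>1 \<epsilon>) (\<psi> \<epsilon>)"
    and A: "\<exists>K::real. \<forall>\<epsilon>\<in>{0<..1}. let S = T / \<epsilon> powr \<beta> in
        Linf_time_norm S (\<lambda>u. W1inf_norm a b u + Hper_norm a b m u) (\<psi> \<epsilon>)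
      + Linf_time_norm S (Hper_norm a b 1) (dt S (\<psi> \<epsilon>))
      + Linf_time_norm S (Hper_norm a b 1) (dt S (dt S (\<psi> \<epsilon>))) \<le> ennreal K"
    and B: "\<exists>K::real. \<forall>\<epsilon>\<in>{0<..1}. Hper_norm a b (m + 2) (\<psi>0 \<epsilon>) \<le> ennreal K"
  shows "\<exists>h0>0. \<exists>\<tau>0>0. \<exists>C>0. \<forall>(M::nat) h \<tau> \<epsilon> (n::nat).
      even M \<longrightarrow> 0 < M \<longrightarrow> h = (b - a) / real M \<longrightarrow> h < h0 \<longrightarrow>
      0 < \<tau> \<longrightarrow> \<tau> < \<tau>0 \<longrightarrow> 0 < \<epsilon> \<longrightarrow> \<epsilon> \<le> 1 \<longrightarrow>
      real n \<le> T / \<epsilon> powr \<beta> / \<tau> \<longrightarrow>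
      (let M1 = (SUP \<epsilon>\<in>{0<..1}. SUP t\<in>{0..T / \<epsilon> powr \<beta>}. Linf_norm a b (\<lambda>x. \<psi> \<epsilon> x t));
           U = ewi_fp a b \<alpha> \<epsilon> \<tau> M (\<psi>0 \<epsilon>) (\<psi>1 \<epsilon>) n
       in
        Hper_norm a b 1 (\<lambda>x. \<psi> \<epsilon> x (real n * \<tau>) - trig_interp a b M U x)
          \<le> ennreal (C * (h ^ (m - 1) + \<epsilon> powr (2 - \<beta>) * \<tau>\<^sup>2)) \<and>
        ennreal (grid_max_norm M U) \<le> 1 + M1)"
proof -
  let ?M1 = "SUP \<epsilon>\<in>{0<..1}. SUP t\<in>{0..T / \<epsilon> powr \<beta>}. Linf_norm a b (\<lambda>x. \<psi> \<epsilon> x t)"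
  obtain K0 :: real where K0: "\<And>\<epsilon>. \<epsilon> \<in> {0<..1} \<Longrightarrow> let S = T / \<epsilon> powr \<beta> in
        Linf_time_norm S (\<lambda>u. W1inf_norm a b u + Hper_norm a b m u) (\<psi> \<epsilon>)
      + Linf_time_norm S (Hper_norm a b 1) (dt S (\<psi> \<epsilon>))
      + Linf_time_norm S (Hper_norm a b 1) (dt S (dt S (\<psi> \<epsilon>))) \<le> ennreal K0"
    using A by blast
  \<comment> \<open>\<open>ennreal\<close> sends negative numbers to 0, so passing to the positive
    part of \<open>K0\<close> leaves the bound unchanged.\<close>
  define K where "K = max K0 0"
  have K: "0 \<le> K" "ennreal K0 \<le> ennreal K" by (auto simp: K_def intro: ennreal_leI)
  define k where "k = m - 2"
  have m: "m = Suc (Suc k)" using \<open>2 \<le> m\<close> by (simp add: k_def)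
  have bounded: "nlsw_bounded a b \<alpha> \<epsilon> (T / \<epsilon> powr \<beta>) T K k (\<psi>0 \<epsilon>) (\<psi>1 \<epsilon>) (\<psi> \<epsilon>)"
    if \<epsilon>: "0 < \<epsilon>" "\<epsilon> \<le> 1" for \<epsilon>
  proof -
    define S where "S = T / \<epsilon> powr \<beta>"
    note scales = eps_powr_horizon[OF \<epsilon> \<open>0 \<le> \<beta>\<close> \<open>\<beta> \<le> 2\<close> \<open>0 < T\<close>]
    have S: "0 < S" using \<open>0 < T\<close> \<epsilon>(1) by (simp add: S_def)
    interpret nlsw_modes a b \<alpha>
      using assms(1-3) by unfold_locales
    have sol\<epsilon>: "nlsw_solution a b \<alpha> \<epsilon> S (\<psi>0 \<epsilon>) (\<psi>1 \<epsilon>) (\<psi> \<epsilon>)"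
      unfolding S_def by (rule sol[OF \<epsilon>])
    then have cont: "continuous_on ({a..b} \<times> {0..S}) (\<lambda>(x, t). \<psi> \<epsilon> x t)"
      "continuous_on ({a..b} \<times> {0..S}) (\<lambda>(x, t). dt S (\<psi> \<epsilon>) x t)"
      "continuous_on ({a..b} \<times> {0..S}) (\<lambda>(x, t). dt S (dt S (\<psi> \<epsilon>)) x t)"
      by (auto simp: nlsw_solution_def C1_time_def)
    have le: "Linf_time_norm S (\<lambda>u. W1inf_norm a b u + Hper_norm a b m u) (\<psi> \<epsilon>)
      + Linf_time_norm S (Hper_norm a b 1) (dt S (\<psi> \<epsilon>))
      + Linf_time_norm S (Hper_norm a b 1) (dt S (dt S (\<psi> \<epsilon>))) \<le> ennreal K" (is "?X + ?Y + ?Z \<le> _")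
      using K0[of \<epsilon>] \<epsilon> K(2) by (auto simp: Let_def S_def intro: order_trans)
    have parts: "?X \<le> ennreal K" "?Y \<le> ennreal K" "?Z \<le> ennreal K"
      by (rule order_trans[OF _ le]; simp add: add_increasing add_increasing2)+
    show ?thesis
      unfolding S_def[symmetric]
    proof
      show "0 < T" "0 < \<epsilon>" "\<epsilon> \<le> 1" by fact+
      show "T \<le> S" "\<epsilon>\<^sup>2 * S \<le> T" using scales \<open>0 < T\<close> by (simp_all add: S_def mult_left_le)
      show "nlsw_solution a b \<alpha> \<epsilon> S (\<psi>0 \<epsilon>) (\<psi>1 \<epsilon>) (\<psi> \<epsilon>)" by (rule sol\<epsilon>)
      fix t assume t: "t \<in> {0..S}"
      show "Hbound (Suc (Suc k)) K (fc (\<lambda>x. \<psi> \<epsilon> x t))"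
        by (rule Hbound_of_Linf_time_norm[OF S K(1) cont(1) parts(1) _ t]) (simp add: m add_increasing)
      show "Hbound 1 K (fc (\<lambda>x. dt S (\<psi> \<epsilon>) x t))"
        by (rule Hbound_of_Linf_time_norm[OF S K(1) cont(2) parts(2) order_refl t])
      show "Hbound 1 K (fc (\<lambda>x. dt S (dt S (\<psi> \<epsilon>)) x t))"
        by (rule Hbound_of_Linf_time_norm[OF S K(1) cont(3) parts(3) order_refl t])
    qed
  qed
  \<comment> \<open>Outside the locale the constant takes just these arguments, which shows its
    independence of \<epsilon>, \<open>M\<close> and \<tau>.\<close>
  define C0 where "C0 = ewi_run.error_const a b \<alpha> T K k"
  define sc where "sc = periodic_interval.sobolev_const a b"
  have nonneg: "0 \<le> C0" "1 \<le> sc"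
  proof -
    \<comment> \<open>One instance, with \<epsilon> = 1, \<open>M = 2\<close> and \<tau> = 1,
      suffices to obtain the signs of the constants.\<close>
    interpret nlsw_bounded a b \<alpha> 1 "T / 1 powr \<beta>" T K k "\<psi>0 1" "\<psi>1 1" "\<psi> 1"
      by (rule bounded) auto
    interpret ewi_run a b \<alpha> 1 "T / 1 powr \<beta>" T K k "\<psi>0 1" "\<psi>1 1" "\<psi> 1" 2 1
      by unfold_locales auto
    show "0 \<le> C0" "1 \<le> sc" unfolding C0_def sc_def by (rule error_const_nonneg sobolev_const_ge_1)+
  qed
  \<comment> \<open>The assumption \<open>small\<close> of \<open>energy_bound\<close> reads
    \<open>Q * h ^ Suc k + R * \<tau>\<^sup>2 \<le> 1\<close>.\<close>
  define Q where "Q = sc * (C0 + K)"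
  define R where "R = sc * (C0 * T)"
  have QR: "0 \<le> Q" "0 \<le> R"
    using nonneg K(1) \<open>0 < T\<close> by (auto simp: Q_def R_def)
  \<comment> \<open>\<open>C0 * (1 + T)\<close> covers both terms of the energy bound, since
    \<open>\<epsilon>\<^sup>2 * S = T * \<epsilon> powr (2 - \<beta>)\<close>; \<open>K\<close>
    covers the tail, and 1 makes \<open>C\<close> positive.\<close>
  define C where "C = C0 * (1 + T) + K + 1"
  have C: "0 < C" using nonneg K(1) \<open>0 < T\<close> by (simp add: C_def add_nonneg_pos)
  show ?thesis
  proof (intro exI conjI allI impI)
    \<comment> \<open>Below these thresholds \<open>h\<close> and \<tau> are less than 1, and
      \<open>Q * h\<close> and \<open>R * \<tau>\<close> are each at most 1/2.\<close>
    show "0 < 1 / (2 * Q + 1)" "0 < 1 / (2 * R + 1)" "0 < C" using QR C by auto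
    fix M :: nat and h \<tau> \<epsilon> :: real and n :: nat
    assume Ms: "even M" "0 < M" and h: "h = (b - a) / real M" "h < 1 / (2 * Q + 1)"
      and taus: "0 < \<tau>" "\<tau> < 1 / (2 * R + 1)" and \<epsilon>: "0 < \<epsilon>" "\<epsilon> \<le> 1"
      and n: "real n \<le> T / \<epsilon> powr \<beta> / \<tau>"
    define S where "S = T / \<epsilon> powr \<beta>"
    note scales = eps_powr_horizon[OF \<epsilon> \<open>0 \<le> \<beta>\<close> \<open>\<beta> \<le> 2\<close> \<open>0 < T\<close>]
    interpret nlsw_bounded a b \<alpha> \<epsilon> S T K k "\<psi>0 \<epsilon>" "\<psi>1 \<epsilon>" "\<psi> \<epsilon>"
      unfolding S_def by (rule bounded[OF \<epsilon>])
    interpret ewi_run a b \<alpha> \<epsilon> S T K k "\<psi>0 \<epsilon>" "\<psi>1 \<epsilon>" "\<psi> \<epsilon>" M \<tau>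
      using Ms taus by unfold_locales auto
    have nS: "real n * \<tau> \<le> S"
      using n unfolding S_def pos_le_divide_eq[OF taus(1)] .
    have h0: "0 < h" using h_pos h(1) by simp
    have "h < 1" using h(2) QR(1) by (auto intro: less_le_trans simp: divide_le_eq)
    then have hk: "h ^ Suc k \<le> h" using h0 power_decreasing[of 1 "Suc k" h] by simp
    have "\<tau> < 1" using taus(2) QR(2) by (auto intro: less_le_trans simp: divide_le_eq)
    then have \<tau>2: "\<tau>\<^sup>2 \<le> \<tau>" using taus(1) by (simp add: power2_eq_square mult_left_le)
    have half: "q * x \<le> 1 / 2" if "0 \<le> q" "x < 1 / (2 * q + 1)" for q x :: real
    proof -
      have "q * x \<le> q * (1 / (2 * q + 1))" using that by (intro mult_left_mono) auto
      also have "\<dots> \<le> 1 / 2" using that(1) by (simp add: field_simps)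
      finally show ?thesis .
    qed
    have "sc * (C0 * (h ^ Suc k + T * \<tau>\<^sup>2) + h ^ Suc k * K) = Q * h ^ Suc k + R * \<tau>\<^sup>2"
      by (simp add: Q_def R_def algebra_simps)
    also have "\<dots> \<le> Q * h + R * \<tau>"
      using hk \<tau>2 QR by (intro add_mono mult_left_mono)
    also have "\<dots> \<le> 1" using half[OF QR(1) h(2)] half[OF QR(2) taus(2)] by simp
    finally have bound: "energy n \<le> C0 * (h ^ Suc k + \<epsilon>\<^sup>2 * S * \<tau>\<^sup>2)" "grid_error_le n 1"
      using energy_bound[OF _ nS] unfolding C0_def sc_def h(1) by auto
    define U where "U = ewi_fp a b \<alpha> \<epsilon> \<tau> M (\<psi>0 \<epsilon>) (\<psi>1 \<epsilon>) n"
    define \<eta> where "\<eta> = \<epsilon> powr (2 - \<beta>)"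
    have "\<epsilon>\<^sup>2 * S = T * \<eta>" using scales(2) by (simp add: S_def \<eta>_def)
    then have "energy n + h ^ Suc k * K \<le> C0 * (h ^ Suc k + T * (\<eta> * \<tau>\<^sup>2)) + h ^ Suc k * K"
      using bound(1) by (simp only: mult.assoc add_le_cancel_right)
    also have "\<dots> \<le> C * (h ^ (m - 1) + \<eta> * \<tau>\<^sup>2)"
    proof -
      have "0 \<le> h ^ Suc k" "0 \<le> \<eta>" using h0 by (simp_all add: \<eta>_def)
      then have "0 \<le> (C0 * T + 1) * h ^ Suc k + (C0 + K + 1) * (\<eta> * \<tau>\<^sup>2)"
        using nonneg K(1) \<open>0 < T\<close> by (intro add_nonneg_nonneg mult_nonneg_nonneg) auto
      then show ?thesis by (simp add: C_def m algebra_simps)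
    qed
    finally have E: "energy n + h ^ Suc k * K \<le> C * (h ^ (m - 1) + \<eta> * \<tau>\<^sup>2)" .
    have "Hper_norm a b 1 (\<lambda>x. \<psi> \<epsilon> x (real n * \<tau>) - trig_interp a b M U x) \<le> ennreal (energy n + h ^ Suc k * K)"
      unfolding U_def h(1) by (rule Hper_norm_le[OF solution_error(1,2)[OF nS]])
    also have "\<dots> \<le> ennreal (C * (h ^ (m - 1) + \<epsilon> powr (2 - \<beta>) * \<tau>\<^sup>2))"
      using E by (simp add: \<eta>_def ennreal_leI)
    finally have 1: "Hper_norm a b 1 (\<lambda>x. \<psi> \<epsilon> x (real n * \<tau>) - trig_interp a b M U x)
      \<le> ennreal (C * (h ^ (m - 1) + \<epsilon> powr (2 - \<beta>) * \<tau>\<^sup>2))" .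
    obtain j where j: "j < M" "grid_max_norm M U = cmod (U j)"
      using grid_max_norm_attained[OF Ms(2)] .
    let ?t = "real n * \<tau>"
    have t: "?t \<in> {0..S}" using nS taus(1) by simp
    have "cmod (U j) \<le> 1 + cmod (\<psi> \<epsilon> (xg j) ?t)"
      using bound(2) j(1) norm_triangle_ineq4[of "\<psi> \<epsilon> (xg j) ?t" "\<psi> \<epsilon> (xg j) ?t - U j"]
      by (force simp: grid_error_le_def U_def)
    then have "ennreal (cmod (U j)) \<le> ennreal (1 + cmod (\<psi> \<epsilon> (xg j) ?t))"
      by (rule ennreal_leI)
    also have "\<dots> = 1 + ennreal (cmod (\<psi> \<epsilon> (xg j) ?t))"
      by (simp add: ennreal_plus)
    also have "ennreal (cmod (\<psi> \<epsilon> (xg j) ?t)) \<le> Linf_norm a b (\<lambda>x. \<psi> \<epsilon> x ?t)"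
      by (rule norm_le_Linf_norm[OF continuous_on_section[OF cont t] xg_in[OF j(1)]])
    also have "\<dots> \<le> (SUP t\<in>{0..T / \<epsilon> powr \<beta>}. Linf_norm a b (\<lambda>x. \<psi> \<epsilon> x t))"
      using t by (intro SUP_upper) (simp add: S_def)
    also have "\<dots> \<le> ?M1"
      using \<epsilon> by (intro SUP_upper2[OF _ order_refl]) auto
    finally have 2: "ennreal (grid_max_norm M U)
        \<le> 1 + ?M1"
      unfolding j(2) by (simp add: add_left_mono)
    show "let M1 = (SUP \<epsilon>\<in>{0<..1}. SUP t\<in>{0..T / \<epsilon> powr \<beta>}. Linf_norm a b (\<lambda>x. \<psi> \<epsilon> x t));
           U = ewi_fp a b \<alpha> \<epsilon> \<tau> M (\<psi>0 \<epsilon>) (\<psi>1 \<epsilon>) n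
       in
        Hper_norm a b 1 (\<lambda>x. \<psi> \<epsilon> x (real n * \<tau>) - trig_interp a b M U x)
          \<le> ennreal (C * (h ^ (m - 1) + \<epsilon> powr (2 - \<beta>) * \<tau>\<^sup>2)) \<and>
        ennreal (grid_max_norm M U) \<le> 1 + M1"
      using 1 2 by (simp add: Let_def U_def)
  qed
qed

end
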